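(* Fix an integer $m\ge1$. Let $\mathcal P_n$ be the total number of pairs of parallel edges in $G_m^n$, that is, the number of unordered pairs of distinct non-loop edges of $G_m^n$ having the same two (distinct) endpoints. Then with high probability $\mathcal P_n$ is asymptotic to $\frac{m^2-1}{16}\log^2 n$, i.e. $$\frac{\mathcal P_n}{\log^2 n}\longrightarrow\frac{m^2-1}{16}\quad\text{in probability as } n\to\infty.$$ Thus with high probability the operation of identifying parallel edges (replacing every class of parallel edges by a single edge) reduces the edge count by $\Theta(\log^2n)$.
   Context: Bollobás–Riordan preferential attachment multigraph $G_m^n$. Let $w_1,\dots,w_{mn+1}$ be independent exponential random variables with mean $1$, $W_k=\sum_{i=1}^k w_i$, $W_0=0$. Put $R_k=W_k/W_{mn+1}$ for $k=1,\dots,mn$, $R_0=0$. Conditionally on $\mathbf W=\{W_k\}$, let $\ell_1,\dots,\ell_{mn}$ be independent, $\ell_k$ having density $\frac{1}{2\sqrt{R_k x}}$ on $(0,R_k]$. The vertex set of $G_m^n$ is $[n]=\{1,\dots,n\}$; vertex $j$ is identified with the interval $(R_{m(j-1)},R_{mj}]$. For each $k\in[mn]$ there is one edge joining the vertex containing $R_k$ with the vertex containing $\ell_k$ (a loop if these coincide). "With high probability" means with probability tending to $1$ as $n\to\infty$.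
   Formalization: The lower half of the Θ(log² n) bound on the edge-count reduction is stated only for m ≥ 2, since for m = 1 there are almost surely no parallel edges and the reduction is 0; the limit in probability and the O(log² n) bound are for all m ≥ 1. *)

theory Defs
  imports "HOL-Probability.Probability"
begin

text \<open>
  A multigraph is a set \<open>E\<close> of edge names with a map \<open>ends\<close> sending an edge to the set of its
  endpoints; this set is a singleton exactly when the edge is a loop. Loops are never parallel.
\<close>

definition parallel_edges :: "('e \<Rightarrow> 'v set) \<Rightarrow> 'e \<Rightarrow> 'e \<Rightarrow> bool" where
  "parallel_edges ends j k \<longleftrightarrow> j \<noteq> k \<and> card (ends j) = 2 \<and> ends j = ends k"

definition num_parallel_pairs :: "'e set \<Rightarrow> ('e \<Rightarrow> 'v set) \<Rightarrow> nat" where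
  "num_parallel_pairs E ends = card {{j, k} | j k. j \<in> E \<and> k \<in> E \<and> parallel_edges ends j k}"

definition identified_edges :: "'e set \<Rightarrow> ('e \<Rightarrow> 'v set) \<Rightarrow> 'e set set" where
  "identified_edges E ends = E // {(j, k). j \<in> E \<and> k \<in> E \<and> (j = k \<or> parallel_edges ends j k)}"

definition edge_reduction :: "'e set \<Rightarrow> ('e \<Rightarrow> 'v set) \<Rightarrow> real" where
  "edge_reduction E ends = real (card E) - real (card (identified_edges E ends))"

text \<open>In the following, \<open>N\<close> stands for the number \<open>m * n\<close> of edges.\<close>

definition partial_W :: "(nat \<Rightarrow> 'a \<Rightarrow> real) \<Rightarrow> nat \<Rightarrow> 'a \<Rightarrow> real" where
  "partial_W w k \<omega> = (\<Sum>i=1..k. w i \<omega>)"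

definition ratio_R :: "nat \<Rightarrow> (nat \<Rightarrow> 'a \<Rightarrow> real) \<Rightarrow> nat \<Rightarrow> 'a \<Rightarrow> real" where
  "ratio_R N w k \<omega> = partial_W w k \<omega> / partial_W w (N + 1) \<omega>"

definition attach_density :: "real \<Rightarrow> real \<Rightarrow> real" where
  "attach_density r x = (if 0 < x \<and> x \<le> r then 1 / (2 * sqrt (r * x)) else 0)"

definition sigma_W :: "'a measure \<Rightarrow> nat \<Rightarrow> (nat \<Rightarrow> 'a \<Rightarrow> real) \<Rightarrow> 'a measure" where
  "sigma_W M N w =
     vimage_algebra (space M) (\<lambda>\<omega>. \<lambda>k\<in>{1..N + 1}. partial_W w k \<omega>)
       (Pi\<^sub>M {1..N + 1} (\<lambda>_. borel))"

text \<open>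
  The assumption \<open>cond_law\<close> says that, conditionally on the sigma-algebra generated by the \<open>W k\<close>,
  the \<open>l k\<close> are independent and \<open>l k\<close> has density \<open>attach_density (R k)\<close>.
\<close>

locale bollobas_riordan = prob_space M for M :: "'a measure" +
  fixes m n :: nat and w l :: "nat \<Rightarrow> 'a \<Rightarrow> real"
  assumes w_indep: "indep_vars (\<lambda>_. borel) w {1..m * n + 1}"
    and w_exponential:
      "\<And>i. i \<in> {1..m * n + 1} \<Longrightarrow> distributed M lborel (w i) (exponential_density 1)"
    and l_measurable: "\<And>k. k \<in> {1..m * n} \<Longrightarrow> random_variable borel (l k)"
    and cond_law:
      "\<And>B. (\<And>k. k \<in> {1..m * n} \<Longrightarrow> B k \<in> sets borel) \<Longrightarrow>
        AE \<omega> in M.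
          real_cond_exp M (sigma_W M (m * n) w)
            (indicator {\<omega> \<in> space M. \<forall>k\<in>{1..m * n}. l k \<omega> \<in> B k}) \<omega> =
          (\<Prod>k=1..m * n.
             measure (density lborel (attach_density (ratio_R (m * n) w k \<omega>))) (B k))"

definition vertex_of :: "nat \<Rightarrow> nat \<Rightarrow> (nat \<Rightarrow> 'a \<Rightarrow> real) \<Rightarrow> 'a \<Rightarrow> real \<Rightarrow> nat" where
  "vertex_of m n w \<omega> x =
     (THE j. j \<in> {1..n} \<and>
        x \<in> {ratio_R (m * n) w (m * (j - 1)) \<omega><..ratio_R (m * n) w (m * j) \<omega>})"

definition br_ends ::
    "nat \<Rightarrow> nat \<Rightarrow> (nat \<Rightarrow> 'a \<Rightarrow> real) \<Rightarrow> (nat \<Rightarrow> 'a \<Rightarrow> real) \<Rightarrow> 'a \<Rightarrow> nat \<Rightarrow> nat set" where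
  "br_ends m n w l \<omega> k =
     {vertex_of m n w \<omega> (ratio_R (m * n) w k \<omega>), vertex_of m n w \<omega> (l k \<omega>)}"

definition br_parallel_pairs ::
    "nat \<Rightarrow> nat \<Rightarrow> (nat \<Rightarrow> 'a \<Rightarrow> real) \<Rightarrow> (nat \<Rightarrow> 'a \<Rightarrow> real) \<Rightarrow> 'a \<Rightarrow> nat" where
  "br_parallel_pairs m n w l \<omega> = num_parallel_pairs {1..m * n} (br_ends m n w l \<omega>)"

definition br_edge_reduction ::
    "nat \<Rightarrow> nat \<Rightarrow> (nat \<Rightarrow> 'a \<Rightarrow> real) \<Rightarrow> (nat \<Rightarrow> 'a \<Rightarrow> real) \<Rightarrow> 'a \<Rightarrow> real" where
  "br_edge_reduction m n w l \<omega> = edge_reduction {1..m * n} (br_ends m n w l \<omega>)"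

definition with_high_probability ::
    "(nat \<Rightarrow> 'a measure) \<Rightarrow> (nat \<Rightarrow> 'a \<Rightarrow> bool) \<Rightarrow> bool" where
  "with_high_probability M Q \<longleftrightarrow>
     (\<lambda>n. measure (M n) {\<omega> \<in> space (M n). Q n \<omega>}) \<longlonglongrightarrow> 1"

definition tendsto_in_probability ::
    "(nat \<Rightarrow> 'a measure) \<Rightarrow> (nat \<Rightarrow> 'a \<Rightarrow> real) \<Rightarrow> real \<Rightarrow> bool" where
  "tendsto_in_probability M X c \<longleftrightarrow>
     (\<forall>\<epsilon>>0. (\<lambda>n. measure (M n) {\<omega> \<in> space (M n). \<bar>X n \<omega> - c\<bar> > \<epsilon>}) \<longlonglongrightarrow> 0)"

end

theory Submission
  imports Defs
begin

text \<open>
  Write \<open>l k = R k * (u k)\<^sup>2\<close> with \<open>u k\<close> uniform on \<open>(0, 1]\<close>, independent of each other and of \<open>w\<close>.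
  Two edges are parallel iff they start in the same block \<open>i\<close> of \<open>m\<close> consecutive edges and attach to
  the same vertex \<open>j < i\<close>. Given \<open>w\<close>, the number of parallel pairs is therefore a sum of independent
  bounded contributions of the blocks, with conditional mean
  \<open>Y = (\<Sum>i. \<Sum>(k, k') in block i. \<Sum>j<i. (sqrt (W (m j)) - sqrt (W (m (j - 1))))\<^sup>2 / sqrt (W k * W k'))\<close>,
  and its conditional variance is at most a constant times \<open>Y\<close>; so it suffices that
  \<open>Y / ln\<^sup>2 n\<close> tends to \<open>(m\<^sup>2 - 1) / 16\<close> in probability.

  By a fourth moment bound, with probability close to \<open>1\<close> all \<open>W k\<close> with \<open>k\<close> beyond a large constant are
  within a factor \<open>1 \<plusminus> \<epsilon>\<close> of \<open>k\<close>. On this event \<open>Y\<close> is, up to a factor close to \<open>1\<close> and an error \<open>O(ln n)\<close>,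
  equal to \<open>(m - 1) / (8 m)\<close> times \<open>T = (\<Sum>j<i\<le>n. D j\<^sup>2 / (i j))\<close>, where the \<open>D j = W (m j) - W (m (j - 1))\<close> are
  independent with \<open>E (D j\<^sup>2) = m (m + 1)\<close>. Chebyshev's inequality gives \<open>T \<sim> m (m + 1) / 2 * ln\<^sup>2 n\<close>.

  Identifying parallel edges removes at most one edge per parallel pair, and at least one edge per
  \<open>m\<close> parallel pairs because a class of parallel edges has at most \<open>m\<close> elements.
\<close>

section \<open>Pairs of parallel edges and the number of identified edges\<close>

text \<open>The weights must be controlled at all block ends at once. The variance of
  \<open>W (m * i)\<close> is \<open>m * i\<close>, so Chebyshev's inequality would leave a union
  bound over the divergent series of \<open>1 / i\<close>; the fourth central moment gives
  \<open>1 / i^2\<close>, whose tail beyond \<open>i0\<close> is small uniformly in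
  \<open>n\<close>. Hence \<epsilon> and \<open>i0\<close> can be fixed before \<open>n\<close>
  grows, and the first \<open>i0\<close> blocks contribute only a bounded number of pairs.

  The substitution \<open>R k * (u k)^2\<close> inverts the distribution function
  \<open>sqrt (x / R k)\<close> of the attachment density. Only a conditional law of the
  \<open>l k\<close> is given, so the \<open>u k\<close> are not constructed on the original space:
  the joint law of weights and attachment points is identified with that of a model on a product
  space, and events of the graph are transferred.

  Origin of the constant: a block has \<open>m * (m - 1) / 2\<close> pairs,
  \<open>1 / sqrt (W k * W k')\<close> is about \<open>1 / (m * i)\<close>, and the squared
  difference of roots is about \<open>D j^2 / (4 * m * j)\<close>. The product of the coefficients
  is \<open>(m - 1) / (8 * m)\<close>; multiplied by \<open>m * (m + 1) / 2\<close> it is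
  \<open>(m^2 - 1) / 16\<close>.\<close>

lemma parallel_edges_commute: "parallel_edges ends j k \<longleftrightarrow> parallel_edges ends k j"
  by (auto simp: parallel_edges_def)

lemma num_parallel_pairs_cong:
  assumes "\<And>k. k \<in> E \<Longrightarrow> f k = g k"
  shows "num_parallel_pairs E f = num_parallel_pairs E g"
proof -
  have "{{j, k} | j k. j \<in> E \<and> k \<in> E \<and> parallel_edges f j k}
      = {{j, k} | j k. j \<in> E \<and> k \<in> E \<and> parallel_edges g j k}"
    unfolding parallel_edges_def using assms by (intro Collect_cong) metis
  then show ?thesis by (simp add: num_parallel_pairs_def)
qed

lemma edge_reduction_cong:
  assumes "\<And>k. k \<in> E \<Longrightarrow> f k = g k"
  shows "edge_reduction E f = edge_reduction E g"
proof -
  have "{(j, k). j \<in> E \<and> k \<in> E \<and> (j = k \<or> parallel_edges f j k)}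
      = {(j, k). j \<in> E \<and> k \<in> E \<and> (j = k \<or> parallel_edges g j k)}"
    unfolding parallel_edges_def using assms by (intro Collect_cong) (auto, (metis+)?)
  then show ?thesis by (simp add: edge_reduction_def identified_edges_def)
qed

lemma num_parallel_pairs_eq_card:
  fixes E :: "'e::linorder set"
  shows "num_parallel_pairs E ends = card {(j, k). j \<in> E \<and> k \<in> E \<and> j < k \<and> parallel_edges ends j k}"
proof -
  let ?S = "{(j, k). j \<in> E \<and> k \<in> E \<and> j < k \<and> parallel_edges ends j k}"
  have "{{j, k} | j k. j \<in> E \<and> k \<in> E \<and> parallel_edges ends j k} = (\<lambda>(j, k). {j, k}) ` ?S"
  proof (intro equalityI subsetI)
    fix x assume "x \<in> {{j, k} | j k. j \<in> E \<and> k \<in> E \<and> parallel_edges ends j k}"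
    then obtain j k where x: "x = {j, k}" "j \<in> E" "k \<in> E" "parallel_edges ends j k" by blast
    then have "j \<noteq> k" by (auto simp: parallel_edges_def)
    then consider "j < k" | "k < j" by fastforce
    then show "x \<in> (\<lambda>(j, k). {j, k}) ` ?S"
    proof cases
      case 1
      then show ?thesis using x by (auto intro!: image_eqI[of _ _ "(j, k)"])
    next
      case 2
      then show ?thesis using x parallel_edges_commute[of ends j k]
        by (auto intro!: image_eqI[of _ _ "(k, j)"])
    qed
  qed auto
  moreover have "inj_on (\<lambda>(j, k). {j, k}) ?S"
    by (auto simp: inj_on_def doubleton_eq_iff)
  ultimately show ?thesis by (simp add: num_parallel_pairs_def card_image)
qed

text \<open>Charging each pair to its larger edge makes the count comparable, edge by edge, with the
  number of edges lost by identification.\<close>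

lemma num_parallel_pairs_eq_sum:
  fixes E :: "'e::linorder set"
  assumes "finite E"
  shows "num_parallel_pairs E ends = (\<Sum>k\<in>E. card {j\<in>E. j < k \<and> parallel_edges ends j k})"
proof -
  have "card {(j, k). j \<in> E \<and> k \<in> E \<and> j < k \<and> parallel_edges ends j k}
      = card (SIGMA k:E. {j\<in>E. j < k \<and> parallel_edges ends j k})"
    by (intro bij_betw_same_card[of prod.swap]) (auto simp: bij_betw_def inj_on_def image_def)
  also have "\<dots> = (\<Sum>k\<in>E. card {j\<in>E. j < k \<and> parallel_edges ends j k})"
    using assms by (subst card_SigmaI) auto
  finally show ?thesis by (simp add: num_parallel_pairs_eq_card)
qed

text \<open>Each class of parallel edges is represented by its least edge.\<close>

lemma edge_reduction_eq_card:
  fixes E :: "'e::linorder set"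
  assumes "finite E"
  shows "edge_reduction E ends = real (card {k\<in>E. \<exists>j\<in>E. j < k \<and> parallel_edges ends j k})"
proof -
  define r where "r = {(j, k). j \<in> E \<and> k \<in> E \<and> (j = k \<or> parallel_edges ends j k)}"
  define N where "N = {k\<in>E. \<exists>j\<in>E. j < k \<and> parallel_edges ends j k}"
  have "bij_betw (\<lambda>k. r `` {k}) (E - N) (E // r)"
    unfolding bij_betw_def
  proof
    have "x = y" if "x \<in> E - N" "y \<in> E - N" "r `` {x} = r `` {y}" for x y
    proof (rule ccontr)
      assume "x \<noteq> y"
      have "y \<in> r `` {x}" using that by (auto simp: r_def)
      then have "parallel_edges ends x y" using \<open>x \<noteq> y\<close> by (auto simp: r_def)
      then show False using that \<open>x \<noteq> y\<close> parallel_edges_commute[of ends x y]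
        by (cases "x < y") (auto simp: N_def)
    qed
    then show "inj_on (\<lambda>k. r `` {k}) (E - N)" by (auto simp: inj_on_def)
    show "(\<lambda>k. r `` {k}) ` (E - N) = E // r"
    proof (intro equalityI subsetI)
      fix c assume "c \<in> E // r"
      then obtain x where x: "x \<in> E" "c = r `` {x}" by (auto elim: quotientE)
      define y where "y = Min c"
      have c: "finite c" "x \<in> c"
        using x assms by (auto simp: r_def intro: finite_subset[of _ E])
      then have "y \<in> c" unfolding y_def by (intro Min_in) auto
      have ry: "r `` {y} = c"
        using \<open>y \<in> c\<close> x by (auto simp: r_def parallel_edges_def)
      have "y \<notin> N"
      proof
        assume "y \<in> N"
        then obtain j where "j \<in> E" "j < y" "parallel_edges ends j y" by (auto simp: N_def)
        then have "j \<in> r `` {y}"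
          using \<open>y \<in> N\<close> parallel_edges_commute[of ends j y] by (auto simp: r_def N_def)
        then have "y \<le> j" using ry c unfolding y_def by (intro Min_le) auto
        then show False using \<open>j < y\<close> by simp
      qed
      moreover have "y \<in> E" using \<open>y \<in> c\<close> x by (auto simp: r_def)
      ultimately show "c \<in> (\<lambda>k. r `` {k}) ` (E - N)" using ry by auto
    qed (auto simp: quotient_def)
  qed
  then have "card (E // r) = card (E - N)" by (simp add: bij_betw_same_card)
  also have "\<dots> = card E - card N"
    using assms by (intro card_Diff_subset) (auto simp: N_def)
  finally have "card (identified_edges E ends) = card E - card N"
    by (simp add: identified_edges_def r_def)
  moreover have "card N \<le> card E" using assms by (intro card_mono) (auto simp: N_def)
  ultimately show ?thesis by (simp add: edge_reduction_def N_def of_nat_diff)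
qed

text \<open>A lost edge has a smaller parallel edge, so at least one pair is charged to it.\<close>

lemma edge_reduction_le_num_parallel_pairs:
  fixes E :: "'e::linorder set"
  assumes "finite E"
  shows "edge_reduction E ends \<le> real (num_parallel_pairs E ends)"
proof -
  have "card {k\<in>E. \<exists>j\<in>E. j < k \<and> parallel_edges ends j k}
      = (\<Sum>k\<in>E. if \<exists>j\<in>E. j < k \<and> parallel_edges ends j k then 1 else 0)"
    using assms by (simp add: sum.If_cases Collect_conj_eq)
  also have "\<dots> \<le> (\<Sum>k\<in>E. card {j\<in>E. j < k \<and> parallel_edges ends j k})"
    using assms by (intro sum_mono) (auto simp: Suc_le_eq card_gt_0_iff)
  finally show ?thesis
    using assms
    by (simp add: edge_reduction_eq_card num_parallel_pairs_eq_sum del: of_nat_sum)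
qed

text \<open>Pairs are charged to lost edges only, and at most \<open>d\<close> of them to each. For
  the random graph \<open>d\<close> will be the block length \<open>m\<close>.\<close>

lemma num_parallel_pairs_le_edge_reduction:
  fixes E :: "'e::linorder set"
  assumes "finite E" and d: "\<And>k. k \<in> E \<Longrightarrow> card {j\<in>E. j < k \<and> parallel_edges ends j k} \<le> d"
  shows "real (num_parallel_pairs E ends) \<le> real d * edge_reduction E ends"
proof -
  have "(\<Sum>k\<in>E. card {j\<in>E. j < k \<and> parallel_edges ends j k})
      \<le> (\<Sum>k\<in>E. if \<exists>j\<in>E. j < k \<and> parallel_edges ends j k then d else 0)"
    using assms by (intro sum_mono) (auto simp: card_eq_0_iff)
  also have "\<dots> = d * card {k\<in>E. \<exists>j\<in>E. j < k \<and> parallel_edges ends j k}"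
    using assms by (simp add: sum.If_cases Collect_conj_eq)
  finally have "num_parallel_pairs E ends \<le> d * card {k\<in>E. \<exists>j\<in>E. j < k \<and> parallel_edges ends j k}"
    using assms(1) by (simp add: num_parallel_pairs_eq_sum)
  then show ?thesis
    using assms(1) by (simp add: edge_reduction_eq_card flip: of_nat_mult)
qed

section \<open>The joint law of the weights and the attachment points\<close>

definition unit_uniform :: "real measure" where
  "unit_uniform = density lborel (indicator {0<..1})"

lemma space_unit_uniform [simp]: "space unit_uniform = UNIV"
  and sets_unit_uniform [measurable_cong, simp]: "sets unit_uniform = sets borel"
  by (simp_all add: unit_uniform_def)

lemma emeasure_unit_uniform:
  "B \<in> sets borel \<Longrightarrow> emeasure unit_uniform B = emeasure lborel ({0<..1} \<inter> B)"
  by (simp add: unit_uniform_def emeasure_density flip: indicator_inter_arith)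

lemma prob_space_unit_uniform: "prob_space unit_uniform"
  by standard (simp add: emeasure_unit_uniform)

lemma measure_unit_uniform_Ioc:
  assumes "0 \<le> a" "a \<le> b" "b \<le> 1"
  shows "measure unit_uniform {a<..b} = b - a"
proof -
  have "{0<..1} \<inter> {a<..b} = {a<..b}" using assms by auto
  then show ?thesis using assms by (simp add: measure_def emeasure_unit_uniform)
qed

lemma AE_unit_uniform: "AE u in unit_uniform. u \<in> {0<..1}"
  unfolding unit_uniform_def by (subst AE_density) (auto simp: indicator_def)

lemma attach_density_measurable [measurable]: "attach_density r \<in> borel_measurable borel"
  unfolding attach_density_def by measurable

text \<open>Substitute \<open>x = r * u^2\<close>: then \<open>sqrt (r * x) = r * u\<close>, and the
  Jacobian \<open>2 * r * u\<close> cancels the density. So the attachment point has the law of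
  \<open>r * u^2\<close> with \<open>u\<close> uniform.\<close>

lemma measure_attach_density:
  assumes r: "r > 0" and B: "B \<in> sets borel"
  shows "measure (density lborel (attach_density r)) B = measure unit_uniform {u. r * u\<^sup>2 \<in> B}"
proof -
  have [measurable]: "B \<in> sets borel" by fact
  have "emeasure (density lborel (attach_density r)) B
      = (\<integral>\<^sup>+x. ennreal (attach_density r x * indicator B x * indicator {r * 0\<^sup>2..r * 1\<^sup>2} x) \<partial>lborel)"
    by (simp add: emeasure_density)
       (intro nn_integral_cong, auto simp: attach_density_def indicator_def)
  also have "\<dots> = (\<integral>\<^sup>+u. ennreal (attach_density r (r * u\<^sup>2) * indicator B (r * u\<^sup>2) * (2 * r * u)
      * indicator {0..1} u) \<partial>lborel)"
  proof (rule nn_integral_substitution)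
    show "set_borel_measurable borel {r * 0\<^sup>2..r * 1\<^sup>2} (\<lambda>x. attach_density r x * indicator B x)"
      unfolding set_borel_measurable_def by measurable
  qed (use r in \<open>auto intro!: derivative_eq_intros continuous_intros\<close>)
  also have "\<dots> = (\<integral>\<^sup>+u. indicator ({0<..1} \<inter> {u. r * u\<^sup>2 \<in> B}) u \<partial>lborel)"
  proof (rule nn_integral_cong)
    fix u :: real
    \<comment> \<open>The substitution rule integrates over the closed interval, while the uniform
      law lives on the half-open one; at \<open>u = 0\<close> both sides vanish because
      \<open>attach_density r 0 = 0\<close>.\<close>
    consider "u \<notin> {0..1}" | "u = 0" | "u \<in> {0<..1}" by fastforce
    then show "ennreal (attach_density r (r * u\<^sup>2) * indicator B (r * u\<^sup>2) * (2 * r * u) * indicator {0..1} u)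
      = indicator ({0<..1} \<inter> {u. r * u\<^sup>2 \<in> B}) u"
    proof cases
      case 3
      then have "u\<^sup>2 \<le> 1" by (simp add: power_le_one)
      then have "r * u\<^sup>2 \<le> r" using r by simp
      moreover have "sqrt (r * (r * u\<^sup>2)) = r * u"
        using r 3 by (simp add: real_sqrt_mult power2_eq_square)
      ultimately show ?thesis using 3 r
        by (auto simp: attach_density_def indicator_def)
    qed (auto simp: indicator_def)
  qed
  also have "\<dots> = emeasure unit_uniform {u. r * u\<^sup>2 \<in> B}"
    by (subst emeasure_unit_uniform) (auto simp: nn_integral_indicator)
  finally show ?thesis by (simp add: measure_def)
qed

lemma partial_W_0 [simp]: "partial_W w 0 \<omega> = 0"
  and partial_W_Suc: "partial_W w (Suc k) \<omega> = partial_W w k \<omega> + w (Suc k) \<omega>"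
  by (simp_all add: partial_W_def)

lemma partial_W_strict_mono:
  assumes "\<forall>i\<in>{1..K}. 0 < w i \<omega>" "j < k" "k \<le> K"
  shows "partial_W w j \<omega> < partial_W w k \<omega>"
  using assms(2,3)
proof (induction k)
  case (Suc k)
  have "0 < w (Suc k) \<omega>" using assms(1) Suc.prems by auto
  then show ?case using Suc by (cases "j = k") (auto simp: partial_W_Suc)
qed simp

context bollobas_riordan
begin

declare One_nat_def [simp del]

abbreviation "N \<equiv> m * n"

lemma w_measurable [measurable]: "i \<in> {1..N + 1} \<Longrightarrow> random_variable borel (w i)"
  using w_exponential[THEN distributed_measurable] by simp

lemma partial_W_measurable [measurable]:
  "k \<le> N + 1 \<Longrightarrow> random_variable borel (partial_W w k)"
  unfolding partial_W_def[abs_def] by (intro borel_measurable_sum w_measurable) auto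

lemma ratio_R_measurable [measurable]:
  "k \<le> N + 1 \<Longrightarrow> random_variable borel (ratio_R N w k)"
  unfolding ratio_R_def[abs_def] by (intro borel_measurable_divide partial_W_measurable) auto

lemma AE_w_pos: "AE \<omega> in M. \<forall>i\<in>{1..N + 1}. 0 < w i \<omega>"
proof (intro AE_finite_allI)
  fix i assume "i \<in> {1..N + 1}"
  show "AE \<omega> in M. 0 < w i \<omega>"
  proof (rule distributed_AE2[THEN iffD2, OF w_exponential[OF \<open>i \<in> _\<close>]])
    show "AE x in lborel. 0 < ennreal (exponential_density 1 x) \<longrightarrow> 0 < x"
      using AE_lborel_singleton[of "0::real"]
      by eventually_elim (auto simp: exponential_density_def split: if_splits)
  qed measurable
qed simp

lemma AE_ratio_R_pos: "AE \<omega> in M. \<forall>k\<in>{1..N}. 0 < ratio_R N w k \<omega>"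
  using AE_w_pos
proof eventually_elim
  case (elim \<omega>)
  show ?case
    using partial_W_strict_mono[where w=w and \<omega>=\<omega>, OF elim, of 0] by (auto simp: ratio_R_def simp del: One_nat_def)
qed

abbreviation "U \<equiv> Pi\<^sub>M {1..N} (\<lambda>_. unit_uniform)"

abbreviation "coord \<equiv> Pi\<^sub>M {1..N + 1} (\<lambda>_. borel :: real measure) \<Otimes>\<^sub>M Pi\<^sub>M {1..N} (\<lambda>_. borel :: real measure)"

lemma prob_space_U: "prob_space U"
  by (intro prob_space_PiM prob_space_unit_uniform)

sublocale MU: pair_prob_space M U
  using prob_space_U
  by (intro pair_prob_space.intro pair_sigma_finite.intro) 
     (auto intro: prob_space_imp_sigma_finite prob_space_axioms)

lemma sigma_W_subalgebra: "subalgebra M (sigma_W M N w)"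
proof -
  have "(\<lambda>\<omega>. \<lambda>k\<in>{1..N + 1}. partial_W w k \<omega>) \<in> M \<rightarrow>\<^sub>M Pi\<^sub>M {1..N + 1} (\<lambda>_. borel)"
    by measurable
  from measurable_sets[OF this] show ?thesis
    unfolding subalgebra_def sigma_W_def sets_vimage_algebra
    by (auto intro!: sets.sigma_sets_subset simp del: One_nat_def)
qed

text \<open>The weights are increments of the partial sums, so every event of the weights may serve
  as a test set for the conditional expectation.\<close>

lemma w_measurable_sigma_W:
  assumes "i \<in> {1..N + 1}"
  shows "w i \<in> borel_measurable (sigma_W M N w)"
proof -
  have W: "(\<lambda>\<omega>. \<lambda>k\<in>{1..N + 1}. partial_W w k \<omega>) \<in> sigma_W M N w \<rightarrow>\<^sub>M Pi\<^sub>M {1..N + 1} (\<lambda>_. borel)"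
    unfolding sigma_W_def
    by (intro measurable_vimage_algebra1) (auto simp: space_PiM)
  have *: "partial_W w k \<in> borel_measurable (sigma_W M N w)" if "k \<le> N + 1" for k
  proof (cases "k = 0")
    case False
    then have k: "k \<in> {1..N + 1}" using that by auto
    show ?thesis
      using measurable_compose[OF W measurable_component_singleton[OF k]] k by (simp cong: measurable_cong)
  qed (simp add: partial_W_def[abs_def])
  have "w i \<omega> = partial_W w i \<omega> - partial_W w (i - 1) \<omega>" for \<omega>
    using assms partial_W_Suc[of w "i - 1" \<omega>] by auto
  then show ?thesis
    using assms by (subst measurable_cong[where g="\<lambda>\<omega>. partial_W w i \<omega> - partial_W w (i - 1) \<omega>"])
      (auto intro!: borel_measurable_diff *)
qed

text \<open>The defining property of conditional expectation, tested on an event of the weights,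
  brings in the product of the conditional probabilities from \<open>cond_law\<close>. By the
  substitution for a single attachment point this product is the measure of a box under
  \<open>U\<close>; it requires positive ratios and therefore holds for almost all sample
  points.\<close>

lemma emeasure_rectangle:
  assumes A: "A \<in> sets (Pi\<^sub>M {1..N + 1} (\<lambda>_. borel))" and B: "\<And>k. k \<in> {1..N} \<Longrightarrow> B k \<in> sets borel"
  shows "emeasure M {\<omega>\<in>space M. (\<lambda>i\<in>{1..N + 1}. w i \<omega>) \<in> A \<and> (\<lambda>k\<in>{1..N}. l k \<omega>) \<in> Pi\<^sub>E {1..N} B}
    = (\<integral>\<^sup>+\<omega>. indicator A (\<lambda>i\<in>{1..N + 1}. w i \<omega>) *
        emeasure U {u\<in>space U. \<forall>k\<in>{1..N}. ratio_R N w k \<omega> * (u k)\<^sup>2 \<in> B k} \<partial>M)"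
proof -
  interpret S: finite_measure_subalgebra M "sigma_W M N w"
    by standard (rule sigma_W_subalgebra)
  define A' where "A' = {\<omega>\<in>space M. (\<lambda>i\<in>{1..N + 1}. w i \<omega>) \<in> A}"
  define L where "L = {\<omega>\<in>space M. \<forall>k\<in>{1..N}. l k \<omega> \<in> B k}"
  define h where "h \<omega> = measure U {u\<in>space U. \<forall>k\<in>{1..N}. ratio_R N w k \<omega> * (u k)\<^sup>2 \<in> B k}" for \<omega>
  have space: "space (sigma_W M N w) = space M" by (simp add: sigma_W_def)
  have "(\<lambda>\<omega>. \<lambda>i\<in>{1..N + 1}. w i \<omega>) \<in> sigma_W M N w \<rightarrow>\<^sub>M Pi\<^sub>M {1..N + 1} (\<lambda>_. borel)"
    by (intro measurable_restrict w_measurable_sigma_W)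
  from measurable_sets[OF this A] have A': "A' \<in> sets (sigma_W M N w)"
    by (simp add: A'_def space vimage_def Int_def conj_commute)
  then have [measurable]: "A' \<in> sets M" using sigma_W_subalgebra by (auto simp: subalgebra_def)
  have [measurable]: "L \<in> sets M"
    unfolding L_def using B l_measurable by (intro sets.sets_Collect_finite_All) auto
  have "{z\<in>space (M \<Otimes>\<^sub>M U). \<forall>k\<in>{1..N}. ratio_R N w k (fst z) * (snd z k)\<^sup>2 \<in> B k} \<in> sets (M \<Otimes>\<^sub>M U)"
    using B by (intro sets.sets_Collect_finite_All) (auto, measurable)
  from MU.M2.measurable_emeasure_Pair[OF this]
  have "(\<lambda>\<omega>. emeasure U (Pair \<omega> -` {z\<in>space (M \<Otimes>\<^sub>M U). \<forall>k\<in>{1..N}. ratio_R N w k (fst z) * (snd z k)\<^sup>2 \<in> B k}))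
    \<in> borel_measurable M" .
  then have "(\<lambda>\<omega>. emeasure U {u\<in>space U. \<forall>k\<in>{1..N}. ratio_R N w k \<omega> * (u k)\<^sup>2 \<in> B k}) \<in> borel_measurable M"
    by (rule measurable_cong[THEN iffD1, rotated])
       (auto simp: space_pair_measure intro!: arg_cong[where f="emeasure U"])
  then have [measurable]: "h \<in> borel_measurable M"
    unfolding h_def[abs_def] measure_def by measurable
  have h_nonneg: "0 \<le> h \<omega>" and h_le: "h \<omega> \<le> 1" for \<omega>
    by (auto simp: h_def)
  have h: "h \<omega> = (\<Prod>k=1..N. measure (density lborel (attach_density (ratio_R N w k \<omega>))) (B k))"
    if "\<forall>k\<in>{1..N}. 0 < ratio_R N w k \<omega>" for \<omega>
  proof -
    interpret product_prob_space "\<lambda>_. unit_uniform" "{1..N}"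
      by (auto simp: product_prob_space_def product_prob_space_axioms_def product_sigma_finite_def
          intro: prob_space_unit_uniform prob_space_imp_sigma_finite)
    interpret finite_product_prob_space "\<lambda>_. unit_uniform" "{1..N}"
      by standard auto
    have "{u\<in>space U. \<forall>k\<in>{1..N}. ratio_R N w k \<omega> * (u k)\<^sup>2 \<in> B k}
        = (\<Pi>\<^sub>E k\<in>{1..N}. {u. ratio_R N w k \<omega> * u\<^sup>2 \<in> B k})"
      by (auto simp: space_PiM PiE_def extensional_def)
    then have "h \<omega> = (\<Prod>k\<in>{1..N}. measure unit_uniform {u. ratio_R N w k \<omega> * u\<^sup>2 \<in> B k})"
      unfolding h_def
    proof (subst finite_measure_PiM_emb[symmetric])
      fix k assume "k \<in> {1..N}"
      from B[OF this] have [measurable]: "B k \<in> sets borel" .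
      show "{u. ratio_R N w k \<omega> * u\<^sup>2 \<in> B k} \<in> sets unit_uniform" by measurable
    qed simp
    also have "\<dots> = (\<Prod>k=1..N. measure (density lborel (attach_density (ratio_R N w k \<omega>))) (B k))"
      using that B by (intro prod.cong refl measure_attach_density[symmetric]) auto
    finally show ?thesis .
  qed
  have "measure M (A' \<inter> L) = (\<integral>\<omega>\<in>A'. indicator L \<omega> \<partial>M)"
    unfolding set_lebesgue_integral_def by (simp flip: indicator_inter_arith)
  also have "\<dots> = (\<integral>\<omega>\<in>A'. real_cond_exp M (sigma_W M N w) (indicator L) \<omega> \<partial>M)"
    by (intro S.real_cond_exp_intA A') (auto simp: less_top[symmetric])
  also have "\<dots> = (\<integral>\<omega>. indicator A' \<omega> * h \<omega> \<partial>M)"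
    unfolding set_lebesgue_integral_def
  proof (rule integral_cong_AE)
    have "AE \<omega> in M. real_cond_exp M (sigma_W M N w) (indicator L) \<omega>
        = (\<Prod>k=1..N. measure (density lborel (attach_density (ratio_R N w k \<omega>))) (B k))"
      unfolding L_def by (rule cond_law) (use B in auto)
    then show "AE \<omega> in M. indicator A' \<omega> *\<^sub>R real_cond_exp M (sigma_W M N w) (indicator L) \<omega> = indicator A' \<omega> * h \<omega>"
      using AE_ratio_R_pos by eventually_elim (simp add: h)
  qed simp_all
  finally have "emeasure M (A' \<inter> L) = ennreal (\<integral>\<omega>. indicator A' \<omega> * h \<omega> \<partial>M)"
    by (simp add: emeasure_eq_measure)
  also have "\<dots> = (\<integral>\<^sup>+\<omega>. ennreal (indicator A' \<omega> * h \<omega>) \<partial>M)"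
    by (intro nn_integral_eq_integral[symmetric] integrable_const_bound[where B=1])
       (auto simp: indicator_def h_le h_nonneg)
  also have "\<dots> = (\<integral>\<^sup>+\<omega>. indicator A (\<lambda>i\<in>{1..N + 1}. w i \<omega>) *
        emeasure U {u\<in>space U. \<forall>k\<in>{1..N}. ratio_R N w k \<omega> * (u k)\<^sup>2 \<in> B k} \<partial>M)"
    by (intro nn_integral_cong) (auto simp: A'_def h_def indicator_def MU.M2.emeasure_eq_measure)
  also have "A' \<inter> L = {\<omega>\<in>space M. (\<lambda>i\<in>{1..N + 1}. w i \<omega>) \<in> A \<and> (\<lambda>k\<in>{1..N}. l k \<omega>) \<in> Pi\<^sub>E {1..N} B}"
    by (auto simp: A'_def L_def)
  finally show ?thesis .
qed

text \<open>The conditional law speaks about boxes only. The extension takes two rounds of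
  uniqueness of measures: for a fixed event \<open>A\<close> of the weights, from boxes to all
  measurable sets of attachment points; then from rectangles to the product sigma-algebra.\<close>

theorem joint_law:
  "distr M coord (\<lambda>\<omega>. (\<lambda>i\<in>{1..N + 1}. w i \<omega>, \<lambda>k\<in>{1..N}. l k \<omega>))
    = distr (M \<Otimes>\<^sub>M U) coord (\<lambda>(\<omega>, u). (\<lambda>i\<in>{1..N + 1}. w i \<omega>, \<lambda>k\<in>{1..N}. ratio_R N w k \<omega> * (u k)\<^sup>2))"
  (is "distr M coord ?X = distr (M \<Otimes>\<^sub>M U) coord ?Y")
proof -
  have X [measurable]: "?X \<in> M \<rightarrow>\<^sub>M coord"
    using l_measurable by (intro measurable_Pair measurable_restrict w_measurable) auto
  have Y [measurable]: "?Y \<in> M \<Otimes>\<^sub>M U \<rightarrow>\<^sub>M coord"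
    by (auto simp: case_prod_beta intro!: measurable_Pair measurable_restrict, measurable)
  have *: "emeasure (distr M coord ?X) (A \<times> X) = emeasure (distr (M \<Otimes>\<^sub>M U) coord ?Y) (A \<times> X)"
    if [measurable]: "A \<in> sets (Pi\<^sub>M {1..N + 1} (\<lambda>_. borel))" "X \<in> sets (Pi\<^sub>M {1..N} (\<lambda>_. borel))" for A X
  proof -
    define f where "f \<omega> = (indicator A (\<lambda>i\<in>{1..N + 1}. w i \<omega>) :: ennreal)" for \<omega>
    have [measurable]: "f \<in> borel_measurable M" unfolding f_def by measurable
    have [measurable]: "(\<lambda>\<omega>. \<lambda>k\<in>{1..N}. l k \<omega>) \<in> M \<rightarrow>\<^sub>M Pi\<^sub>M {1..N} (\<lambda>_. borel)"
      "(\<lambda>(\<omega>, u). \<lambda>k\<in>{1..N}. ratio_R N w k \<omega> * (u k)\<^sup>2) \<in> M \<Otimes>\<^sub>M U \<rightarrow>\<^sub>M Pi\<^sub>M {1..N} (\<lambda>_. borel)"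
      using measurable_compose[OF X measurable_snd] measurable_compose[OF Y measurable_snd]
      by (simp_all add: case_prod_beta)
    \<comment> \<open>\<open>P\<close> and \<open>Q\<close> are the laws of the attachment points
      restricted to the event \<open>A\<close> of the weights. They are finite measures of mass at
      most one, hence determined by their values on boxes.\<close>
    define P where "P = distr (density M f) (Pi\<^sub>M {1..N} (\<lambda>_. borel)) (\<lambda>\<omega>. \<lambda>k\<in>{1..N}. l k \<omega>)"
    define Q where "Q = distr (density (M \<Otimes>\<^sub>M U) (\<lambda>z. f (fst z))) (Pi\<^sub>M {1..N} (\<lambda>_. borel))
      (\<lambda>(\<omega>, u). \<lambda>k\<in>{1..N}. ratio_R N w k \<omega> * (u k)\<^sup>2)"
    have P: "emeasure P X = emeasure (distr M coord ?X) (A \<times> X)"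
      if [measurable]: "X \<in> sets (Pi\<^sub>M {1..N} (\<lambda>_. borel))" for X
    proof -
      have "emeasure P X = (\<integral>\<^sup>+\<omega>. indicator (?X -` (A \<times> X) \<inter> space M) \<omega> \<partial>M)"
        unfolding P_def by (subst emeasure_distr, simp, simp, subst emeasure_density, measurable)
          (intro nn_integral_cong, auto simp: f_def indicator_def)
      then show ?thesis by (simp add: emeasure_distr)
    qed
    have Q: "emeasure Q X = emeasure (distr (M \<Otimes>\<^sub>M U) coord ?Y) (A \<times> X)"
      if [measurable]: "X \<in> sets (Pi\<^sub>M {1..N} (\<lambda>_. borel))" for X
    proof -
      have "emeasure Q X = (\<integral>\<^sup>+z. indicator (?Y -` (A \<times> X) \<inter> space (M \<Otimes>\<^sub>M U)) z \<partial>(M \<Otimes>\<^sub>M U))"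
        unfolding Q_def by (subst emeasure_distr, simp, simp, subst emeasure_density, measurable)
          (intro nn_integral_cong, auto simp: f_def indicator_def)
      then show ?thesis by (simp add: emeasure_distr)
    qed
    have "P = Q"
    proof (rule measure_eqI_PiM_finite[where A="\<lambda>_. \<Pi>\<^sub>E k\<in>{1..N}. UNIV" and I="{1..N}" and M="\<lambda>_. borel"])
      fix B :: "nat \<Rightarrow> real set" assume B: "\<And>i. i \<in> {1..N} \<Longrightarrow> B i \<in> sets borel"
      then have [measurable]: "Pi\<^sub>E {1..N} B \<in> sets (Pi\<^sub>M {1..N} (\<lambda>_. borel))"
        by (intro sets_PiM_I_finite) auto
      have "emeasure P (Pi\<^sub>E {1..N} B)
        = emeasure M {\<omega>\<in>space M. (\<lambda>i\<in>{1..N + 1}. w i \<omega>) \<in> A \<and> (\<lambda>k\<in>{1..N}. l k \<omega>) \<in> Pi\<^sub>E {1..N} B}"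
        unfolding P[OF \<open>Pi\<^sub>E {1..N} B \<in> _\<close>]
        by (subst emeasure_distr) (auto intro!: arg_cong[where f="emeasure M"] simp: Pi_iff)
      also have "\<dots> = (\<integral>\<^sup>+\<omega>. indicator A (\<lambda>i\<in>{1..N + 1}. w i \<omega>) *
        emeasure U {u\<in>space U. \<forall>k\<in>{1..N}. ratio_R N w k \<omega> * (u k)\<^sup>2 \<in> B k} \<partial>M)"
        by (rule emeasure_rectangle) (use B in auto)
      also have "\<dots> = (\<integral>\<^sup>+\<omega>. emeasure U (Pair \<omega> -` (?Y -` (A \<times> Pi\<^sub>E {1..N} B) \<inter> space (M \<Otimes>\<^sub>M U))) \<partial>M)"
      proof (rule nn_integral_cong)
        fix \<omega> assume "\<omega> \<in> space M"
        then have "Pair \<omega> -` (?Y -` (A \<times> Pi\<^sub>E {1..N} B) \<inter> space (M \<Otimes>\<^sub>M U)) =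
          (if (\<lambda>i\<in>{1..N + 1}. w i \<omega>) \<in> A
           then {u\<in>space U. \<forall>k\<in>{1..N}. ratio_R N w k \<omega> * (u k)\<^sup>2 \<in> B k} else {})"
          by (auto simp: space_pair_measure PiE_iff)
        then show "indicator A (\<lambda>i\<in>{1..N + 1}. w i \<omega>) *
            emeasure U {u\<in>space U. \<forall>k\<in>{1..N}. ratio_R N w k \<omega> * (u k)\<^sup>2 \<in> B k}
          = emeasure U (Pair \<omega> -` (?Y -` (A \<times> Pi\<^sub>E {1..N} B) \<inter> space (M \<Otimes>\<^sub>M U)))"
          by (simp del: One_nat_def)
      qed
      also have "\<dots> = emeasure (M \<Otimes>\<^sub>M U) (?Y -` (A \<times> Pi\<^sub>E {1..N} B) \<inter> space (M \<Otimes>\<^sub>M U))"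
        by (intro MU.M2.emeasure_pair_measure_alt[symmetric]) measurable
      also have "\<dots> = emeasure Q (Pi\<^sub>E {1..N} B)"
        unfolding Q[OF \<open>Pi\<^sub>E {1..N} B \<in> _\<close>] by (intro emeasure_distr[symmetric]) auto
      finally show "emeasure P (Pi\<^sub>E {1..N} B) = emeasure Q (Pi\<^sub>E {1..N} B)" .
    next
      interpret D: prob_space "distr M coord ?X" by (rule prob_space_distr) (rule X)
      have "(\<Pi>\<^sub>E k\<in>{1..N}. UNIV) \<in> sets (Pi\<^sub>M {1..N} (\<lambda>_. borel::real measure))"
        by (intro sets_PiM_I_finite) auto
      then show "emeasure P (\<Pi>\<^sub>E k\<in>{1..N}. UNIV) \<noteq> \<infinity>" by (simp add: P del: One_nat_def)
      show "range (\<lambda>_::nat. \<Pi>\<^sub>E k\<in>{1..N}. UNIV) \<subseteq> prod_algebra {1..N} (\<lambda>_. borel::real measure)"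
        by (auto intro!: prod_algebraI_finite)
    qed (simp_all add: P_def Q_def space_PiM)
    with P[OF that(2)] Q[OF that(2)] show ?thesis by simp
  qed
  interpret D: prob_space "distr M coord ?X" by (rule prob_space_distr) (rule X)
  show ?thesis
  proof (rule measure_eqI_generator_eq)
    let ?E = "{a \<times> b | a b. a \<in> sets (Pi\<^sub>M {1..N + 1} (\<lambda>_. borel :: real measure))
      \<and> b \<in> sets (Pi\<^sub>M {1..N} (\<lambda>_. borel :: real measure))}"
    show "Int_stable ?E" by (rule Int_stable_pair_measure_generator)
    show "?E \<subseteq> Pow (space coord)"
      unfolding space_pair_measure by (rule pair_measure_closed)
    show "sets (distr M coord ?X) = sigma_sets (space coord) ?E"
      "sets (distr (M \<Otimes>\<^sub>M U) coord ?Y) = sigma_sets (space coord) ?E"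
      by (simp_all add: sets_pair_measure space_pair_measure)
    show "range (\<lambda>_::nat. space coord) \<subseteq> ?E"
      unfolding space_pair_measure by blast
    show "emeasure (distr M coord ?X) S = emeasure (distr (M \<Otimes>\<^sub>M U) coord ?Y) S" if "S \<in> ?E" for S
      using that * by auto
  qed auto
qed

end

section \<open>Measurability of graph events and their transfer to the product model\<close>

lemma ratio_R_cong:
  assumes "\<And>i. i \<in> {1..N + 1} \<Longrightarrow> w i \<omega> = w' i \<omega>'" "k \<le> N + 1"
  shows "ratio_R N w k \<omega> = ratio_R N w' k \<omega>'"
proof -
  have "partial_W w k \<omega> = partial_W w' k \<omega>'" if "k \<le> N + 1" for k
    unfolding partial_W_def using that assms(1) by (intro sum.cong) auto
  then show ?thesis using assms(2) by (simp add: ratio_R_def)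
qed

lemma br_ends_cong:
  assumes w: "\<And>i. i \<in> {1..m * n + 1} \<Longrightarrow> w i \<omega> = w' i \<omega>'"
    and l: "\<And>k. k \<in> {1..m * n} \<Longrightarrow> l k \<omega> = l' k \<omega>'" and k: "k \<in> {1..m * n}"
  shows "br_ends m n w l \<omega> k = br_ends m n w' l' \<omega>' k"
proof -
  have le: "m * i \<le> m * n + 1" if "i \<le> n" for i
    using mult_le_mono2[OF that, of m] by linarith
  have "vertex_of m n w \<omega> = vertex_of m n w' \<omega>'"
  proof
    fix x
    have "ratio_R (m * n) w (m * j) \<omega> = ratio_R (m * n) w' (m * j) \<omega>'"
      "ratio_R (m * n) w (m * (j - 1)) \<omega> = ratio_R (m * n) w' (m * (j - 1)) \<omega>'" if "j \<in> {1..n}" for j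
      using that w by (intro ratio_R_cong le; auto)+
    then show "vertex_of m n w \<omega> x = vertex_of m n w' \<omega>' x"
      unfolding vertex_of_def by (metis (no_types, lifting))
  qed
  moreover have "ratio_R (m * n) w k \<omega> = ratio_R (m * n) w' k \<omega>'"
    using k w by (intro ratio_R_cong) auto
  ultimately show ?thesis using l[OF k] by (simp add: br_ends_def)
qed

text \<open>The description is a function of the set of qualifying indices, which takes finitely
  many values, each on a measurable set. This also covers points where no index or several indices
  qualify and \<open>THE\<close> is unspecified.\<close>

lemma measurable_THE_finite:
  assumes "finite I" and [measurable]: "\<And>j. j \<in> I \<Longrightarrow> Measurable.pred M (p j)"
  shows "(\<lambda>x. THE j. j \<in> I \<and> p j x) \<in> M \<rightarrow>\<^sub>M count_space UNIV"
proof -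
  have "(\<lambda>x. {j\<in>I. p j x}) \<in> M \<rightarrow>\<^sub>M count_space (Pow I)"
  proof (subst measurable_count_space_eq2)
    have "(\<lambda>x. {j\<in>I. p j x}) -` {S} \<inter> space M \<in> sets M" if "S \<subseteq> I" for S
    proof -
      have "(\<lambda>x. {j\<in>I. p j x}) -` {S} \<inter> space M = {x\<in>space M. \<forall>j\<in>I. j \<in> S \<longleftrightarrow> p j x}"
        using that by auto
      also have "\<dots> \<in> sets M"
        using assms by (intro sets.sets_Collect_finite_All) measurable
      finally show ?thesis .
    qed
    then show "(\<lambda>x. {j\<in>I. p j x}) \<in> space M \<rightarrow> Pow I \<and>
      (\<forall>S\<in>Pow I. (\<lambda>x. {j\<in>I. p j x}) -` {S} \<inter> space M \<in> sets M)" by auto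
  qed (use assms in simp)
  from measurable_compose[OF this, of "\<lambda>S. THE j. j \<in> S" "count_space UNIV"]
  show ?thesis by simp
qed

text \<open>Finitely many discrete values are collected in a list because lists over a countable
  type are again countable, so that the discrete sigma-algebra is compatible with pairing.\<close>

lemma measurable_map_list:
  fixes f :: "'i \<Rightarrow> 'a \<Rightarrow> 'b::countable"
  assumes "\<And>k. k \<in> set ks \<Longrightarrow> f k \<in> M \<rightarrow>\<^sub>M count_space UNIV"
  shows "(\<lambda>x. map (\<lambda>k. f k x) ks) \<in> M \<rightarrow>\<^sub>M count_space UNIV"
  using assms
proof (induction ks)
  case (Cons k ks)
  have "f k \<in> M \<rightarrow>\<^sub>M count_space UNIV" "(\<lambda>x. map (\<lambda>k. f k x) ks) \<in> M \<rightarrow>\<^sub>M count_space UNIV"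
    using Cons by auto
  then have "(\<lambda>x. (f k x, map (\<lambda>k. f k x) ks)) \<in> M \<rightarrow>\<^sub>M count_space (UNIV \<times> UNIV)"
    by (subst pair_measure_countable[symmetric]) (auto intro: measurable_Pair)
  from measurable_compose[OF this, of "\<lambda>(a, b). a # b" "count_space UNIV"]
  show ?case by simp
qed simp

text \<open>All endpoints together form a single variable with values in a countable type, and every
  set of such values is measurable. The assumption on \<open>Q\<close> says that it looks only at
  the actual edges, so it factors through that variable.\<close>

lemma sets_Collect_br_ends:
  fixes M :: "'a measure"
  assumes w: "\<And>i. i \<in> {1..m * n + 1} \<Longrightarrow> w i \<in> borel_measurable M"
    and l: "\<And>k. k \<in> {1..m * n} \<Longrightarrow> l k \<in> borel_measurable M"
    and Q: "\<And>f g. (\<And>k. k \<in> {1..m * n} \<Longrightarrow> f k = g k) \<Longrightarrow> Q f = Q g"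
  shows "{x\<in>space M. Q (br_ends m n w l x)} \<in> sets M"
proof -
  have W: "partial_W w k \<in> borel_measurable M" if "k \<le> m * n + 1" for k
    unfolding partial_W_def[abs_def] using that by (intro borel_measurable_sum w) auto
  have R: "ratio_R (m * n) w k \<in> borel_measurable M" if "k \<le> m * n + 1" for k
    unfolding ratio_R_def[abs_def] using that by (intro borel_measurable_divide W) auto
  have V: "(\<lambda>x. vertex_of m n w x (f x)) \<in> M \<rightarrow>\<^sub>M count_space UNIV"
    if [measurable]: "f \<in> borel_measurable M" for f
    unfolding vertex_of_def
  proof (rule measurable_THE_finite)
    fix j assume j: "j \<in> {1..n}"
    then have "m * j \<le> m * n" "m * (j - 1) \<le> m * n"
      by (auto intro!: mult_le_mono2)
    then have [measurable]: "ratio_R (m * n) w (m * j) \<in> borel_measurable M"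
        "ratio_R (m * n) w (m * (j - 1)) \<in> borel_measurable M"
      by (auto intro!: R le_SucI)
    show "Measurable.pred M (\<lambda>x. f x \<in> {ratio_R (m * n) w (m * (j - 1)) x<..ratio_R (m * n) w (m * j) x})"
      unfolding greaterThanAtMost_iff by measurable
  qed simp
  \<comment> \<open>List positions start at 0 and edge names at 1; \<open>G\<close> undoes the
    shift.\<close>
  define F where "F x = map (\<lambda>k. (vertex_of m n w x (ratio_R (m * n) w (Suc k) x), vertex_of m n w x (l (Suc k) x)))
    [0..<m * n]" for x
  define G where "G v k = {fst (v ! (k - 1)), snd (v ! (k - 1))}" for v :: "(nat \<times> nat) list" and k
  have "F \<in> M \<rightarrow>\<^sub>M count_space UNIV"
    unfolding F_def
  proof (rule measurable_map_list)
    fix k assume "k \<in> set [0..<m * n]"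
    then have *: "Suc k \<in> {1..m * n}" by auto
    then show "(\<lambda>x. (vertex_of m n w x (ratio_R (m * n) w (Suc k) x), vertex_of m n w x (l (Suc k) x)))
      \<in> M \<rightarrow>\<^sub>M count_space UNIV"
      by (subst UNIV_Times_UNIV[symmetric], subst pair_measure_countable[symmetric])
         (auto intro!: measurable_Pair V R l)
  qed
  moreover have "Q (br_ends m n w l x) \<longleftrightarrow> Q (G (F x))" for x
  proof (rule Q)
    fix k assume "k \<in> {1..m * n}"
    then have "k - 1 < m * n" "Suc (k - 1) = k" by auto
    then show "br_ends m n w l x k = G (F x) k"
      by (simp add: br_ends_def G_def F_def del: upt_Suc)
  qed
  ultimately show ?thesis
    using measurable_sets[of F M "count_space UNIV" "{v. Q (G v)}"]
    by (simp add: vimage_def Int_def conj_commute)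
qed

context bollobas_riordan
begin

text \<open>On \<open>M \<Otimes>\<^sub>M U\<close> the random attachment points \<open>l k\<close> are replaced by \<open>R k * (u k)\<^sup>2\<close> with
  \<open>u\<close> independent of \<open>w\<close>, so that conditioning on \<open>w\<close> becomes Fubini's theorem.\<close>

definition "w_model i z = w i (fst z)"
definition "l_model k z = ratio_R N w k (fst z) * (snd z k)\<^sup>2"

lemma l_model_measurable [measurable]:
  "k \<in> {1..N} \<Longrightarrow> l_model k \<in> borel_measurable (M \<Otimes>\<^sub>M U)"
  unfolding l_model_def[abs_def] by measurable

context
  fixes Q :: "(nat \<Rightarrow> nat set) \<Rightarrow> bool"
  assumes Q: "\<And>f g. (\<And>k. k \<in> {1..N} \<Longrightarrow> f k = g k) \<Longrightarrow> Q f = Q g"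
begin

lemma sets_Collect_ends: "{\<omega>\<in>space M. Q (br_ends m n w l \<omega>)} \<in> events"
  by (intro sets_Collect_br_ends w_measurable l_measurable Q)

lemma sets_Collect_ends_model:
  "{z\<in>space (M \<Otimes>\<^sub>M U). Q (br_ends m n w_model l_model z)} \<in> sets (M \<Otimes>\<^sub>M U)"
  by (intro sets_Collect_br_ends l_model_measurable Q)
     (auto simp: w_model_def[abs_def] intro!: measurable_compose[OF measurable_fst] w_measurable)

text \<open>The graph depends only on the coordinates \<open>w i\<close> and \<open>l k\<close>.
  Reading it off on the coordinate space makes both probabilities the measure of one set
  \<open>S\<close> under the two sides of \<open>joint_law\<close>.\<close>

lemma prob_ends_eq_model:
  "prob {\<omega>\<in>space M. Q (br_ends m n w l \<omega>)}
    = measure (M \<Otimes>\<^sub>M U) {z\<in>space (M \<Otimes>\<^sub>M U). Q (br_ends m n w_model l_model z)}"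
proof -
  define S where "S = {z\<in>space coord. Q (br_ends m n (\<lambda>i z. fst z i) (\<lambda>k z. snd z k) z)}"
  let ?X = "\<lambda>\<omega>. (\<lambda>i\<in>{1..N + 1}. w i \<omega>, \<lambda>k\<in>{1..N}. l k \<omega>)"
  let ?Y = "\<lambda>(\<omega>, u). (\<lambda>i\<in>{1..N + 1}. w i \<omega>, \<lambda>k\<in>{1..N}. ratio_R N w k \<omega> * (u k)\<^sup>2)"
  have S: "S \<in> sets coord"
    unfolding S_def
    by (intro sets_Collect_br_ends Q)
       (auto intro!: measurable_compose[OF measurable_fst] measurable_compose[OF measurable_snd]
         measurable_component_singleton)
  have X: "?X \<in> M \<rightarrow>\<^sub>M coord"
    using l_measurable by (intro measurable_Pair measurable_restrict w_measurable) auto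
  have Y: "?Y \<in> M \<Otimes>\<^sub>M U \<rightarrow>\<^sub>M coord"
    by (auto simp: case_prod_beta intro!: measurable_Pair measurable_restrict, measurable)
  have "prob {\<omega>\<in>space M. Q (br_ends m n w l \<omega>)} = measure (distr M coord ?X) S"
  proof (subst measure_distr[OF X S], rule arg_cong[where f=prob])
    have "Q (br_ends m n w l \<omega>) \<longleftrightarrow> Q (br_ends m n (\<lambda>i z. fst z i) (\<lambda>k z. snd z k) (?X \<omega>))" for \<omega>
      by (intro Q br_ends_cong) auto
    then show "{\<omega>\<in>space M. Q (br_ends m n w l \<omega>)} = ?X -` S \<inter> space M"
      using measurable_space[OF X] unfolding S_def by blast
  qed
  also have "\<dots> = measure (distr (M \<Otimes>\<^sub>M U) coord ?Y) S"
    by (simp only: joint_law)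
  also have "\<dots> = measure (M \<Otimes>\<^sub>M U) {z\<in>space (M \<Otimes>\<^sub>M U). Q (br_ends m n w_model l_model z)}"
  proof (subst measure_distr[OF Y S], rule arg_cong[where f="measure (M \<Otimes>\<^sub>M U)"])
    have "Q (br_ends m n w_model l_model z) \<longleftrightarrow> Q (br_ends m n (\<lambda>i z. fst z i) (\<lambda>k z. snd z k) (?Y z))" for z
      by (intro Q br_ends_cong) (auto simp: w_model_def l_model_def case_prod_beta)
    then show "?Y -` S \<inter> space (M \<Otimes>\<^sub>M U) = {z\<in>space (M \<Otimes>\<^sub>M U). Q (br_ends m n w_model l_model z)}"
      using measurable_space[OF Y] unfolding S_def by blast
  qed
  finally show ?thesis .
qed

end

end

section \<open>Parallel pairs as a sum over blocks\<close>

definition block_pairs :: "nat \<Rightarrow> nat \<Rightarrow> (nat \<times> nat) set" where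
  "block_pairs m i = {(k, k'). m * (i - 1) < k \<and> k < k' \<and> k' \<le> m * i}"

text \<open>The edge \<open>k\<close> attaches to the vertex \<open>j\<close> iff \<open>u k\<close> lies in \<open>slot m W k j\<close>; the normalisation
  \<open>W (m * n + 1)\<close> of the \<open>R k\<close> cancels. As \<open>l k \<le> R k\<close>, both edges of a parallel pair with larger
  endpoint \<open>i\<close> belong to the block \<open>{m * (i - 1)<..m * i}\<close>.\<close>

definition slot :: "nat \<Rightarrow> (nat \<Rightarrow> real) \<Rightarrow> nat \<Rightarrow> nat \<Rightarrow> real set" where
  "slot m W k j = {sqrt (W (m * (j - 1)) / W k)<..sqrt (W (m * j) / W k)}"

text \<open>The range \<open>j < i\<close> excludes loops. Only coordinates of \<open>u\<close> in
  block \<open>i\<close> enter, which makes the counts of different blocks independent once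
  \<open>W\<close> is fixed.\<close>

definition block_count :: "nat \<Rightarrow> (nat \<Rightarrow> real) \<Rightarrow> nat \<Rightarrow> (nat \<Rightarrow> real) \<Rightarrow> real" where
  "block_count m W i u = (\<Sum>(k, k')\<in>block_pairs m i. \<Sum>j\<in>{1..<i}.
     indicator (slot m W k j) (u k) * indicator (slot m W k' j) (u k'))"

lemma finite_block_pairs [simp]: "finite (block_pairs m i)"
  by (rule finite_subset[of _ "{..m * i} \<times> {..m * i}"]) (auto simp: block_pairs_def)

lemma card_block_pairs:
  assumes "i \<ge> 1"
  shows "real (card (block_pairs m i)) = real m * (real m - 1) / 2"
proof -
  define a where "a = m * (i - 1)"
  have "m * i = a + m" using assms by (cases i) (auto simp: a_def)
  then have "block_pairs m i = prod.swap ` (SIGMA k':{a<..a + m}. {a<..<k'})"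
    by (auto simp: block_pairs_def a_def image_def)
  then have "card (block_pairs m i) = card (SIGMA k':{a<..a + m}. {a<..<k'})"
    by (simp add: card_image)
  also have "\<dots> = (\<Sum>k'\<in>{a<..a + m}. k' - a - 1)" by (simp add: card_SigmaI)
  also have "\<dots> = (\<Sum>d<m. d)"
    by (rule sum.reindex_bij_witness[of _ "\<lambda>d. a + d + 1" "\<lambda>k'. k' - a - 1"]) auto
  also have "real \<dots> = real m * (real m - 1) / 2"
    by (induction m) (auto simp: field_simps)
  finally show ?thesis .
qed

lemma block_index_unique:
  assumes "m * (i - 1) < k" "k \<le> m * i" "m * (i' - 1) < k" "k \<le> m * i'" "i \<ge> 1" "i' \<ge> 1"
  shows "i = (i'::nat)"
proof -
  have "m * (i - 1) < m * i'" "m * (i' - 1) < m * i" using assms by linarith+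
  then show ?thesis using assms(5,6) by auto
qed

context
  fixes m n :: nat and w l :: "nat \<Rightarrow> 'a \<Rightarrow> real" and \<omega> :: 'a and u :: "nat \<Rightarrow> real"
  assumes m: "m \<ge> 1"
    and w: "\<forall>i\<in>{1..m * n + 1}. 0 < w i \<omega>"
    and u: "\<forall>k\<in>{1..m * n}. u k \<in> {0<..1}"
    and l: "\<And>k. k \<in> {1..m * n} \<Longrightarrow> l k \<omega> = ratio_R (m * n) w k \<omega> * (u k)\<^sup>2"
begin

lemmas W_strict_mono = partial_W_strict_mono[where w=w and \<omega>=\<omega>, OF w]

lemma ratio_R_less_iff:
  assumes "j \<le> m * n + 1" "k \<le> m * n + 1"
  shows "ratio_R (m * n) w j \<omega> < ratio_R (m * n) w k \<omega> \<longleftrightarrow> j < k"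
proof -
  have "0 < partial_W w (m * n + 1) \<omega>" using W_strict_mono[of 0] by simp
  moreover have "partial_W w j \<omega> < partial_W w k \<omega> \<longleftrightarrow> j < k"
    using W_strict_mono[of j k] W_strict_mono[of k j] assms
    by (cases j k rule: linorder_cases) auto
  ultimately show ?thesis by (simp add: ratio_R_def divide_less_cancel)
qed

lemma vertex_of_eq:
  assumes j: "j \<in> {1..n}" and x: "x \<in> {ratio_R (m * n) w (m * (j - 1)) \<omega><..ratio_R (m * n) w (m * j) \<omega>}"
  shows "vertex_of m n w \<omega> x = j"
  unfolding vertex_of_def
proof (rule the_equality)
  fix j' assume j': "j' \<in> {1..n} \<and> x \<in> {ratio_R (m * n) w (m * (j' - 1)) \<omega><..ratio_R (m * n) w (m * j') \<omega>}"
  have le: "m * i \<le> m * n + 1" if "i \<le> n" for i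
    using mult_le_mono2[OF that, of m] by linarith
  have *: "j - 1 \<le> n" "j' - 1 \<le> n" "j \<le> n" "j' \<le> n" using j j' by auto
  have "ratio_R (m * n) w (m * (j - 1)) \<omega> < ratio_R (m * n) w (m * j') \<omega>"
    "ratio_R (m * n) w (m * (j' - 1)) \<omega> < ratio_R (m * n) w (m * j) \<omega>"
    using x j' by auto
  then have "m * (j - 1) < m * j'" "m * (j' - 1) < m * j"
    using ratio_R_less_iff[OF le[OF *(1)] le[OF *(4)]] ratio_R_less_iff[OF le[OF *(2)] le[OF *(3)]]
    by blast+
  then show "j' = j" using j j' by auto
qed (use assms in simp)

lemma vertex_of_ratio_R:
  assumes i: "i \<in> {1..n}" and k: "m * (i - 1) < k" "k \<le> m * i"
  shows "vertex_of m n w \<omega> (ratio_R (m * n) w k \<omega>) = i"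
proof (rule vertex_of_eq[OF i])
  have "m * i \<le> m * n" using i by auto
  then have "k \<le> m * n + 1" "m * i \<le> m * n + 1" "m * (i - 1) \<le> m * n + 1"
    using k by linarith+
  then show "ratio_R (m * n) w k \<omega> \<in> {ratio_R (m * n) w (m * (i - 1)) \<omega><..ratio_R (m * n) w (m * i) \<omega>}"
    using k ratio_R_less_iff[of "m * (i - 1)" k] ratio_R_less_iff[of "m * i" k] by auto
qed

text \<open>Squaring turns membership of \<open>u k\<close> in a slot into the position of
  \<open>W k * (u k)^2\<close> between two consecutive block ends. Since \<open>u k\<close> is
  positive such a block exists, and since \<open>u k\<close> is at most 1 it does not come after
  block \<open>i\<close>.\<close>

lemma vertex_of_l:
  assumes i: "i \<in> {1..n}" and k: "m * (i - 1) < k" "k \<le> m * i"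
  obtains j where "j \<in> {1..i}" "vertex_of m n w \<omega> (l k \<omega>) = j"
    "\<And>j'. j' \<in> {1..n} \<Longrightarrow> u k \<in> slot m (\<lambda>k. partial_W w k \<omega>) k j' \<longleftrightarrow> j' = j"
proof -
  have mi: "m * i \<le> m * n" using i by auto
  have "k \<le> m * n" using k(2) mi by (rule order_trans)
  then have k': "k \<in> {1..m * n}" using k by auto
  define W where "W k = partial_W w k \<omega>" for k
  have "0 < W k" "0 < W (m * n + 1)"
    using W_strict_mono[of 0] k' by (auto simp: W_def)
  define x where "x = W k * (u k)\<^sup>2"
  have u': "0 < u k" "u k \<le> 1" using u k' by auto
  have slot: "u k \<in> slot m W k j \<longleftrightarrow>
      l k \<omega> \<in> {ratio_R (m * n) w (m * (j - 1)) \<omega><..ratio_R (m * n) w (m * j) \<omega>}" for j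
  proof -
    have "sqrt (a / W k) < u k \<longleftrightarrow> a < x" "u k \<le> sqrt (a / W k) \<longleftrightarrow> x \<le> a" for a
    proof -
      have "sqrt (a / W k) < u k \<longleftrightarrow> sqrt (a / W k) < sqrt ((u k)\<^sup>2)" using u' by simp
      also have "\<dots> \<longleftrightarrow> a < x"
        unfolding real_sqrt_less_iff x_def using \<open>0 < W k\<close> by (simp add: field_simps)
      finally show "sqrt (a / W k) < u k \<longleftrightarrow> a < x" .
      then show "u k \<le> sqrt (a / W k) \<longleftrightarrow> x \<le> a" by (simp add: not_less[symmetric])
    qed
    moreover have "ratio_R (m * n) w j \<omega> < l k \<omega> \<longleftrightarrow> W j < x"
      "l k \<omega> \<le> ratio_R (m * n) w j \<omega> \<longleftrightarrow> x \<le> W j" for j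
      using \<open>0 < W (m * n + 1)\<close> 
      by (simp_all add: l[OF k'] ratio_R_def x_def W_def field_simps)
    ultimately show ?thesis by (simp add: slot_def)
  qed
  have "x \<le> W k" using \<open>0 < W k\<close> u' by (simp add: x_def power_le_one)
  also have "W k \<le> W (m * i)"
    using W_strict_mono[of k "m * i"] k mi by (cases "k = m * i") (auto simp: W_def)
  finally have x_le: "x \<le> W (m * i)" .
  define j where "j = (LEAST j. x \<le> W (m * j))"
  have "0 < x" using u' \<open>0 < W k\<close> by (simp add: x_def)
  have j1: "x \<le> W (m * j)" unfolding j_def by (rule LeastI[of _ i]) (rule x_le)
  have "j \<noteq> 0" using j1 \<open>0 < x\<close> by (auto simp: W_def intro: gr0I)
  then have j2: "W (m * (j - 1)) < x"
    using not_less_Least[of "j - 1" "\<lambda>j. x \<le> W (m * j)"] by (auto simp: j_def[symmetric])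
  have "j \<le> i" unfolding j_def by (rule Least_le) (rule x_le)
  have mem: "l k \<omega> \<in> {ratio_R (m * n) w (m * (j - 1)) \<omega><..ratio_R (m * n) w (m * j) \<omega>}"
    using \<open>0 < W (m * n + 1)\<close> j1 j2
    by (simp add: l[OF k'] ratio_R_def x_def W_def field_simps)
  have j: "j \<in> {1..i}" "j \<in> {1..n}" using \<open>j \<le> i\<close> \<open>j \<noteq> 0\<close> i by auto
  have v: "vertex_of m n w \<omega> (l k \<omega>) = j" using j(2) mem by (rule vertex_of_eq)
  have "u k \<in> slot m W k j' \<longleftrightarrow> j' = j" if "j' \<in> {1..n}" for j'
    using vertex_of_eq[OF that, of "l k \<omega>"] v mem slot[of j'] by auto
  then show ?thesis
    using j(1) v by (intro that[of j]) (auto simp: W_def[abs_def])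
qed

lemma block_index:
  assumes "k \<in> {1..m * n}"
  obtains i where "i \<in> {1..n}" "m * (i - 1) < k" "k \<le> m * i"
proof (rule that[of "(k - 1) div m + 1"])
  have "m * ((k - 1) div m) \<le> k - 1" "1 \<le> k" using assms by simp_all
  then show "m * ((k - 1) div m + 1 - 1) < k" unfolding add_diff_cancel_right' by linarith
  have "k - 1 < m * ((k - 1) div m + 1)"
    using m dividend_less_times_div[of m "k - 1"] by (simp add: algebra_simps)
  then show "k \<le> m * ((k - 1) div m + 1)" using assms by auto
  have "(k - 1) div m < n"
    using assms m by (intro less_mult_imp_div_less) (auto simp: mult.commute)
  then show "(k - 1) div m + 1 \<in> {1..n}" by auto
qed

text \<open>An edge attaches to its own block or an earlier one, so its block is its larger
  endpoint. Two non-loops with equal endpoint sets therefore agree in the block and in the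
  attachment vertex separately.\<close>

lemma parallel_edges_iff:
  assumes i: "i \<in> {1..n}" and k: "m * (i - 1) < k" "k \<le> m * i" and k': "k' \<in> {1..m * n}"
  shows "parallel_edges (br_ends m n w l \<omega>) k k' \<longleftrightarrow> k \<noteq> k' \<and> m * (i - 1) < k' \<and> k' \<le> m * i \<and>
    vertex_of m n w \<omega> (l k \<omega>) = vertex_of m n w \<omega> (l k' \<omega>) \<and> vertex_of m n w \<omega> (l k \<omega>) < i"
proof -
  obtain i' where i': "i' \<in> {1..n}" "m * (i' - 1) < k'" "k' \<le> m * i'"
    using k' by (rule block_index)
  obtain j where j: "j \<in> {1..i}" "vertex_of m n w \<omega> (l k \<omega>) = j" using i k by (rule vertex_of_l)
  obtain j' where j': "j' \<in> {1..i'}" "vertex_of m n w \<omega> (l k' \<omega>) = j'" using i' by (rule vertex_of_l)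
  have "m * (i - 1) < k' \<and> k' \<le> m * i \<longleftrightarrow> i = i'"
    using i' i block_index_unique[of m i k' i'] by auto
  moreover have "br_ends m n w l \<omega> k = {i, j}" "br_ends m n w l \<omega> k' = {i', j'}"
    using j j' vertex_of_ratio_R[OF i k] vertex_of_ratio_R[OF i'] by (simp_all add: br_ends_def)
  moreover have "card {i, j} = 2 \<and> {i, j} = {i', j'} \<longleftrightarrow> i = i' \<and> j = j' \<and> j < i"
    using j(1) j'(1) by (auto simp: doubleton_eq_iff card_insert_if)
  ultimately show ?thesis using j(2) j'(2) by (auto simp: parallel_edges_def)
qed

text \<open>All edges parallel to \<open>k\<close> lie in the block of \<open>k\<close>, which has
  \<open>m\<close> edges.\<close>

lemma card_parallel_le:
  assumes k: "k \<in> {1..m * n}"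
  shows "card {j\<in>{1..m * n}. j < k \<and> parallel_edges (br_ends m n w l \<omega>) j k} \<le> m"
proof -
  obtain i where i: "i \<in> {1..n}" "m * (i - 1) < k" "k \<le> m * i"
    using k by (rule block_index)
  have "{j\<in>{1..m * n}. j < k \<and> parallel_edges (br_ends m n w l \<omega>) j k} \<subseteq> {m * (i - 1)<..m * i}"
    using parallel_edges_iff[OF i] parallel_edges_commute[of "br_ends m n w l \<omega>" _ k] by auto
  then have "card {j\<in>{1..m * n}. j < k \<and> parallel_edges (br_ends m n w l \<omega>) j k} \<le> card {m * (i - 1)<..m * i}"
    by (intro card_mono) auto
  also have "\<dots> = m" using i by (simp add: diff_mult_distrib2[symmetric])
  finally show ?thesis .
qed

text \<open>The parallel pairs split according to their common block. Within a block,
  \<open>u k\<close> lies in exactly one slot, so the sum over \<open>j\<close> is 1 if both edges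
  of the pair attach to the same earlier vertex and 0 otherwise.\<close>

lemma br_parallel_pairs_eq_sum:
  "real (br_parallel_pairs m n w l \<omega>) = (\<Sum>i=1..n. block_count m (\<lambda>k. partial_W w k \<omega>) i u)"
proof -
  define t where "t k = vertex_of m n w \<omega> (l k \<omega>)" for k
  define S where "S i = {(k, k')\<in>block_pairs m i. t k = t k' \<and> t k < i}" for i
  have sub: "k \<in> {1..m * n}" if "i \<in> {1..n}" "m * (i - 1) < k" "k \<le> m * i" for i k
  proof -
    have "m * i \<le> m * n" using that by auto
    then have "k \<le> m * n" using that(3) by linarith
    then show ?thesis using that by auto
  qed
  have "{(j, k). j \<in> {1..m * n} \<and> k \<in> {1..m * n} \<and> j < k \<and> parallel_edges (br_ends m n w l \<omega>) j k}
      = (\<Union>i\<in>{1..n}. S i)" (is "?A = ?B")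
  proof (intro equalityI subsetI)
    fix p assume "p \<in> ?A"
    then obtain k k' where p: "p = (k, k')" "k \<in> {1..m * n}" "k' \<in> {1..m * n}" "k < k'"
      "parallel_edges (br_ends m n w l \<omega>) k k'" by auto
    obtain i where i: "i \<in> {1..n}" "m * (i - 1) < k" "k \<le> m * i" using p(2) by (rule block_index)
    then show "p \<in> ?B"
      using p parallel_edges_iff[OF i p(3)] by (auto simp: S_def block_pairs_def t_def)
  next
    fix p assume "p \<in> ?B"
    then obtain i k k' where i: "i \<in> {1..n}" and p: "p = (k, k')" "m * (i - 1) < k" "k < k'" "k' \<le> m * i"
        "t k = t k'" "t k < i"
      by (auto simp: S_def block_pairs_def)
    have k: "m * (i - 1) < k'" "k \<le> m * i" using p by auto
    show "p \<in> ?A"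
      using sub[OF i p(2) k(2)] sub[OF i k(1) p(4)] parallel_edges_iff[OF i p(2) k(2), of k'] p k
      by (auto simp: t_def)
  qed
  then have "real (br_parallel_pairs m n w l \<omega>) = real (card (\<Union>i\<in>{1..n}. S i))"
    by (simp add: br_parallel_pairs_def num_parallel_pairs_eq_card)
  also have "card (\<Union>i\<in>{1..n}. S i) = (\<Sum>i\<in>{1..n}. card (S i))"
  proof (rule card_UN_disjoint)
    show "\<forall>i\<in>{1..n}. finite (S i)"
      by (auto simp: S_def intro: finite_subset[OF _ finite_block_pairs[of m]])
    show "\<forall>i\<in>{1..n}. \<forall>i'\<in>{1..n}. i \<noteq> i' \<longrightarrow> S i \<inter> S i' = {}"
    proof safe
      fix i i' k k' assume "i \<in> {1..n}" "i' \<in> {1..n}" "i \<noteq> i'" "(k, k') \<in> S i" "(k, k') \<in> S i'"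
      then show "(k, k') \<in> {}"
        using block_index_unique[of m i k i'] by (auto simp: S_def block_pairs_def)
    qed
  qed simp
  also have "real (\<Sum>i\<in>{1..n}. card (S i)) = (\<Sum>i\<in>{1..n}. block_count m (\<lambda>k. partial_W w k \<omega>) i u)"
    unfolding of_nat_sum
  proof (rule sum.cong)
    fix i assume i: "i \<in> {1..n}"
    have "real (card (S i)) = (\<Sum>(k, k')\<in>block_pairs m i. if t k = t k' \<and> t k < i then 1 else 0)"
      by (simp add: case_prod_beta sum.If_cases S_def Int_def)
         (auto intro!: arg_cong[where f=card])
    also have "\<dots> = block_count m (\<lambda>k. partial_W w k \<omega>) i u"
      unfolding block_count_def
    proof (intro sum.cong refl, clarify)
      fix k k' assume "(k, k') \<in> block_pairs m i"
      then have k: "m * (i - 1) < k" "k \<le> m * i" and k': "m * (i - 1) < k'" "k' \<le> m * i"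
        by (auto simp: block_pairs_def)
      obtain j where j: "j \<in> {1..i}" "t k = j"
          "\<And>a. a \<in> {1..n} \<Longrightarrow> u k \<in> slot m (\<lambda>k. partial_W w k \<omega>) k a \<longleftrightarrow> a = j"
        using vertex_of_l[OF i k] unfolding t_def by metis
      obtain j' where j': "j' \<in> {1..i}" "t k' = j'"
          "\<And>a. a \<in> {1..n} \<Longrightarrow> u k' \<in> slot m (\<lambda>k. partial_W w k \<omega>) k' a \<longleftrightarrow> a = j'"
        using vertex_of_l[OF i k'] unfolding t_def by metis
      have "(\<Sum>a\<in>{1..<i}. indicator (slot m (\<lambda>k. partial_W w k \<omega>) k a) (u k) *
          indicator (slot m (\<lambda>k. partial_W w k \<omega>) k' a) (u k'))
        = (\<Sum>a\<in>{1..<i}. if a = j then (if j = j' then 1 else 0) else (0::real))"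
        using i j(3) j'(3) by (intro sum.cong) (auto simp: indicator_def)
      also have "\<dots> = (if t k = t k' \<and> t k < i then 1 else 0)"
        using j(1,2) j'(2) by (auto simp: sum.delta)
      finally show "(if t k = t k' \<and> t k < i then 1 else (0::real))
        = (\<Sum>a\<in>{1..<i}. indicator (slot m (\<lambda>k. partial_W w k \<omega>) k a) (u k) *
          indicator (slot m (\<lambda>k. partial_W w k \<omega>) k' a) (u k'))" by (rule sym)
    qed
    finally show "real (card (S i)) = block_count m (\<lambda>k. partial_W w k \<omega>) i u" .
  qed simp
  finally show ?thesis .
qed

end

section \<open>Conditional mean and conditional concentration\<close>

text \<open>Chebyshev's inequality for independent summands. Bounding variances by raw second
  moments keeps the right-hand side directly computable in both applications, to the block counts
  and to the weighted squares of block increments.\<close>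

lemma (in prob_space) prob_sum_deviation_le:
  fixes X :: "'i \<Rightarrow> 'a \<Rightarrow> real"
  assumes I: "finite I" and ind: "indep_vars (\<lambda>_. borel) X I"
    and sq: "\<And>i. i \<in> I \<Longrightarrow> integrable M (\<lambda>x. (X i x)\<^sup>2)"
    and a: "a > 0"
  shows "prob {x\<in>space M. \<bar>(\<Sum>i\<in>I. X i x) - (\<Sum>i\<in>I. expectation (X i))\<bar> \<ge> a}
    \<le> (\<Sum>i\<in>I. expectation (\<lambda>x. (X i x)\<^sup>2)) / a\<^sup>2"
proof -
  have rv [measurable]: "random_variable borel (X i)" if "i \<in> I" for i
    using ind that by (auto simp: indep_vars_def)
  have int: "integrable M (X i)" if "i \<in> I" for i
    using rv sq that by (blast dest: square_integrable_imp_integrable)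
  define Z where "Z i x = X i x - expectation (X i)" for i x
  have Zint: "integrable M (Z i)" if "i \<in> I" for i
    unfolding Z_def using int[OF that] by auto
  have Z0: "expectation (Z i) = 0" if "i \<in> I" for i
    unfolding Z_def using int[OF that] by (simp add: prob_space)
  have Zsq: "integrable M (\<lambda>x. Z i x * Z i x)" if "i \<in> I" for i
    unfolding Z_def using int[OF that] sq[OF that] 
    by (simp add: algebra_simps power2_eq_square)
  have Zvar: "expectation (\<lambda>x. Z i x * Z i x) \<le> expectation (\<lambda>x. (X i x)\<^sup>2)" if "i \<in> I" for i
  proof -
    have "expectation (\<lambda>x. Z i x * Z i x) = variance (X i)"
      by (simp add: Z_def power2_eq_square)
    also have "\<dots> = expectation (\<lambda>x. (X i x)\<^sup>2) - (expectation (X i))\<^sup>2"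
      using int[OF that] sq[OF that] by (rule variance_eq)
    finally show ?thesis by simp
  qed
  have ZZ: "integrable M (\<lambda>x. Z i x * Z j x)" "expectation (\<lambda>x. Z i x * Z j x) = 0"
    if "i \<in> I" "j \<in> I" "i \<noteq> j" for i j
  proof -
    have "indep_vars (\<lambda>_. borel) Z {i, j}"
      unfolding Z_def
      by (rule indep_vars_compose2[where Y="\<lambda>i x. x - expectation (X i)", OF indep_vars_subset[OF ind]])
         (use that in auto)
    then show "integrable M (\<lambda>x. Z i x * Z j x)" "expectation (\<lambda>x. Z i x * Z j x) = 0"
      using indep_vars_integrable[of "{i, j}" Z] indep_vars_lebesgue_integral[of "{i, j}" Z] Zint Z0 that
      by auto
  qed
  have ZZ_int: "integrable M (\<lambda>x. Z i x * Z j x)" if "i \<in> I" "j \<in> I" for i j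
    using that ZZ(1) Zsq by (cases "i = j") auto
  have eq: "(\<Sum>i\<in>I. X i x) - (\<Sum>i\<in>I. expectation (X i)) = (\<Sum>i\<in>I. Z i x)" for x
    by (simp add: Z_def sum_subtractf)
  have sqeq: "(\<Sum>i\<in>I. Z i x)\<^sup>2 = (\<Sum>i\<in>I. \<Sum>j\<in>I. Z i x * Z j x)" for x
    by (simp add: power2_eq_square sum_product)
  have "expectation (\<lambda>x. (\<Sum>i\<in>I. Z i x)\<^sup>2) = (\<Sum>i\<in>I. \<Sum>j\<in>I. expectation (\<lambda>x. Z i x * Z j x))"
    unfolding sqeq using ZZ_int by (simp add: Bochner_Integration.integral_sum Bochner_Integration.integrable_sum)
  also have "\<dots> = (\<Sum>i\<in>I. \<Sum>j\<in>I. if i = j then expectation (\<lambda>x. Z i x * Z i x) else 0)"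
    by (intro sum.cong refl) (auto simp: ZZ)
  also have "\<dots> \<le> (\<Sum>i\<in>I. expectation (\<lambda>x. (X i x)\<^sup>2))"
    using I Zvar by (auto intro!: sum_mono)
  finally have le: "expectation (\<lambda>x. (\<Sum>i\<in>I. Z i x)\<^sup>2) \<le> (\<Sum>i\<in>I. expectation (\<lambda>x. (X i x)\<^sup>2))" .
  have [measurable]: "random_variable borel (\<lambda>x. \<Sum>i\<in>I. Z i x)"
    by (intro borel_measurable_sum borel_measurable_integrable Zint)
  have "prob {x\<in>space M. \<bar>\<Sum>i\<in>I. Z i x\<bar> \<ge> a} \<le> expectation (\<lambda>x. (\<Sum>i\<in>I. Z i x)\<^sup>2) / a\<^sup>2"
  proof (rule second_moment_method)
    show "integrable M (\<lambda>x. (\<Sum>i\<in>I. Z i x)\<^sup>2)"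
      unfolding sqeq using ZZ_int by (intro Bochner_Integration.integrable_sum)
  qed (use a in auto)
  also have "\<dots> \<le> (\<Sum>i\<in>I. expectation (\<lambda>x. (X i x)\<^sup>2)) / a\<^sup>2"
    using le by (intro divide_right_mono) auto
  finally show ?thesis unfolding eq .
qed

lemma indep_vars_PiM_coordinates:
  assumes M: "\<And>i. prob_space (M i)" and I: "I \<noteq> {}"
  shows "prob_space.indep_vars (Pi\<^sub>M I M) M (\<lambda>i x. x i) I"
proof -
  interpret P: prob_space "Pi\<^sub>M I M" by (rule prob_space_PiM) (rule M)
  have "distr (Pi\<^sub>M I M) (Pi\<^sub>M I M) (\<lambda>x. \<lambda>i\<in>I. x i) = distr (Pi\<^sub>M I M) (Pi\<^sub>M I M) (\<lambda>x. x)"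
    by (intro distr_cong refl) (auto simp: space_PiM PiE_iff extensional_restrict)
  also have "\<dots> = (\<Pi>\<^sub>M i\<in>I. distr (Pi\<^sub>M I M) (M i) (\<lambda>x. x i))"
    using M by (auto simp: distr_PiM_component intro!: PiM_cong)
  finally show ?thesis
    by (subst P.indep_vars_iff_distr_eq_PiM') (use I in auto)
qed

text \<open>This is the mean of \<open>block_count\<close> for fixed \<open>W\<close>: the slot of
  \<open>j\<close> for edge \<open>k\<close> has length
  \<open>(sqrt (W (m * j)) - sqrt (W (m * (j - 1)))) / sqrt (W k)\<close>, and the two edges of a
  pair use independent coordinates.\<close>

definition mean_count :: "nat \<Rightarrow> (nat \<Rightarrow> real) \<Rightarrow> nat \<Rightarrow> real" where
  "mean_count m W i = (\<Sum>(k, k')\<in>block_pairs m i. \<Sum>j\<in>{1..<i}.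
     (sqrt (W (m * j)) - sqrt (W (m * (j - 1))))\<^sup>2 / (sqrt (W k) * sqrt (W k')))"

lemma slot_measurable [measurable]: "slot m W k j \<in> sets borel"
  by (simp add: slot_def)

text \<open>The slots of one edge are disjoint, so every pair is counted at most once and the number
  of pairs in the block is a bound.\<close>

lemma block_count_bounds:
  assumes W: "\<And>j k. j < k \<Longrightarrow> k \<le> m * i \<Longrightarrow> W j < W k" and "0 \<le> W 0" and "i \<ge> 1"
  shows "0 \<le> block_count m W i u" "block_count m W i u \<le> real m * (real m - 1) / 2"
proof -
  show "0 \<le> block_count m W i u"
    unfolding block_count_def by (auto intro!: sum_nonneg)
  have "(\<Sum>j\<in>{1..<i}. indicator (slot m W k j) (u k) * indicator (slot m W k' j) (u k')) \<le> (1::real)"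
    if "(k, k') \<in> block_pairs m i" for k k'
  proof -
    have k: "k \<le> m * i" "0 < k" using that by (auto simp: block_pairs_def)
    have "0 < W k" using W[of 0 k] k assms(2) by auto
    define J where "J = {j\<in>{1..<i}. u k \<in> slot m W k j}"
    have "j = j'" if "j \<in> J" "j' \<in> J" for j j'
    proof -
      have less: False if "a \<in> J" "b \<in> J" "a < b" for a b
      proof -
        have "u k \<le> sqrt (W (m * a) / W k)" "sqrt (W (m * (b - 1)) / W k) < u k"
          using that by (auto simp: J_def slot_def)
        then have "sqrt (W (m * (b - 1)) / W k) < sqrt (W (m * a) / W k)" by linarith
        then have "W (m * (b - 1)) < W (m * a)"
          using \<open>0 < W k\<close> by (simp add: divide_less_cancel)
        moreover have "W (m * a) \<le> W (m * (b - 1))"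
        proof (cases "m * a = m * (b - 1)")
          case False
          have "m * a \<le> m * (b - 1)" using that by (intro mult_le_mono2) auto
          moreover have "m * (b - 1) \<le> m * i" using that by (intro mult_le_mono2) (auto simp: J_def)
          ultimately show ?thesis using False W[of "m * a" "m * (b - 1)"] by simp
        qed (simp only: order_refl)
        ultimately show False by simp
      qed
      show ?thesis using less[of j j'] less[of j' j] that by (cases j j' rule: linorder_cases) auto
    qed
    then have "card J \<le> 1" by (intro card_le_Suc0_iff_eq[THEN iffD2, unfolded One_nat_def[symmetric]]) (auto simp: J_def)
    have "(\<Sum>j\<in>{1..<i}. indicator (slot m W k j) (u k) * indicator (slot m W k' j) (u k'))
      \<le> (\<Sum>j\<in>{1..<i}. indicator (slot m W k j) (u k) :: real)"
      by (intro sum_mono) (auto simp: indicator_def)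
    also have "\<dots> = real (card J)" by (simp add: J_def indicator_def sum.If_cases Int_def)
    also have "\<dots> \<le> 1" using \<open>card J \<le> 1\<close> by simp
    finally show ?thesis .
  qed
  then have "block_count m W i u \<le> (\<Sum>(k, k')\<in>block_pairs m i. 1)"
    unfolding block_count_def by (intro sum_mono) auto
  also have "\<dots> = real m * (real m - 1) / 2"
    using card_block_pairs[OF \<open>i \<ge> 1\<close>] by (simp add: case_prod_beta)
  finally show "block_count m W i u \<le> real m * (real m - 1) / 2" .
qed

context
  fixes m n :: nat and W :: "nat \<Rightarrow> real"
  assumes m: "m \<ge> 1"
    and W: "\<And>j k. j < k \<Longrightarrow> k \<le> m * n \<Longrightarrow> W j < W k" and W0: "W 0 = 0"
begin

declare One_nat_def [simp del]

private abbreviation "U \<equiv> Pi\<^sub>M {1..m * n} (\<lambda>_. unit_uniform)"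

interpretation U: prob_space U
  by (intro prob_space_PiM prob_space_unit_uniform)

private lemma block_le: "k \<le> m * i \<Longrightarrow> i \<le> n \<Longrightarrow> k \<le> m * n"
  by (rule order_trans) auto

private lemma pairs_in_range:
  assumes "i \<in> {1..n}" "(k, k') \<in> block_pairs m i"
  shows "k \<in> {1..m * n}" "k' \<in> {1..m * n}" "k \<noteq> k'"
  using assms by (auto simp: block_pairs_def intro: block_le[of _ i])

private lemma W_pos: "0 < k \<Longrightarrow> k \<le> m * n \<Longrightarrow> 0 < W k"
  using W[of 0 k] W0 by simp

private lemma W_nonneg: "k \<le> m * n \<Longrightarrow> 0 \<le> W k"
  using W_pos[of k] W0 by (cases "k = 0") auto

private lemma W_mono: "j \<le> k \<Longrightarrow> k \<le> m * n \<Longrightarrow> W j \<le> W k"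
  using W[of j k] by (cases "j = k") auto

private lemma component_measurable [measurable]:
  "k \<in> {1..m * n} \<Longrightarrow> (\<lambda>u. u k) \<in> borel_measurable U"
  using measurable_component_singleton[of k "{1..m * n}" "\<lambda>_. unit_uniform"]
  by (simp cong: measurable_cong_sets)

private lemma slot_indicator_measurable:
  assumes "k \<in> {1..m * n}"
  shows "(\<lambda>u. indicator (slot m W k j) (u k) :: real) \<in> borel_measurable U"
  by (rule measurable_compose[OF component_measurable[OF assms]]) simp

text \<open>For \<open>j < i\<close> the whole block \<open>j\<close> precedes \<open>k\<close>, so
  the slot lies inside the unit interval and its probability is its length.\<close>

private lemma expectation_slot:
  assumes i: "i \<in> {1..n}" and k: "m * (i - 1) < k" "k \<le> m * i" and j: "j \<in> {1..<i}"
  shows "U.expectation (\<lambda>u. indicator (slot m W k j) (u k))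
    = (sqrt (W (m * j)) - sqrt (W (m * (j - 1)))) / sqrt (W k)"
proof -
  have kN: "k \<le> m * n" using k i by (auto intro: block_le)
  then have kI: "k \<in> {1..m * n}" using k by auto
  have "m * j \<le> m * (i - 1)" "m * (j - 1) \<le> m * j" using j by (auto intro!: mult_le_mono2)
  then have "m * j \<le> k" "m * (j - 1) \<le> m * j" "m * j \<le> m * n" "m * (j - 1) \<le> m * n"
    using k kN by linarith+
  then have "0 \<le> W (m * (j - 1))" "W (m * (j - 1)) \<le> W (m * j)" "W (m * j) \<le> W k" "0 < W k"
    using kN kI by (blast intro: W_nonneg W_mono, blast intro: W_nonneg W_mono,
        blast intro: W_nonneg W_mono, auto intro: W_pos)
  then have "measure unit_uniform (slot m W k j) = sqrt (W (m * j) / W k) - sqrt (W (m * (j - 1)) / W k)"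
    unfolding slot_def by (intro measure_unit_uniform_Ioc) (auto intro!: divide_right_mono)
  also have "measure unit_uniform (slot m W k j) = (\<integral>x. indicator (slot m W k j) x \<partial>unit_uniform)"
    by simp
  also have "\<dots> = (\<integral>x. indicator (slot m W k j) x \<partial>distr U unit_uniform (\<lambda>u. u k))"
    by (subst distr_PiM_component[OF prob_space_unit_uniform kI]) simp
  also have "\<dots> = U.expectation (\<lambda>u. indicator (slot m W k j) (u k))"
    by (rule integral_distr[OF measurable_component_singleton[OF kI] borel_measurable_indicator]) simp
  finally show ?thesis by (simp add: real_sqrt_divide diff_divide_distrib)
qed

private lemma indep_coordinates:
  assumes "n \<ge> 1"
  shows "U.indep_vars (\<lambda>_. borel) (\<lambda>k u. u k) {1..m * n}"
proof -
  have "U.indep_vars (\<lambda>_. unit_uniform) (\<lambda>k u. u k) {1..m * n}"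
    using assms m by (intro indep_vars_PiM_coordinates prob_space_unit_uniform)
      (auto simp: Suc_le_eq One_nat_def)
  from U.indep_vars_compose2[OF this, of "\<lambda>_ x. x" "\<lambda>_. borel"] show ?thesis
    by (simp add: measurable_ident_sets)
qed

lemma block_count_measurable:
  "i \<in> {1..n} \<Longrightarrow> block_count m W i \<in> borel_measurable U"
  unfolding block_count_def[abs_def]
  by (intro borel_measurable_sum, clarify, intro borel_measurable_sum borel_measurable_times
      slot_indicator_measurable; rule pairs_in_range; assumption)

lemma expectation_block_count:
  assumes i: "i \<in> {1..n}"
  shows "U.expectation (block_count m W i) = mean_count m W i"
proof -
  have *: "integrable U (\<lambda>u. indicator (slot m W k j) (u k) * indicator (slot m W k' j) (u k') :: real) \<and>
    U.expectation (\<lambda>u. indicator (slot m W k j) (u k) * indicator (slot m W k' j) (u k'))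
    = (sqrt (W (m * j)) - sqrt (W (m * (j - 1))))\<^sup>2 / (sqrt (W k) * sqrt (W k'))"
    if kk: "(k, k') \<in> block_pairs m i" and j: "j \<in> {1..<i}" for k k' j
  proof -
    note r = pairs_in_range[OF i kk]
    define f where "f a u = (indicator (slot m W a j) (u a) :: real)" for a and u :: "nat \<Rightarrow> real"
    have "U.indep_vars (\<lambda>_. borel) f {k, k'}"
      unfolding f_def
      by (rule U.indep_vars_compose2[OF U.indep_vars_subset[OF indep_coordinates]])
         (use r i in auto)
    moreover have "integrable U (f a)" if "a \<in> {k, k'}" for a
      using that r unfolding f_def
      by (intro U.integrable_const_bound[where B=1] slot_indicator_measurable) auto
    ultimately have "integrable U (\<lambda>u. \<Prod>a\<in>{k, k'}. f a u)"
      "U.expectation (\<lambda>u. \<Prod>a\<in>{k, k'}. f a u) = (\<Prod>a\<in>{k, k'}. U.expectation (f a))"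
      by (auto intro!: U.indep_vars_integrable U.indep_vars_lebesgue_integral)
    moreover have "U.expectation (f a) = (sqrt (W (m * j)) - sqrt (W (m * (j - 1)))) / sqrt (W a)"
      if "a \<in> {k, k'}" for a
      unfolding f_def using that kk by (intro expectation_slot[OF i _ _ j]) (auto simp: block_pairs_def)
    ultimately show ?thesis using r(3) by (simp add: f_def power2_eq_square)
  qed
  define g where "g p j u = (indicator (slot m W (fst p) j) (u (fst p)) * indicator (slot m W (snd p) j) (u (snd p)) :: real)"
    for p j and u :: "nat \<Rightarrow> real"
  have g: "integrable U (g p j)" "U.expectation (g p j)
      = (sqrt (W (m * j)) - sqrt (W (m * (j - 1))))\<^sup>2 / (sqrt (W (fst p)) * sqrt (W (snd p)))"
    if "p \<in> block_pairs m i" "j \<in> {1..<i}" for p j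
    using *[of "fst p" "snd p" j] that unfolding g_def by auto
  have "U.expectation (block_count m W i) = U.expectation (\<lambda>u. \<Sum>p\<in>block_pairs m i. \<Sum>j\<in>{1..<i}. g p j u)"
    unfolding block_count_def[abs_def] g_def case_prod_beta ..
  also have "\<dots> = (\<Sum>p\<in>block_pairs m i. U.expectation (\<lambda>u. \<Sum>j\<in>{1..<i}. g p j u))"
    using g by (intro Bochner_Integration.integral_sum Bochner_Integration.integrable_sum)
  also have "\<dots> = (\<Sum>p\<in>block_pairs m i. \<Sum>j\<in>{1..<i}. U.expectation (g p j))"
    using g by (intro sum.cong refl Bochner_Integration.integral_sum)
  also have "\<dots> = mean_count m W i"
    unfolding mean_count_def case_prod_beta using g by (intro sum.cong refl) auto
  finally show ?thesis .
qed

text \<open>Different blocks read disjoint sets of independent coordinates.\<close>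

lemma indep_block_count:
  assumes "n \<ge> 1"
  shows "U.indep_vars (\<lambda>_. borel) (block_count m W) {1..n}"
proof -
  define K where "K i = {m * (i - 1)<..m * i}" for i
  have K: "K i \<subseteq> {1..m * n}" if "i \<in> {1..n}" for i
    using that by (auto simp: K_def intro: block_le[of _ i])
  have "i = i'" if "a \<in> K i" "a \<in> K i'" "i \<in> {1..n}" "i' \<in> {1..n}" for a i i'
    using that by (intro block_index_unique[of m i a i']) (auto simp: K_def)
  then have "disjoint_family_on K {1..n}" by (auto simp: disjoint_family_on_def)
  from U.indep_vars_restrict[OF indep_coordinates[OF assms] K this]
  have "U.indep_vars (\<lambda>i. Pi\<^sub>M (K i) (\<lambda>_. borel)) (\<lambda>i u. restrict u (K i)) {1..n}" by simp
  then have "U.indep_vars (\<lambda>_. borel) (\<lambda>i u. block_count m W i (restrict u (K i))) {1..n}"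
  proof (rule U.indep_vars_compose2)
    fix i
    show "block_count m W i \<in> borel_measurable (Pi\<^sub>M (K i) (\<lambda>_. borel))"
      unfolding block_count_def[abs_def]
      by (intro borel_measurable_sum, clarify, intro borel_measurable_sum borel_measurable_times)
         (auto intro!: measurable_compose[OF measurable_component_singleton borel_measurable_indicator]
           simp: block_pairs_def K_def)
  qed
  moreover have "block_count m W i (restrict u (K i)) = block_count m W i u" for i u
    unfolding block_count_def by (intro sum.cong refl) (auto simp: block_pairs_def K_def)
  ultimately show ?thesis by simp
qed

text \<open>A count between 0 and \<open>?q\<close> has square at most \<open>?q\<close> times
  itself, so the second moments are linear in the means. With mean and \<open>a\<close> both of
  order \<open>L\<close> the bound is of order \<open>1 / L\<close>. Blocks up to \<open>i0\<close>
  are left out because the estimates of the mean hold only beyond \<open>i0\<close>.\<close>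

lemma block_count_deviation:
  assumes n: "n \<ge> 1" and a: "a > 0"
  shows "measure U {u\<in>space U. \<bar>(\<Sum>i\<in>{i0<..n}. block_count m W i u) - (\<Sum>i\<in>{i0<..n}. mean_count m W i)\<bar> \<ge> a}
    \<le> real m * (real m - 1) / 2 * (\<Sum>i\<in>{i0<..n}. mean_count m W i) / a\<^sup>2"
proof -
  let ?q = "real m * (real m - 1) / 2"
  have bounds: "0 \<le> block_count m W i u" "block_count m W i u \<le> ?q" if "i \<in> {i0<..n}" for i u
  proof -
    have "W j < W k" if "j < k" "k \<le> m * i" for j k
      using that \<open>i \<in> {i0<..n}\<close> by (intro W) (auto intro: block_le)
    from block_count_bounds[OF this] that
    show "0 \<le> block_count m W i u" "block_count m W i u \<le> ?q" by (auto simp: W0)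
  qed
  have meas [measurable]: "block_count m W i \<in> borel_measurable U" if "i \<in> {i0<..n}" for i
    using that by (intro block_count_measurable) auto
  have int: "integrable U (block_count m W i)" if "i \<in> {i0<..n}" for i
    using that bounds[OF that] by (intro U.integrable_const_bound[where B="?q"]) (auto simp: meas)
  have sq_le: "(block_count m W i u)\<^sup>2 \<le> ?q * block_count m W i u" if "i \<in> {i0<..n}" for i u
    using mult_right_mono[OF bounds(2)[OF that] bounds(1)[OF that]] by (simp add: power2_eq_square)
  have int2: "integrable U (\<lambda>u. (block_count m W i u)\<^sup>2)" if "i \<in> {i0<..n}" for i
    using bounds[OF that]
    by (intro U.integrable_const_bound[where B="?q\<^sup>2"] borel_measurable_power meas that)
       (auto simp del: power_divide intro!: power_mono)
  have mean: "(\<Sum>i\<in>{i0<..n}. U.expectation (block_count m W i)) = (\<Sum>i\<in>{i0<..n}. mean_count m W i)"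
    by (intro sum.cong refl expectation_block_count) auto
  have "measure U {u\<in>space U. \<bar>(\<Sum>i\<in>{i0<..n}. block_count m W i u) - (\<Sum>i\<in>{i0<..n}. U.expectation (block_count m W i))\<bar> \<ge> a}
    \<le> (\<Sum>i\<in>{i0<..n}. U.expectation (\<lambda>u. (block_count m W i u)\<^sup>2)) / a\<^sup>2"
    by (rule U.prob_sum_deviation_le[OF _ U.indep_vars_subset[OF indep_block_count[OF n]] int2 a]) auto
  also have "\<dots> \<le> (\<Sum>i\<in>{i0<..n}. ?q * U.expectation (block_count m W i)) / a\<^sup>2"
  proof (intro divide_right_mono sum_mono)
    fix i assume i: "i \<in> {i0<..n}"
    have "U.expectation (\<lambda>u. (block_count m W i u)\<^sup>2) \<le> U.expectation (\<lambda>u. ?q * block_count m W i u)"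
      using sq_le[OF i] int[OF i] int2[OF i] by (intro integral_mono) auto
    then show "U.expectation (\<lambda>u. (block_count m W i u)\<^sup>2) \<le> ?q * U.expectation (block_count m W i)" by simp
  qed simp
  also have "\<dots> = ?q * (\<Sum>i\<in>{i0<..n}. U.expectation (block_count m W i)) / a\<^sup>2"
    by (simp add: sum_distrib_left)
  finally show ?thesis unfolding mean .
qed

end

section \<open>Deterministic estimates of the conditional mean\<close>

text \<open>Replacing \<open>W k\<close> by \<open>k\<close> and \<open>(sqrt x - sqrt y)\<^sup>2\<close> by \<open>(x - y)\<^sup>2 / (4 * x)\<close> turns the sum of the
  \<open>mean_count\<close> into a multiple of \<open>weighted_sum\<close>.\<close>

definition weighted_sum :: "nat \<Rightarrow> nat \<Rightarrow> (nat \<Rightarrow> real) \<Rightarrow> real" where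
  "weighted_sum m n W = (\<Sum>i=1..n. (\<Sum>j\<in>{1..<i}. (W (m * j) - W (m * (j - 1)))\<^sup>2 / real j) / real i)"

text \<open>A crude bound for early blocks, where no lower bound on \<open>W\<close> by a multiple
  of the index is available; it telescopes.\<close>

lemma sqrt_diff_squared_le:
  fixes x y :: real
  assumes "0 \<le> y" "y \<le> x"
  shows "(sqrt x - sqrt y)\<^sup>2 \<le> x - y"
proof -
  have "y = sqrt y * sqrt y" using assms by simp
  also have "\<dots> \<le> sqrt x * sqrt y" using assms by (intro mult_right_mono) auto
  finally show ?thesis using assms by (simp add: power2_diff)
qed

text \<open>Factor \<open>x - y = (sqrt x - sqrt y) * (sqrt x + sqrt y)\<close>; the second factor
  lies between \<open>2 * sqrt c\<close> and \<open>2 * sqrt C\<close>.\<close>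

lemma sqrt_diff_squared_bounds:
  fixes x y c C :: real
  assumes "0 < c" "c \<le> y" "y \<le> x" "x \<le> C"
  shows "(x - y)\<^sup>2 / (4 * C) \<le> (sqrt x - sqrt y)\<^sup>2" "(sqrt x - sqrt y)\<^sup>2 \<le> (x - y)\<^sup>2 / (4 * c)"
proof -
  have pos: "0 < x" "0 < y" "0 < C" using assms by auto
  have eq: "(x - y)\<^sup>2 = (sqrt x - sqrt y)\<^sup>2 * (sqrt x + sqrt y)\<^sup>2"
  proof -
    have "x - y = (sqrt x - sqrt y) * (sqrt x + sqrt y)"
      using pos by (simp add: algebra_simps)
    then show ?thesis by (metis power_mult_distrib)
  qed
  have "(sqrt x + sqrt y)\<^sup>2 \<le> (2 * sqrt C)\<^sup>2"
    using assms pos by (intro power_mono) (auto intro!: add_mono[of _ "sqrt C" _ "sqrt C", simplified])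
  then have u: "(sqrt x + sqrt y)\<^sup>2 \<le> 4 * C" using pos by (simp add: power_mult_distrib)
  have "(2 * sqrt c)\<^sup>2 \<le> (sqrt x + sqrt y)\<^sup>2"
    using assms by (intro power_mono) (auto intro!: add_mono[of "sqrt c" _ "sqrt c", simplified])
  then have l: "4 * c \<le> (sqrt x + sqrt y)\<^sup>2" using assms by (simp add: power_mult_distrib)
  show "(x - y)\<^sup>2 / (4 * C) \<le> (sqrt x - sqrt y)\<^sup>2"
    using mult_left_mono[OF u, of "(sqrt x - sqrt y)\<^sup>2"] pos by (simp add: eq divide_le_eq)
  show "(sqrt x - sqrt y)\<^sup>2 \<le> (x - y)\<^sup>2 / (4 * c)"
    using mult_left_mono[OF l, of "(sqrt x - sqrt y)\<^sup>2"] assms by (simp add: eq le_divide_eq)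
qed

lemma sum_squares_le_square_sum:
  fixes f :: "'i \<Rightarrow> real"
  assumes "finite A" "\<And>i. i \<in> A \<Longrightarrow> 0 \<le> f i"
  shows "(\<Sum>i\<in>A. (f i)\<^sup>2) \<le> (\<Sum>i\<in>A. f i)\<^sup>2"
  using assms
proof (induction A rule: finite_induct)
  case (insert a A)
  have "(\<Sum>i\<in>insert a A. (f i)\<^sup>2) \<le> (f a)\<^sup>2 + (\<Sum>i\<in>A. f i)\<^sup>2"
    using insert by simp
  also have "\<dots> \<le> (f a + (\<Sum>i\<in>A. f i))\<^sup>2"
    using insert by (simp add: power2_sum sum_nonneg)
  finally show ?case using insert by simp
qed simp

text \<open>The bound \<open>lower\<close> has \<open>i + 1\<close> because it is applied at the
  left end \<open>m * (i - 1)\<close> of block \<open>i\<close>, where it yields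
  \<open>(1 - \<epsilon>) * m * i\<close> for the whole block by monotonicity.\<close>

context
  fixes m n i0 :: nat and W :: "nat \<Rightarrow> real" and \<epsilon> :: real
  assumes m: "m \<ge> 1"
    and W: "\<And>j k. j < k \<Longrightarrow> k \<le> m * n \<Longrightarrow> W j < W k" and W0: "W 0 = 0"
    and \<epsilon>: "0 < \<epsilon>" "\<epsilon> < 1" and i0: "i0 \<le> n"
    and lower: "\<And>i. i \<in> {i0..n} \<Longrightarrow> (1 - \<epsilon>) * real m * real (i + 1) \<le> W (m * i)"
    and upper: "\<And>i. i \<in> {i0..n} \<Longrightarrow> W (m * i) \<le> (1 + \<epsilon>) * real m * real i"
begin

declare One_nat_def [simp del]

private definition "q = real m * (real m - 1) / 2"
private definition "\<Delta> j = W (m * j) - W (m * (j - 1))"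
private definition "a j = (sqrt (W (m * j)) - sqrt (W (m * (j - 1))))\<^sup>2"

private lemma W_mono': "j \<le> k \<Longrightarrow> k \<le> m * n \<Longrightarrow> W j \<le> W k"
  using W[of j k] by (cases "j = k") auto

private lemma W_block_mono: "j \<le> k \<Longrightarrow> k \<le> n \<Longrightarrow> W (m * j) \<le> W (m * k)"
  by (intro W_mono') auto

private lemma W_nonneg': "k \<le> n \<Longrightarrow> 0 \<le> W (m * k)"
  using W_block_mono[of 0 k] W0 by simp

private lemma q_nonneg: "0 \<le> q"
  using m by (simp add: q_def)

text \<open>The coefficient combines \<open>q\<close> pairs, the factor
  \<open>1 / (e * m * i)\<close> of a pair and the factor \<open>1 / (4 * e * m * j)\<close> of a
  squared difference of roots, without \<open>i\<close> and \<open>j\<close>. It is used with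
  \<open>e = 1 - \<epsilon>\<close> and \<open>e = 1 + \<epsilon>\<close>.\<close>

private lemma coefficient_eq:
  assumes "e \<noteq> 0"
  shows "q / (e * real m * (4 * e * real m)) = (real m - 1) / (8 * real m * e\<^sup>2)"
  using assms m by (simp add: q_def divide_simps power2_eq_square)

private lemma sum_telescope: "k \<le> n \<Longrightarrow> (\<Sum>j\<in>{1..k}. \<Delta> j) = W (m * k)"
proof (induction k)
  case (Suc k)
  then show ?case by (simp add: \<Delta>_def)
qed (simp add: W0)

text \<open>The inner sum over \<open>j\<close> is the same for all pairs; only the denominator
  varies, and for block \<open>i\<close> it lies between \<open>c\<close> and
  \<open>C\<close>.\<close>

private lemma mean_count_bounds:
  assumes i: "i \<in> {i0<..n}"
  shows "q / ((1 + \<epsilon>) * real m * real i) * (\<Sum>j\<in>{1..<i}. a j) \<le> mean_count m W i"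
    "mean_count m W i \<le> q / ((1 - \<epsilon>) * real m * real i) * (\<Sum>j\<in>{1..<i}. a j)"
proof -
  define c where "c = (1 - \<epsilon>) * real m * real i"
  define C where "C = (1 + \<epsilon>) * real m * real i"
  have pos: "0 < c" "0 < C" using \<epsilon> m i by (auto simp: c_def C_def)
  have S: "0 \<le> (\<Sum>j\<in>{1..<i}. a j)" by (intro sum_nonneg) (simp add: a_def)
  have Wk: "c \<le> W k" "W k \<le> C" if "m * (i - 1) < k" "k \<le> m * i" for k
  proof -
    have "m * i \<le> m * n" using i by auto
    then have "k \<le> m * n" using that by linarith
    have "c = (1 - \<epsilon>) * real m * real (i - 1 + 1)" using i by (simp add: c_def)
    also have "\<dots> \<le> W (m * (i - 1))" using i by (intro lower) auto
    also have "\<dots> \<le> W k" using that \<open>k \<le> m * n\<close> by (intro W_mono') auto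
    finally show "c \<le> W k" .
    have "W k \<le> W (m * i)" using that \<open>m * i \<le> m * n\<close> by (intro W_mono')
    also have "\<dots> \<le> C" unfolding C_def using i by (intro upper) auto
    finally show "W k \<le> C" .
  qed
  have prod: "c \<le> sqrt (W k) * sqrt (W k') \<and> sqrt (W k) * sqrt (W k') \<le> C"
    if "(k, k') \<in> block_pairs m i" for k k'
  proof -
    have k: "c \<le> W k" "W k \<le> C" "c \<le> W k'" "W k' \<le> C"
      using that by (auto intro!: Wk simp: block_pairs_def)
    have "sqrt c * sqrt c \<le> sqrt (W k) * sqrt (W k')"
      using k pos by (intro mult_mono) auto
    moreover have "sqrt (W k) * sqrt (W k') \<le> sqrt C * sqrt C"
      using k pos by (intro mult_mono) auto
    ultimately show ?thesis using pos by simp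
  qed
  have eq: "mean_count m W i = (\<Sum>(k, k')\<in>block_pairs m i. (\<Sum>j\<in>{1..<i}. a j) / (sqrt (W k) * sqrt (W k')))"
    unfolding mean_count_def a_def by (simp add: sum_divide_distrib case_prod_beta)
  have card: "real (card (block_pairs m i)) = q"
    using card_block_pairs[of i m] i by (simp add: q_def One_nat_def)
  have "q / C * (\<Sum>j\<in>{1..<i}. a j) = (\<Sum>(k, k')\<in>block_pairs m i. (\<Sum>j\<in>{1..<i}. a j) / C)"
    by (simp add: case_prod_beta card)
  also have "\<dots> \<le> mean_count m W i"
    unfolding eq
  proof (intro sum_mono, clarify)
    fix k k' assume "(k, k') \<in> block_pairs m i"
    from prod[OF this] pos S show "(\<Sum>j\<in>{1..<i}. a j) / C \<le> (\<Sum>j\<in>{1..<i}. a j) / (sqrt (W k) * sqrt (W k'))"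
      by (intro divide_left_mono) auto
  qed
  finally show "q / ((1 + \<epsilon>) * real m * real i) * (\<Sum>j\<in>{1..<i}. a j) \<le> mean_count m W i"
    by (simp only: C_def)
  have "mean_count m W i \<le> (\<Sum>(k, k')\<in>block_pairs m i. (\<Sum>j\<in>{1..<i}. a j) / c)"
    unfolding eq
  proof (intro sum_mono, clarify)
    fix k k' assume "(k, k') \<in> block_pairs m i"
    from prod[OF this] pos S show "(\<Sum>j\<in>{1..<i}. a j) / (sqrt (W k) * sqrt (W k')) \<le> (\<Sum>j\<in>{1..<i}. a j) / c"
      by (intro divide_left_mono) (auto intro!: mult_pos_pos intro: less_le_trans)
  qed
  also have "\<dots> = q / c * (\<Sum>j\<in>{1..<i}. a j)"
    by (simp add: case_prod_beta card)
  finally show "mean_count m W i \<le> q / ((1 - \<epsilon>) * real m * real i) * (\<Sum>j\<in>{1..<i}. a j)"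
    by (simp only: c_def)
qed

private lemma a_bounds:
  assumes j: "j \<in> {i0<..n}"
  shows "(\<Delta> j)\<^sup>2 / real j / (4 * (1 + \<epsilon>) * real m) \<le> a j" "a j \<le> (\<Delta> j)\<^sup>2 / real j / (4 * (1 - \<epsilon>) * real m)"
proof -
  have "(1 - \<epsilon>) * real m * real (j - 1 + 1) \<le> W (m * (j - 1))" using j by (intro lower) auto
  then have "(1 - \<epsilon>) * real m * real j \<le> W (m * (j - 1))" using j by simp
  moreover have "W (m * (j - 1)) \<le> W (m * j)" using j by (intro W_block_mono) auto
  moreover have "W (m * j) \<le> (1 + \<epsilon>) * real m * real j" using j by (intro upper) auto
  moreover have "0 < (1 - \<epsilon>) * real m * real j" using j \<epsilon> m by simp
  ultimately show "(\<Delta> j)\<^sup>2 / real j / (4 * (1 + \<epsilon>) * real m) \<le> a j" "a j \<le> (\<Delta> j)\<^sup>2 / real j / (4 * (1 - \<epsilon>) * real m)"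
    using sqrt_diff_squared_bounds[of "(1 - \<epsilon>) * real m * real j" "W (m * (j - 1))" "W (m * j)"
        "(1 + \<epsilon>) * real m * real j"]
    by (simp_all add: a_def \<Delta>_def mult_ac)
qed

text \<open>The early terms telescope to a quantity that \<open>upper\<close> bounds independently
  of \<open>n\<close>. After the division by \<open>i\<close> and the summation over
  \<open>i\<close> they cost only a multiple of \<open>harm n\<close>, which is negligible against
  the squared logarithm.\<close>

private lemma sum_a_le: "(\<Sum>j\<in>{1..i0}. a j) \<le> W (m * i0)"
proof -
  have "(\<Sum>j\<in>{1..i0}. a j) \<le> (\<Sum>j\<in>{1..i0}. \<Delta> j)"
  proof (rule sum_mono)
    fix j assume "j \<in> {1..i0}"
    then have "j \<le> n" "j - 1 \<le> n" using i0 by auto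
    then show "a j \<le> \<Delta> j"
      unfolding a_def \<Delta>_def by (intro sqrt_diff_squared_le W_nonneg' W_block_mono) auto
  qed
  then show ?thesis using sum_telescope[OF i0] by simp
qed

text \<open>The counterpart for the lower estimate: \<open>weighted_sum\<close> contains the early
  terms, and this bounds what has to be subtracted. The increments are nonnegative, so their squares
  sum to at most the square of the telescoping sum.\<close>

private lemma sum_Delta_squared_le: "(\<Sum>j\<in>{1..i0}. (\<Delta> j)\<^sup>2 / real j) \<le> ((1 + \<epsilon>) * real m * real i0)\<^sup>2"
proof -
  have nonneg: "0 \<le> \<Delta> j" if "j \<in> {1..i0}" for j
    using that i0 W_block_mono[of "j - 1" j] by (auto simp: \<Delta>_def)
  have "(\<Sum>j\<in>{1..i0}. (\<Delta> j)\<^sup>2 / real j) \<le> (\<Sum>j\<in>{1..i0}. (\<Delta> j)\<^sup>2)"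
    by (intro sum_mono) (auto simp: divide_le_eq mult_le_cancel_left1)
  also have "\<dots> \<le> (\<Sum>j\<in>{1..i0}. \<Delta> j)\<^sup>2"
    using nonneg by (intro sum_squares_le_square_sum) auto
  also have "\<dots> \<le> ((1 + \<epsilon>) * real m * real i0)\<^sup>2"
    unfolding sum_telescope[OF i0] using i0 upper[of i0] W_nonneg'[OF i0] by (intro power_mono) auto
  finally show ?thesis .
qed

text \<open>The inner sum is split at \<open>i0\<close>. The early part is absorbed in the
  \<open>harm n\<close> term; the late part is comparable to the weighted sum and may be completed
  to all indices since its terms are nonnegative.\<close>

lemma sum_mean_count_le:
  "(\<Sum>i\<in>{i0<..n}. mean_count m W i)
    \<le> real m * (real m - 1) / 2 * ((1 + \<epsilon>) / (1 - \<epsilon>) * real i0) * harm n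
      + (real m - 1) / (8 * real m * (1 - \<epsilon>)\<^sup>2) * weighted_sum m n W"
proof -
  define f where "f j = (\<Delta> j)\<^sup>2 / real j" for j
  have f: "0 \<le> f j" for j by (simp add: f_def)
  define A where "A = (1 + \<epsilon>) * real m * real i0"
  define B where "B = 4 * (1 - \<epsilon>) * real m"
  have pos: "0 < B" "0 \<le> A" using \<epsilon> m by (auto simp: B_def A_def)
  have S: "(\<Sum>j\<in>{1..<i}. a j) \<le> A + (\<Sum>j\<in>{1..<i}. f j) / B" if i: "i \<in> {i0<..n}" for i
  proof -
    have "(\<Sum>j\<in>{1..<i}. a j) = (\<Sum>j\<in>{1..i0}. a j) + (\<Sum>j\<in>{i0<..<i}. a j)"
      using i by (subst sum.union_disjoint[symmetric]) (auto intro!: sum.cong simp: One_nat_def)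
    also have "\<dots> \<le> A + (\<Sum>j\<in>{i0<..<i}. f j / B)"
    proof (intro add_mono sum_mono)
      show "(\<Sum>j\<in>{1..i0}. a j) \<le> A" using sum_a_le upper[of i0] i0 by (auto simp: A_def)
      show "a j \<le> f j / B" if "j \<in> {i0<..<i}" for j
        using a_bounds(2)[of j] that i by (auto simp: f_def B_def)
    qed
    also have "(\<Sum>j\<in>{i0<..<i}. f j / B) \<le> (\<Sum>j\<in>{1..<i}. f j / B)"
      using f pos by (intro sum_mono2) (auto simp: One_nat_def)
    finally show ?thesis by (simp add: sum_divide_distrib)
  qed
  have "(\<Sum>i\<in>{i0<..n}. mean_count m W i)
      \<le> (\<Sum>i\<in>{i0<..n}. q / ((1 - \<epsilon>) * real m * real i) * (A + (\<Sum>j\<in>{1..<i}. f j) / B))"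
  proof (rule sum_mono)
    fix i assume i: "i \<in> {i0<..n}"
    have "0 \<le> q / ((1 - \<epsilon>) * real m * real i)" using q_nonneg \<epsilon> by simp
    from mult_left_mono[OF S[OF i] this] mean_count_bounds(2)[OF i]
    show "mean_count m W i \<le> q / ((1 - \<epsilon>) * real m * real i) * (A + (\<Sum>j\<in>{1..<i}. f j) / B)" by linarith
  qed
  also have "\<dots> \<le> (\<Sum>i\<in>{1..n}. q / ((1 - \<epsilon>) * real m * real i) * (A + (\<Sum>j\<in>{1..<i}. f j) / B))"
    using q_nonneg \<epsilon> pos f
    by (intro sum_mono2) (auto simp: One_nat_def intro!: mult_nonneg_nonneg divide_nonneg_nonneg add_nonneg_nonneg sum_nonneg)
  also have "\<dots> = (\<Sum>i\<in>{1..n}. q / ((1 - \<epsilon>) * real m) * A * inverse (real i)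
      + q / ((1 - \<epsilon>) * real m * B) * ((\<Sum>j\<in>{1..<i}. f j) / real i))"
    by (intro sum.cong refl) (simp add: divide_inverse distrib_left mult_ac)
  also have "\<dots> = q / ((1 - \<epsilon>) * real m) * A * harm n + q / ((1 - \<epsilon>) * real m * B) * weighted_sum m n W"
    by (simp add: sum.distrib sum_distrib_left harm_def weighted_sum_def f_def \<Delta>_def)
  also have "q / ((1 - \<epsilon>) * real m) * A = real m * (real m - 1) / 2 * ((1 + \<epsilon>) / (1 - \<epsilon>) * real i0)"
    using \<epsilon> m by (simp add: A_def q_def field_simps)
  also have "q / ((1 - \<epsilon>) * real m * B) = (real m - 1) / (8 * real m * (1 - \<epsilon>)\<^sup>2)"
    using \<epsilon> coefficient_eq[of "1 - \<epsilon>"] by (simp add: B_def)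
  finally show ?thesis .
qed

text \<open>Here the early terms \<open>a j\<close> are dropped, so the early part of the weighted
  sum is first removed at the cost of a multiple of \<open>harm n\<close>.\<close>

lemma sum_mean_count_ge:
  "(real m - 1) / (8 * real m * (1 + \<epsilon>)\<^sup>2) * (weighted_sum m n W - ((1 + \<epsilon>) * real m * real i0)\<^sup>2 * harm n)
    \<le> (\<Sum>i\<in>{i0<..n}. mean_count m W i)"
proof -
  define f where "f j = (\<Delta> j)\<^sup>2 / real j" for j
  have f: "0 \<le> f j" for j by (simp add: f_def)
  define A where "A = ((1 + \<epsilon>) * real m * real i0)\<^sup>2"
  define B where "B = 4 * (1 + \<epsilon>) * real m"
  have pos: "0 < B" using \<epsilon> m by (auto simp: B_def)
  have "weighted_sum m n W = (\<Sum>i\<in>{1..n}. (\<Sum>j\<in>{1..<i}. f j) / real i)"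
    by (simp add: weighted_sum_def f_def \<Delta>_def)
  also have "\<dots> \<le> (\<Sum>i\<in>{1..n}. (A + (\<Sum>j\<in>{i0<..<i}. f j)) / real i)"
  proof (intro sum_mono divide_right_mono)
    fix i
    have "(\<Sum>j\<in>{1..<i}. f j) \<le> (\<Sum>j\<in>{1..i0} \<union> {i0<..<i}. f j)"
      using f by (intro sum_mono2) auto
    also have "\<dots> = (\<Sum>j\<in>{1..i0}. f j) + (\<Sum>j\<in>{i0<..<i}. f j)"
      by (intro sum.union_disjoint) auto
    also have "(\<Sum>j\<in>{1..i0}. f j) \<le> A"
      using sum_Delta_squared_le by (simp add: f_def A_def)
    finally show "(\<Sum>j\<in>{1..<i}. f j) \<le> A + (\<Sum>j\<in>{i0<..<i}. f j)" by simp
  qed simp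
  also have "\<dots> = A * harm n + (\<Sum>i\<in>{1..n}. (\<Sum>j\<in>{i0<..<i}. f j) / real i)"
    by (simp add: distrib_right sum.distrib harm_def sum_distrib_left divide_inverse)
  also have "(\<Sum>i\<in>{1..n}. (\<Sum>j\<in>{i0<..<i}. f j) / real i) = (\<Sum>i\<in>{i0<..n}. (\<Sum>j\<in>{i0<..<i}. f j) / real i)"
    by (intro sum.mono_neutral_right) (auto simp: One_nat_def)
  finally have le: "weighted_sum m n W - A * harm n \<le> (\<Sum>i\<in>{i0<..n}. (\<Sum>j\<in>{i0<..<i}. f j) / real i)" by simp
  have "(real m - 1) / (8 * real m * (1 + \<epsilon>)\<^sup>2) = q / ((1 + \<epsilon>) * real m * B)"
    using \<epsilon> coefficient_eq[of "1 + \<epsilon>"] by (simp add: B_def)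
  then have "(real m - 1) / (8 * real m * (1 + \<epsilon>)\<^sup>2) * (weighted_sum m n W - A * harm n)
      \<le> q / ((1 + \<epsilon>) * real m * B) * (\<Sum>i\<in>{i0<..n}. (\<Sum>j\<in>{i0<..<i}. f j) / real i)"
    using le q_nonneg pos \<epsilon> by (simp only:) (intro mult_left_mono, auto)
  also have "\<dots> = (\<Sum>i\<in>{i0<..n}. q / ((1 + \<epsilon>) * real m * real i) * ((\<Sum>j\<in>{i0<..<i}. f j) / B))"
    unfolding sum_distrib_left by (intro sum.cong refl) simp
  also have "\<dots> \<le> (\<Sum>i\<in>{i0<..n}. mean_count m W i)"
  proof (rule sum_mono)
    fix i assume i: "i \<in> {i0<..n}"
    have "(\<Sum>j\<in>{i0<..<i}. f j) / B = (\<Sum>j\<in>{i0<..<i}. f j / B)" by (simp add: sum_divide_distrib)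
    also have "\<dots> \<le> (\<Sum>j\<in>{i0<..<i}. a j)"
      using a_bounds(1) i by (intro sum_mono) (auto simp: f_def B_def)
    also have "\<dots> \<le> (\<Sum>j\<in>{1..<i}. a j)"
      by (intro sum_mono2) (auto simp: a_def One_nat_def)
    finally have "(\<Sum>j\<in>{i0<..<i}. f j) / B \<le> (\<Sum>j\<in>{1..<i}. a j)" .
    moreover have "0 \<le> q / ((1 + \<epsilon>) * real m * real i)" using q_nonneg \<epsilon> by simp
    ultimately show "q / ((1 + \<epsilon>) * real m * real i) * ((\<Sum>j\<in>{i0<..<i}. f j) / B) \<le> mean_count m W i"
      using mean_count_bounds(1)[OF i] mult_left_mono by fastforce
  qed
  finally show ?thesis by (simp only: A_def)
qed

end

section \<open>Concentration of the weights\<close>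

lemma sum_inverse_squares_le:
  assumes "1 \<le> a"
  shows "(\<Sum>i=a..n. 1 / (real i)\<^sup>2) \<le> 2 / real a"
proof (cases "a \<le> n")
  case True
  \<comment> \<open>The subtracted \<open>1 / n\<close> strengthens the claim so that the induction
    closes, through \<open>1 / (n + 1)^2 <= 1 / n - 1 / (n + 1)\<close>.\<close>
  have "(\<Sum>i=a..n. 1 / (real i)\<^sup>2) \<le> 2 / real a - 1 / real n"
    using True
  proof (induction n rule: dec_induct)
    case base
    then show ?case using assms by (simp add: power2_eq_square field_simps)
  next
    case (step n)
    define x where "x = real n"
    have "0 < x" using step assms by (simp add: x_def)
    then have "1 / (x + 1)\<^sup>2 \<le> 1 / (x * (x + 1))"
      by (intro divide_left_mono) (auto simp: power2_eq_square)
    also have "\<dots> = 1 / x - 1 / (x + 1)" using \<open>0 < x\<close> by (simp add: field_simps)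
    finally have "1 / (real (Suc n))\<^sup>2 \<le> 1 / real n - 1 / real (Suc n)" by (simp add: x_def add.commute)
    moreover have "(\<Sum>i=a..Suc n. 1 / (real i)\<^sup>2) = (\<Sum>i=a..n. 1 / (real i)\<^sup>2) + 1 / (real (Suc n))\<^sup>2"
      using step by simp
    ultimately show ?case using step.IH by linarith
  qed
  moreover have "0 \<le> 1 / real n" by simp
  ultimately show ?thesis by linarith
qed (use assms in simp)

text \<open>\<open>weighted_sum\<close> with every squared increment replaced by 1; the mean of the
  weighted sum is therefore \<open>m * (m + 1) * harm2 n\<close>.\<close>

definition harm2 :: "nat \<Rightarrow> real" where
  "harm2 n = (\<Sum>i=1..n. (\<Sum>j\<in>{1..<i}. 1 / real j) / real i)"

text \<open>In the square of the harmonic sum each pair \<open>j < i\<close> occurs twice, and the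
  diagonal stays bounded. This is why \<open>harm2 n\<close> is asymptotic to half the squared
  logarithm.\<close>

lemma harm_squared: "(harm n)\<^sup>2 = 2 * harm2 n + (\<Sum>i=1..n. 1 / (real i)\<^sup>2)"
proof (induction n)
  case (Suc n)
  have "{1..<Suc n} = {1..n}" by auto
  then have "harm2 (Suc n) = harm2 n + harm n / real (Suc n)"
    by (simp add: harm2_def harm_def inverse_eq_divide)
  moreover have "(harm (Suc n))\<^sup>2 = (harm n)\<^sup>2 + 2 * (harm n / real (Suc n)) + 1 / (real (Suc n))\<^sup>2"
    unfolding harm_Suc power2_sum inverse_eq_divide power_divide by simp
  moreover have "(\<Sum>i=1..Suc n. 1 / (real i)\<^sup>2) = (\<Sum>i=1..n. 1 / (real i)\<^sup>2) + 1 / (real (Suc n))\<^sup>2"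
    by simp
  ultimately show ?case using Suc by linarith
qed (simp add: harm2_def harm_def)

lemma ln_real_at_top: "filterlim (\<lambda>n. ln (real n)) at_top sequentially"
  by (rule filterlim_compose[OF ln_at_top filterlim_real_sequentially])

lemma const_div_ln_squared_tendsto: "(\<lambda>n. c / (ln (real n))\<^sup>2) \<longlonglongrightarrow> (0::real)"
  by (intro tendsto_divide_0[OF tendsto_const] filterlim_at_top_imp_at_infinity
      filterlim_pow_at_top ln_real_at_top) simp

lemma harm_div_ln_tendsto: "(\<lambda>n. harm n / ln (real n)) \<longlonglongrightarrow> 1"
proof -
  have "(\<lambda>n. (harm n - ln (real n)) / ln (real n)) \<longlonglongrightarrow> 0"
    using tendsto_divide_0[OF euler_mascheroni_LIMSEQ filterlim_at_top_imp_at_infinity[OF ln_real_at_top]] by simp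
  then have "(\<lambda>n. 1 + (harm n - ln (real n)) / ln (real n)) \<longlonglongrightarrow> 1 + 0"
    by (intro tendsto_intros)
  moreover have "\<forall>\<^sub>F n in sequentially. 1 + (harm n - ln (real n)) / ln (real n) = harm n / ln (real n)"
    using eventually_gt_at_top[of 1] by eventually_elim (simp add: field_simps)
  ultimately show ?thesis by (simp add: filterlim_cong)
qed

lemma harm_div_ln_squared_tendsto: "(\<lambda>n. harm n / (ln (real n))\<^sup>2) \<longlonglongrightarrow> 0"
proof -
  have "(\<lambda>n. 1 / ln (real n)) \<longlonglongrightarrow> 0"
    by (intro tendsto_divide_0[OF tendsto_const] filterlim_at_top_imp_at_infinity ln_real_at_top)
  from tendsto_mult[OF harm_div_ln_tendsto this] show ?thesis
    by (simp add: power2_eq_square)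
qed

lemma harm2_div_ln_squared_tendsto: "(\<lambda>n. harm2 n / (ln (real n))\<^sup>2) \<longlonglongrightarrow> 1 / 2"
proof -
  have "(\<lambda>n. (\<Sum>i=1..n. 1 / (real i)\<^sup>2) / (ln (real n))\<^sup>2) \<longlonglongrightarrow> 0"
  proof (rule tendsto_sandwich[of "\<lambda>_. 0" _ _ "\<lambda>n. 2 / (ln (real n))\<^sup>2"])
    show "(\<lambda>n. 2 / (ln (real n))\<^sup>2) \<longlonglongrightarrow> 0" by (rule const_div_ln_squared_tendsto)
    show "\<forall>\<^sub>F n in sequentially. (\<Sum>i=1..n. 1 / (real i)\<^sup>2) / (ln (real n))\<^sup>2 \<le> 2 / (ln (real n))\<^sup>2"
      using sum_inverse_squares_le[of 1] by (intro always_eventually allI divide_right_mono) simp_all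
    show "\<forall>\<^sub>F n in sequentially. 0 \<le> (\<Sum>i=1..n. 1 / (real i)\<^sup>2) / (ln (real n))\<^sup>2"
      by (intro always_eventually allI divide_nonneg_nonneg sum_nonneg) auto
  qed simp
  from tendsto_divide[OF tendsto_diff[OF tendsto_power[OF harm_div_ln_tendsto, of 2] this] tendsto_const[of 2]]
  have "(\<lambda>n. ((harm n / ln (real n))\<^sup>2 - (\<Sum>i=1..n. 1 / (real i)\<^sup>2) / (ln (real n))\<^sup>2) / 2)
      \<longlonglongrightarrow> (1\<^sup>2 - 0) / 2"
    by simp
  moreover have "((harm n / ln (real n))\<^sup>2 - (\<Sum>i=1..n. 1 / (real i)\<^sup>2) / (ln (real n))\<^sup>2) / 2
      = harm2 n / (ln (real n))\<^sup>2" for n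
    unfolding power_divide harm_squared by (simp flip: diff_divide_distrib)
  ultimately show ?thesis by (simp only: power_one diff_zero)
qed

section \<open>Moments of sums of exponential variables\<close>

lemma (in prob_space) erlang_moments:
  assumes D: "distributed M lborel X (erlang_density K 1)"
  shows "expectation X = real K + 1"
    "expectation (\<lambda>x. (X x)\<^sup>2) = (real K + 1) * (real K + 2)"
    "expectation (\<lambda>x. X x ^ 3) = (real K + 1) * (real K + 2) * (real K + 3)"
    "expectation (\<lambda>x. X x ^ 4) = (real K + 1) * (real K + 2) * (real K + 3) * (real K + 4)"
proof -
  \<comment> \<open>The moment of order \<open>i\<close> is \<open>fact (K + i) / fact K\<close>, a
    rising factorial; shape \<open>K\<close> belongs to a sum of \<open>K + 1\<close> unit
    exponentials.\<close>
  define F where "F = (fact K :: real)"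
  have "F \<noteq> 0" by (simp add: F_def)
  have "fact (K + 1) = (real K + 1) * F" by (simp add: F_def)
  moreover from this have 2: "fact (K + 2) = (real K + 1) * (real K + 2) * F" by simp
  moreover have 3: "fact (K + 3) = (real K + 1) * (real K + 2) * (real K + 3) * F"
    using 2 by (simp add: numeral_3_eq_3)
  moreover have "fact (K + 4) = (real K + 1) * (real K + 2) * (real K + 3) * (real K + 4) * F"
    using 3 fact_Suc[of "K + 3", where 'a=real] by (simp add: algebra_simps)
  ultimately show "expectation X = real K + 1"
    "expectation (\<lambda>x. (X x)\<^sup>2) = (real K + 1) * (real K + 2)"
    "expectation (\<lambda>x. X x ^ 3) = (real K + 1) * (real K + 2) * (real K + 3)"
    "expectation (\<lambda>x. X x ^ 4) = (real K + 1) * (real K + 2) * (real K + 3) * (real K + 4)"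
    using erlang_ith_moment[OF _ D, of 1] erlang_ith_moment[OF _ D, of 2]
      erlang_ith_moment[OF _ D, of 3] erlang_ith_moment[OF _ D, of 4] \<open>F \<noteq> 0\<close>
    by (simp_all flip: F_def)
qed

text \<open>The quartic and cubic terms in the mean cancel. What remains is quadratic in
  \<open>K + 1\<close>, and this is what makes the later union bound over all block ends
  summable.\<close>

lemma (in prob_space) erlang_fourth_central_moment:
  assumes D: "distributed M lborel X (erlang_density K 1)"
  shows "integrable M (\<lambda>x. (X x - (real K + 1)) ^ 4)"
    "expectation (\<lambda>x. (X x - (real K + 1)) ^ 4) = 3 * (real K + 1)\<^sup>2 + 6 * (real K + 1)"
proof -
  define c where "c = real K + 1"
  have eq: "(x - c) ^ 4 = x ^ 4 - 4 * c * x ^ 3 + 6 * c\<^sup>2 * x\<^sup>2 - 4 * c ^ 3 * x + c ^ 4" for x :: real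
    by algebra
  have int: "integrable M (\<lambda>x. X x ^ i)" for i
    by (rule erlang_ith_moment_integrable[OF _ D]) simp
  note ints = int[of 4] int[of 3] int[of 2] int[of 1, simplified]
  show "integrable M (\<lambda>x. (X x - (real K + 1)) ^ 4)"
    unfolding c_def[symmetric] eq using ints by simp
  have "expectation (\<lambda>x. (X x - c) ^ 4) = expectation (\<lambda>x. X x ^ 4) - 4 * c * expectation (\<lambda>x. X x ^ 3)
      + 6 * c\<^sup>2 * expectation (\<lambda>x. (X x)\<^sup>2) - 4 * c ^ 3 * expectation X + c ^ 4"
    unfolding eq using ints by (simp add: prob_space)
  also have "\<dots> = 3 * c\<^sup>2 + 6 * c"
    unfolding erlang_moments[OF D] c_def by algebra
  finally show "expectation (\<lambda>x. (X x - (real K + 1)) ^ 4) = 3 * (real K + 1)\<^sup>2 + 6 * (real K + 1)"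
    by (simp add: c_def)
qed

text \<open>A fourth moment bound, obtained by applying the second moment method to the squared
  deviation.\<close>

lemma (in prob_space) erlang_deviation:
  assumes D: "distributed M lborel X (erlang_density K 1)" and a: "0 < a"
  shows "prob {x\<in>space M. \<bar>X x - (real K + 1)\<bar> \<ge> a} \<le> 9 * (real K + 1)\<^sup>2 / a ^ 4"
proof -
  have [measurable]: "random_variable borel X" using distributed_measurable[OF D] by simp
  have "a \<le> \<bar>y\<bar> \<longleftrightarrow> a\<^sup>2 \<le> \<bar>y\<^sup>2\<bar>" for y
    using abs_le_square_iff[of a y] a by simp
  then have "{x\<in>space M. \<bar>X x - (real K + 1)\<bar> \<ge> a} = {x\<in>space M. \<bar>(X x - (real K + 1))\<^sup>2\<bar> \<ge> a\<^sup>2}"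
    by simp
  also have "prob \<dots> \<le> expectation (\<lambda>x. ((X x - (real K + 1))\<^sup>2)\<^sup>2) / (a\<^sup>2)\<^sup>2"
    using erlang_fourth_central_moment(1)[OF D] a by (intro second_moment_method) (auto simp flip: power_mult)
  also have "\<dots> = (3 * (real K + 1)\<^sup>2 + 6 * (real K + 1)) / a ^ 4"
    using erlang_fourth_central_moment(2)[OF D] by (simp flip: power_mult)
  \<comment> \<open>Since \<open>real K + 1\<close> is at least 1, the linear term is at most 6
    times the square, and \<open>3 + 6 = 9\<close>.\<close>
  also have "\<dots> \<le> 9 * (real K + 1)\<^sup>2 / a ^ 4"
    using a by (intro divide_right_mono) (auto simp: power2_eq_square algebra_simps)
  finally show ?thesis .
qed

section \<open>Regularity of the partial sums and of the weighted sum\<close>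

context bollobas_riordan
begin

lemma partial_W_erlang:
  assumes "k \<in> {1..N + 1}"
  shows "distributed M lborel (partial_W w k) (erlang_density (k - 1) 1)"
proof -
  have "distributed M lborel (\<lambda>\<omega>. \<Sum>i\<in>{1..k}. w i \<omega>) (erlang_density (card {1..k} - 1) 1)"
    using assms by (intro exponential_distributed_sum w_exponential indep_vars_subset[OF w_indep]) auto
  then show ?thesis by (simp add: partial_W_def[abs_def])
qed

text \<open>Controlling block ends suffices because the partial sums are monotone. The tolerance is
  halved so that the other half of \<epsilon> can absorb the shift from \<open>i\<close> to
  \<open>i + 1\<close> in the lower estimate.\<close>

definition good :: "real \<Rightarrow> nat \<Rightarrow> 'a \<Rightarrow> bool" where
  "good \<epsilon> i0 \<omega> \<longleftrightarrow> (\<forall>i\<in>{i0..n}. \<bar>partial_W w (m * i) \<omega> - real (m * i)\<bar> < \<epsilon> / 2 * real (m * i))"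

lemma block_end_le: "i \<le> n \<Longrightarrow> m * i \<le> N + 1"
  using mult_le_mono2[of i n m] by linarith

lemma good_measurable [measurable]: "{\<omega>\<in>space M. good \<epsilon> i0 \<omega>} \<in> events"
  unfolding good_def
proof (intro sets.sets_Collect_finite_All)
  fix i assume "i \<in> {i0..n}"
  then have [measurable]: "random_variable borel (partial_W w (m * i))"
    by (intro partial_W_measurable block_end_le) auto
  show "{\<omega>\<in>space M. \<bar>partial_W w (m * i) \<omega> - real (m * i)\<bar> < \<epsilon> / 2 * real (m * i)} \<in> events"
    by measurable
qed simp

text \<open>Union bound over the block ends: the fourth moment bound at relative error
  \<open>\<epsilon> / 2\<close> contributes \<open>9 * 2^4 = 144\<close>, using
  \<open>m * i >= i\<close>, and the tail of the inverse squares contributes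
  \<open>2 / i0\<close>.\<close>

lemma prob_not_good:
  assumes m: "m \<ge> 1" and \<epsilon>: "\<epsilon> > 0" and i0: "i0 \<ge> 1"
  shows "prob {\<omega>\<in>space M. \<not> good \<epsilon> i0 \<omega>} \<le> 288 / (\<epsilon> ^ 4 * real i0)"
proof -
  define A where "A i = {\<omega>\<in>space M. \<bar>partial_W w (m * i) \<omega> - real (m * i)\<bar> \<ge> \<epsilon> / 2 * real (m * i)}" for i
  have A [measurable]: "A i \<in> events" if "i \<in> {i0..n}" for i
  proof -
    have [measurable]: "random_variable borel (partial_W w (m * i))"
      using that by (intro partial_W_measurable block_end_le) auto
    show ?thesis unfolding A_def by measurable
  qed
  have "{\<omega>\<in>space M. \<not> good \<epsilon> i0 \<omega>} = (\<Union>i\<in>{i0..n}. A i)"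
    by (auto simp: good_def A_def not_less)
  then have "prob {\<omega>\<in>space M. \<not> good \<epsilon> i0 \<omega>} \<le> (\<Sum>i\<in>{i0..n}. prob (A i))"
    using A by (auto intro!: finite_measure_subadditive_finite)
  also have "\<dots> \<le> (\<Sum>i\<in>{i0..n}. 144 / \<epsilon> ^ 4 * (1 / (real i)\<^sup>2))"
  proof (rule sum_mono)
    fix i assume i: "i \<in> {i0..n}"
    define k where "k = real (m * i)"
    have mi: "m * i \<in> {1..N + 1}" using i i0 m block_end_le[of i] by (auto simp: One_nat_def Suc_le_eq)
    have "0 < m" "0 < i" using m i i0 by (auto simp: One_nat_def Suc_le_eq)
    then have k: "0 < k" "real i \<le> k" "real (m * i - 1) + 1 = k"
      using m mi unfolding k_def by (auto simp: of_nat_diff)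
    have "prob (A i) \<le> 9 * k\<^sup>2 / (\<epsilon> / 2 * k) ^ 4"
      using erlang_deviation[OF partial_W_erlang[OF mi], of "\<epsilon> / 2 * k"] \<epsilon> k by (simp add: A_def k_def)
    also have "\<dots> = 144 / \<epsilon> ^ 4 * (1 / k\<^sup>2)"
    proof -
      have "k ^ 4 = k\<^sup>2 * k\<^sup>2" by (simp flip: power_add)
      then show ?thesis
        unfolding power_mult_distrib power_divide using \<open>0 < k\<close> \<epsilon> by (simp add: field_simps)
    qed
    also have "\<dots> \<le> 144 / \<epsilon> ^ 4 * (1 / (real i)\<^sup>2)"
      using k \<epsilon> i i0 by (intro mult_left_mono divide_left_mono power_mono) auto
    finally show "prob (A i) \<le> 144 / \<epsilon> ^ 4 * (1 / (real i)\<^sup>2)" .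
  qed
  also have "\<dots> = 144 / \<epsilon> ^ 4 * (\<Sum>i=i0..n. 1 / (real i)\<^sup>2)"
    by (simp add: sum_distrib_left)
  also have "\<dots> \<le> 144 / \<epsilon> ^ 4 * (2 / real i0)"
    using \<epsilon> i0 by (intro mult_left_mono sum_inverse_squares_le) auto
  finally show ?thesis by simp
qed

text \<open>Exchanging the sums writes the weighted sum as a sum of independent terms
  \<open>c j * (D j)^2\<close> with \<open>c j <= harm n / j\<close>. Hence the squares of the
  \<open>c j\<close> sum to at most \<open>2 * (harm n)^2\<close>; the remaining factor is the
  fourth moment of a sum of \<open>m\<close> unit exponentials. For \<open>a\<close> of order
  \<open>(harm n)^2\<close> the bound tends to 0.\<close>

lemma weighted_sum_deviation:
  assumes m: "m \<ge> 1" and a: "a > 0"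
  shows "prob {\<omega>\<in>space M. \<bar>weighted_sum m n (\<lambda>k. partial_W w k \<omega>) - real m * (real m + 1) * harm2 n\<bar> \<ge> a}
    \<le> 2 * (real m * (real m + 1) * (real m + 2) * (real m + 3)) * (harm n)\<^sup>2 / a\<^sup>2"
proof -
  define c where "c j = (\<Sum>i\<in>{j<..n}. 1 / real i) / real j" for j
  define K where "K j = {m * (j - 1)<..m * j}" for j
  define D where "D j \<omega> = (\<Sum>k\<in>K j. w k \<omega>)" for j \<omega>
  define X where "X j \<omega> = c j * (D j \<omega>)\<^sup>2" for j \<omega>
  have swap: "(\<Sum>i=1..n. (\<Sum>j\<in>{1..<i}. f j / real j) / real i) = (\<Sum>j=1..n. c j * f j)" for f :: "nat \<Rightarrow> real"
  proof -
    have "(\<Sum>i=1..n. (\<Sum>j\<in>{1..<i}. f j / real j) / real i)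
        = (\<Sum>i\<in>{1..n}. \<Sum>j\<in>{j\<in>{1..n}. j < i}. f j / real j / real i)"
      unfolding sum_divide_distrib by (intro sum.cong refl) auto
    also have "\<dots> = (\<Sum>j\<in>{1..n}. \<Sum>i\<in>{i\<in>{1..n}. j < i}. f j / real j / real i)"
      by (rule sum.swap_restrict) auto
    also have "\<dots> = (\<Sum>j=1..n. c j * f j)"
    proof (intro sum.cong refl)
      fix j assume "j \<in> {1..n}"
      then have "{i\<in>{1..n}. j < i} = {j<..n}" by auto
      then show "(\<Sum>i\<in>{i\<in>{1..n}. j < i}. f j / real j / real i) = c j * f j"
        by (simp add: c_def sum_distrib_left sum_distrib_right sum_divide_distrib mult.commute)
    qed
    finally show ?thesis .
  qed
  have D: "partial_W w (m * j) \<omega> - partial_W w (m * (j - 1)) \<omega> = D j \<omega>" if "j \<ge> 1" for j \<omega>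
  proof -
    have "{1..b} = {1..a} \<union> {a<..b}" if "a \<le> b" for a b :: nat using that by auto
    then have "{1..m * j} = {1..m * (j - 1)} \<union> K j" unfolding K_def by simp
    moreover have "{1..m * (j - 1)} \<inter> K j = {}" "finite (K j)" by (auto simp: K_def)
    ultimately show ?thesis
      unfolding partial_W_def D_def by (simp add: sum.union_disjoint)
  qed
  have T: "weighted_sum m n (\<lambda>k. partial_W w k \<omega>) = (\<Sum>j\<in>{1..n}. X j \<omega>)" for \<omega>
    unfolding weighted_sum_def X_def swap using D by (intro sum.cong refl) auto
  have harm2: "harm2 n = (\<Sum>j=1..n. c j)"
    using swap[of "\<lambda>_. 1"] by (simp add: harm2_def)
  have K: "K j \<subseteq> {1..N + 1}" "card (K j) = m" "K j \<noteq> {}" if "j \<in> {1..n}" for j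
  proof -
    show "K j \<subseteq> {1..N + 1}" using that block_end_le[of j] by (auto simp: K_def)
    show card: "card (K j) = m" using that by (simp add: K_def diff_mult_distrib2[symmetric])
    then show "K j \<noteq> {}" using m by auto
  qed
  have disj: "disjoint_family_on K {1..n}"
    unfolding disjoint_family_on_def
  proof (intro ballI impI)
    fix i j assume "i \<in> {1..n}" "j \<in> {1..n}" "i \<noteq> j"
    then show "K i \<inter> K j = {}" using block_index_unique[of m i _ j] by (auto simp: K_def)
  qed
  have "indep_vars (\<lambda>_. borel) (\<lambda>j \<omega>. c j * (\<Sum>k\<in>K j. (restrict (\<lambda>k. w k \<omega>) (K j)) k)\<^sup>2) {1..n}"
  proof (rule indep_vars_compose2[OF indep_vars_restrict[OF w_indep K(1) disj]])
    fix j
    show "(\<lambda>v. c j * (\<Sum>k\<in>K j. v k)\<^sup>2) \<in> borel_measurable (Pi\<^sub>M (K j) (\<lambda>_. borel))"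
      by measurable
  qed
  then have ind: "indep_vars (\<lambda>_. borel) X {1..n}"
    by (simp add: X_def[abs_def] D_def)
  have erl: "distributed M lborel (D j) (erlang_density (m - 1) 1)" if "j \<in> {1..n}" for j
  proof -
    have "distributed M lborel (\<lambda>\<omega>. \<Sum>k\<in>K j. w k \<omega>) (erlang_density (card (K j) - 1) 1)"
      using K[OF that]
      by (intro exponential_distributed_sum w_exponential indep_vars_subset[OF w_indep])
         (auto simp: K_def)
    then show ?thesis using K(2)[OF that] by (simp add: D_def[abs_def])
  qed
  have m1: "real (m - 1) + 1 = real m" "real (m - 1) + 2 = real m + 1" "real (m - 1) + 3 = real m + 2"
    "real (m - 1) + 4 = real m + 3"
    using m by auto
  have EX: "expectation (X j) = c j * (real m * (real m + 1))" if "j \<in> {1..n}" for j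
    using erlang_moments(2)[OF erl[OF that]] by (simp add: X_def[abs_def] m1)
  have X2: "(X j \<omega>)\<^sup>2 = (c j)\<^sup>2 * D j \<omega> ^ 4" for j \<omega>
    by (simp add: X_def power_mult_distrib flip: power_mult)
  have EX2: "expectation (\<lambda>\<omega>. (X j \<omega>)\<^sup>2) = (c j)\<^sup>2 * (real m * (real m + 1) * (real m + 2) * (real m + 3))"
    if "j \<in> {1..n}" for j
    unfolding X2 using erlang_moments(4)[OF erl[OF that]] by (simp add: m1)
  have int: "integrable M (\<lambda>\<omega>. (X j \<omega>)\<^sup>2)" if "j \<in> {1..n}" for j
    unfolding X2 using erlang_ith_moment_integrable[OF _ erl[OF that], of 4] by simp
  have c2: "(\<Sum>j\<in>{1..n}. (c j)\<^sup>2) \<le> 2 * (harm n)\<^sup>2"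
  proof -
    have "(\<Sum>j\<in>{1..n}. (c j)\<^sup>2) \<le> (\<Sum>j\<in>{1..n}. (harm n)\<^sup>2 * (1 / (real j)\<^sup>2))"
    proof (rule sum_mono)
      fix j assume "j \<in> {1..n}"
      have "(\<Sum>i\<in>{j<..n}. 1 / real i) \<le> harm n"
        unfolding harm_def inverse_eq_divide by (intro sum_mono2) auto
      then have "(\<Sum>i\<in>{j<..n}. 1 / real i)\<^sup>2 \<le> (harm n)\<^sup>2"
        by (intro power_mono sum_nonneg) auto
      then show "(c j)\<^sup>2 \<le> (harm n)\<^sup>2 * (1 / (real j)\<^sup>2)"
        unfolding c_def power_divide by (simp add: divide_right_mono)
    qed
    also have "\<dots> = (harm n)\<^sup>2 * (\<Sum>j=1..n. 1 / (real j)\<^sup>2)" by (simp add: sum_distrib_left)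
    also have "\<dots> \<le> (harm n)\<^sup>2 * 2"
      using sum_inverse_squares_le[of 1 n] by (intro mult_left_mono) auto
    finally show ?thesis by simp
  qed
  have "prob {\<omega>\<in>space M. \<bar>(\<Sum>j\<in>{1..n}. X j \<omega>) - (\<Sum>j\<in>{1..n}. expectation (X j))\<bar> \<ge> a}
      \<le> (\<Sum>j\<in>{1..n}. expectation (\<lambda>\<omega>. (X j \<omega>)\<^sup>2)) / a\<^sup>2"
    by (rule prob_sum_deviation_le[OF _ ind int a]) auto
  also have "(\<Sum>j\<in>{1..n}. expectation (X j)) = (\<Sum>j\<in>{1..n}. c j * (real m * (real m + 1)))"
    by (intro sum.cong refl EX)
  also have "\<dots> = real m * (real m + 1) * harm2 n"
    unfolding harm2 sum_distrib_right[symmetric] by (rule mult.commute)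
  also have "(\<Sum>j\<in>{1..n}. expectation (\<lambda>\<omega>. (X j \<omega>)\<^sup>2))
      = (\<Sum>j\<in>{1..n}. (c j)\<^sup>2 * (real m * (real m + 1) * (real m + 2) * (real m + 3)))"
    by (intro sum.cong refl EX2)
  also have "\<dots> / a\<^sup>2 \<le> (2 * (harm n)\<^sup>2) * (real m * (real m + 1) * (real m + 2) * (real m + 3)) / a\<^sup>2"
    unfolding sum_distrib_right[symmetric] using c2 by (intro divide_right_mono mult_right_mono) auto
  also have "\<dots> = 2 * (real m * (real m + 1) * (real m + 2) * (real m + 3)) * (harm n)\<^sup>2 / a\<^sup>2"
    by simp
  finally show ?thesis by (simp only: T)
qed

end

section \<open>Concentration of the number of parallel pairs\<close>

context bollobas_riordan
begin

lemma partial_W_model: "partial_W w_model k z = partial_W w k (fst z)"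
  by (simp add: partial_W_def w_model_def)

lemma l_model_eq: "l_model k z = ratio_R N w_model k z * (snd z k)\<^sup>2"
  by (simp add: l_model_def ratio_R_def partial_W_model)

lemma AE_U: "AE u in U. \<forall>k\<in>{1..N}. u k \<in> {0<..1}"
  by (intro AE_finite_allI AE_PiM_component prob_space_unit_uniform AE_unit_uniform) auto

lemma w_pos_measurable [measurable]: "{\<omega>\<in>space M. \<forall>i\<in>{1..N + 1}. 0 < w i \<omega>} \<in> events"
  by (intro sets.sets_Collect_finite_All) (auto intro!: borel_measurable_less[of "\<lambda>_. 0", simplified])

lemma weighted_sum_measurable [measurable]:
  "(\<lambda>\<omega>. weighted_sum m n (\<lambda>k. partial_W w k \<omega>)) \<in> borel_measurable M"
  unfolding weighted_sum_def
proof (intro borel_measurable_sum borel_measurable_divide borel_measurable_power borel_measurable_diff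
    borel_measurable_const partial_W_measurable block_end_le)
qed auto

text \<open>The three summands account for irregular block ends, an atypical weighted sum, and the
  fluctuation of the block counts for fixed regular weights. The tolerance \<open>3 * \<eta>\<close>
  is spent equally: at most \<open>\<eta> * L\<close> pairs in the first \<open>i0\<close> blocks, a
  conditional mean within \<open>\<eta> * L\<close> of \<open>c * L\<close>, and a fluctuation below
  \<open>\<eta> * L\<close>.\<close>

lemma br_parallel_pairs_deviation:
  fixes \<epsilon> \<zeta> \<eta> L c :: real and i0 :: nat
  assumes m: "m \<ge> 1" and \<epsilon>: "0 < \<epsilon>" "\<epsilon> < 1" and i0: "2 / \<epsilon> \<le> real i0" "i0 \<le> n"
    and \<eta>: "0 < \<eta>" and \<zeta>: "0 < \<zeta>" and L: "0 < L" and c: "0 \<le> c"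
    and few: "real m * (real m - 1) / 2 * real i0 \<le> \<eta> * L"
    and hi: "real m * (real m - 1) / 2 * ((1 + \<epsilon>) / (1 - \<epsilon>) * real i0) * harm n
      + (real m - 1) / (8 * real m * (1 - \<epsilon>)\<^sup>2) * (real m * (real m + 1) * harm2 n + \<zeta> * L) \<le> (c + \<eta>) * L"
    and lo: "(c - \<eta>) * L \<le> (real m - 1) / (8 * real m * (1 + \<epsilon>)\<^sup>2) *
      (real m * (real m + 1) * harm2 n - \<zeta> * L - ((1 + \<epsilon>) * real m * real i0)\<^sup>2 * harm n)"
  shows "prob {\<omega>\<in>space M. \<bar>real (br_parallel_pairs m n w l \<omega>) / L - c\<bar> > 3 * \<eta>}
    \<le> 288 / (\<epsilon> ^ 4 * real i0)
      + 2 * (real m * (real m + 1) * (real m + 2) * (real m + 3)) * (harm n)\<^sup>2 / (\<zeta> * L)\<^sup>2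
      + real m * (real m - 1) / 2 * (c + \<eta>) / (\<eta>\<^sup>2 * L)"
proof -
  define q where "q = real m * (real m - 1) / 2"
  have q: "0 \<le> q" using m by (simp add: q_def)
  have "0 < 2 / \<epsilon>" using \<epsilon> by simp
  then have "0 < real i0" using i0(1) by linarith
  then have i0_pos: "1 \<le> i0" by (simp add: One_nat_def Suc_le_eq)
  then have n: "1 \<le> n" using i0 by simp
  define T where "T \<omega> = weighted_sum m n (\<lambda>k. partial_W w k \<omega>)" for \<omega>
  define Y where "Y \<omega> = (\<Sum>i\<in>{i0<..n}. mean_count m (\<lambda>k. partial_W w k \<omega>) i)" for \<omega>
  define A1 where "A1 = {\<omega>\<in>space M. \<not> good \<epsilon> i0 \<omega>}"
  define A2 where "A2 = {\<omega>\<in>space M. \<bar>T \<omega> - real m * (real m + 1) * harm2 n\<bar> \<ge> \<zeta> * L}"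
  define A3 where "A3 = {\<omega>\<in>space M. \<not> (\<forall>i\<in>{1..N + 1}. 0 < w i \<omega>)}"
  have [measurable]: "A1 \<in> events"
    unfolding A1_def by (rule sets.sets_Collect_neg[OF good_measurable])
  have [measurable]: "A3 \<in> events"
    unfolding A3_def by (rule sets.sets_Collect_neg[OF w_pos_measurable])
  have [measurable]: "A2 \<in> events"
    unfolding A2_def T_def by measurable
  define Q where "Q f \<longleftrightarrow> \<bar>real (num_parallel_pairs {1..N} f) / L - c\<bar> > 3 * \<eta>" for f :: "nat \<Rightarrow> nat set"
  have Qcong: "Q f = Q g" if "\<And>k. k \<in> {1..N} \<Longrightarrow> f k = g k" for f g
    using num_parallel_pairs_cong[of "{1..N}" f g, OF that] by (simp add: Q_def)
  define B where "B = {z\<in>space (M \<Otimes>\<^sub>M U). Q (br_ends m n w_model l_model z)}"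
  have B [measurable]: "B \<in> sets (M \<Otimes>\<^sub>M U)"
    unfolding B_def by (rule sets_Collect_ends_model) (rule Qcong)
  define b where "b = q * (c + \<eta>) / (\<eta>\<^sup>2 * L)"
  have cond: "measure U (Pair \<omega> -` B) \<le> b" if \<omega>: "\<omega> \<in> space M" "\<omega> \<notin> A1 \<union> A2 \<union> A3" for \<omega>
  proof -
    define W where "W k = partial_W w k \<omega>" for k
    have wpos: "\<forall>i\<in>{1..N + 1}. 0 < w i \<omega>" and good: "good \<epsilon> i0 \<omega>"
      and T: "\<bar>T \<omega> - real m * (real m + 1) * harm2 n\<bar> < \<zeta> * L"
      using \<omega> by (auto simp: A1_def A2_def A3_def not_le)
    have W: "W j < W k" if "j < k" "k \<le> N" for j k
      unfolding W_def using that by (intro partial_W_strict_mono[where w=w and \<omega>=\<omega>, OF wpos]) auto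
    have W0: "W 0 = 0" by (simp add: W_def)
    have upper: "W (m * i) \<le> (1 + \<epsilon>) * real m * real i"
      and lower: "(1 - \<epsilon>) * real m * real (i + 1) \<le> W (m * i)" if i: "i \<in> {i0..n}" for i
    proof -
      have "\<bar>W (m * i) - real m * real i\<bar> < \<epsilon> / 2 * (real m * real i)"
        using good i by (auto simp: good_def W_def)
      then have *: "W (m * i) \<le> real m * real i + \<epsilon> / 2 * (real m * real i)"
        "real m * real i - \<epsilon> / 2 * (real m * real i) \<le> W (m * i)" by linarith+
      have "0 \<le> \<epsilon> / 2 * (real m * real i)" using \<epsilon> by simp
      with *(1) show "W (m * i) \<le> (1 + \<epsilon>) * real m * real i"
        by (simp add: algebra_simps)
      \<comment> \<open>The choice of \<open>i0\<close> enters here: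
        \<open>\<epsilon> / 2 * i\<close> is at least 1 and pays for replacing \<open>i\<close> by
        \<open>i + 1\<close>.\<close>
      have "2 / \<epsilon> \<le> real i" using i i0 by auto
      then have "1 \<le> \<epsilon> / 2 * real i" using \<epsilon> by (simp add: field_simps)
      then have "(1 - \<epsilon>) * real (i + 1) \<le> real i - \<epsilon> / 2 * real i"
        using \<epsilon> by (simp add: algebra_simps)
      then have "real m * ((1 - \<epsilon>) * real (i + 1)) \<le> real m * (real i - \<epsilon> / 2 * real i)"
        by (intro mult_left_mono) auto
      with *(2) show "(1 - \<epsilon>) * real m * real (i + 1) \<le> W (m * i)"
        by (simp add: algebra_simps)
    qed
    have TW: "T \<omega> = weighted_sum m n W" and YW: "Y \<omega> = (\<Sum>i\<in>{i0<..n}. mean_count m W i)"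
      by (simp_all add: T_def Y_def W_def[abs_def])
    have Y_hi: "Y \<omega> \<le> (c + \<eta>) * L"
    proof -
      have "Y \<omega> \<le> q * ((1 + \<epsilon>) / (1 - \<epsilon>) * real i0) * harm n + (real m - 1) / (8 * real m * (1 - \<epsilon>)\<^sup>2) * T \<omega>"
        unfolding YW TW q_def by (rule sum_mean_count_le[OF m W W0 \<epsilon> i0(2) lower upper])
      also have "(real m - 1) / (8 * real m * (1 - \<epsilon>)\<^sup>2) * T \<omega>
          \<le> (real m - 1) / (8 * real m * (1 - \<epsilon>)\<^sup>2) * (real m * (real m + 1) * harm2 n + \<zeta> * L)"
        using T m by (intro mult_left_mono) auto
      finally show ?thesis using hi by (simp add: q_def)
    qed
    have Y_lo: "(c - \<eta>) * L \<le> Y \<omega>"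
    proof -
      note lo
      also have "(real m - 1) / (8 * real m * (1 + \<epsilon>)\<^sup>2) *
          (real m * (real m + 1) * harm2 n - \<zeta> * L - ((1 + \<epsilon>) * real m * real i0)\<^sup>2 * harm n)
        \<le> (real m - 1) / (8 * real m * (1 + \<epsilon>)\<^sup>2) * (T \<omega> - ((1 + \<epsilon>) * real m * real i0)\<^sup>2 * harm n)"
        using T m by (intro mult_left_mono) auto
      also have "\<dots> \<le> Y \<omega>"
        unfolding YW TW by (rule sum_mean_count_ge[OF m W W0 \<epsilon> i0(2) lower upper])
      finally show ?thesis .
    qed
    define S where "S = {u\<in>space U. \<bar>(\<Sum>i\<in>{i0<..n}. block_count m W i u) - (\<Sum>i\<in>{i0<..n}. mean_count m W i)\<bar> \<ge> \<eta> * L}"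
    have S: "S \<in> sets U"
    proof -
      have [measurable]: "block_count m W i \<in> borel_measurable U" if "i \<in> {i0<..n}" for i
        using that i0_pos by (intro block_count_measurable[where m=m and n=n and W=W, OF m W W0]) auto
      show ?thesis unfolding S_def by measurable
    qed
    have "measure U (Pair \<omega> -` B) \<le> measure U S"
    \<comment> \<open>The inclusion is only almost sure: the description of the graph by slots
      requires all coordinates of \<open>u\<close> to lie in the half-open unit interval.\<close>
    proof (rule MU.M2.finite_measure_mono_AE[OF _ S])
      show "AE u in U. u \<in> Pair \<omega> -` B \<longrightarrow> u \<in> S"
        using AE_U AE_space
      proof eventually_elim
        case (elim u)
        show ?case
        proof
          assume "u \<in> Pair \<omega> -` B"
          then have dev: "\<bar>real (br_parallel_pairs m n w_model l_model (\<omega>, u)) / L - c\<bar> > 3 * \<eta>"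
            by (simp add: B_def Q_def br_parallel_pairs_def)
          have "real (br_parallel_pairs m n w_model l_model (\<omega>, u))
              = (\<Sum>i=1..n. block_count m (\<lambda>k. partial_W w_model k (\<omega>, u)) i u)"
            using wpos elim l_model_eq[of _ "(\<omega>, u)"]
            by (intro br_parallel_pairs_eq_sum m) (auto simp: w_model_def)
          also have "\<dots> = (\<Sum>i\<in>{1..i0} \<union> {i0<..n}. block_count m W i u)"
            unfolding partial_W_model W_def[abs_def] using i0 i0_pos by (intro sum.cong) auto
          also have "\<dots> = (\<Sum>i\<in>{1..i0}. block_count m W i u) + (\<Sum>i\<in>{i0<..n}. block_count m W i u)"
            by (intro sum.union_disjoint) auto
          finally have P: "real (br_parallel_pairs m n w_model l_model (\<omega>, u))
            = (\<Sum>i\<in>{1..i0}. block_count m W i u) + (\<Sum>i\<in>{i0<..n}. block_count m W i u)" .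
          have bounds: "0 \<le> block_count m W i u \<and> block_count m W i u \<le> q" if i: "i \<in> {1..i0}" for i
          proof -
            have "m * i \<le> N" using i i0 by auto
            then have "W j < W k" if "j < k" "k \<le> m * i" for j k
              using that by (intro W) linarith+
            from block_count_bounds[where m=m and i=i and W=W, OF this] i W0 show ?thesis by (auto simp: q_def)
          qed
          have "0 \<le> (\<Sum>i\<in>{1..i0}. block_count m W i u)"
            using bounds by (intro sum_nonneg) auto
          moreover have "(\<Sum>i\<in>{1..i0}. block_count m W i u) \<le> \<eta> * L"
          proof -
            have "(\<Sum>i\<in>{1..i0}. block_count m W i u) \<le> (\<Sum>i\<in>{1..i0}. q)"
              using bounds by (intro sum_mono) auto
            then show ?thesis using few by (simp add: q_def mult.commute)
          qed
          moreover have "\<bar>real (br_parallel_pairs m n w_model l_model (\<omega>, u)) - c * L\<bar> > 3 * \<eta> * L"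
          proof -
            have "real (br_parallel_pairs m n w_model l_model (\<omega>, u)) - c * L
              = (real (br_parallel_pairs m n w_model l_model (\<omega>, u)) / L - c) * L"
              using L by (simp add: left_diff_distrib)
            then have "\<bar>real (br_parallel_pairs m n w_model l_model (\<omega>, u)) - c * L\<bar>
              = \<bar>real (br_parallel_pairs m n w_model l_model (\<omega>, u)) / L - c\<bar> * L"
              using L by (simp only: abs_mult abs_of_pos)
            then show ?thesis using mult_strict_right_mono[OF dev L] by (simp only:)
          qed
          ultimately have "\<bar>(\<Sum>i\<in>{i0<..n}. block_count m W i u) - Y \<omega>\<bar> \<ge> \<eta> * L"
            using Y_lo Y_hi unfolding P left_diff_distrib distrib_right by linarith
          then show "u \<in> S" using elim by (simp add: S_def YW)
        qed
      qed
    qed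
    also have "\<dots> \<le> q * (\<Sum>i\<in>{i0<..n}. mean_count m W i) / (\<eta> * L)\<^sup>2"
      unfolding S_def q_def using \<eta> L by (intro block_count_deviation[where m=m and n=n and W=W, OF m W W0 n]) auto
    also have "\<dots> \<le> q * ((c + \<eta>) * L) / (\<eta> * L)\<^sup>2"
      using Y_hi q by (intro divide_right_mono mult_left_mono) (auto simp: YW)
    also have "\<dots> = b" using L \<eta> by (simp add: b_def power2_eq_square field_simps)
    finally show ?thesis .
  qed
  have "0 \<le> b" using q c \<eta> L by (simp add: b_def)
  \<comment> \<open>By Fubini's theorem the sections of the bad event are integrated over the
    weights: they are bounded by 1 on the exceptional weights and by \<open>b\<close>
    elsewhere.\<close>
  have "emeasure (M \<Otimes>\<^sub>M U) B = (\<integral>\<^sup>+\<omega>. emeasure U (Pair \<omega> -` B) \<partial>M)"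
    by (rule MU.M2.emeasure_pair_measure_alt) (rule B)
  also have "\<dots> \<le> (\<integral>\<^sup>+\<omega>. indicator (A1 \<union> A2 \<union> A3) \<omega> + ennreal b \<partial>M)"
  proof (rule nn_integral_mono)
    fix \<omega> assume \<omega>: "\<omega> \<in> space M"
    show "emeasure U (Pair \<omega> -` B) \<le> indicator (A1 \<union> A2 \<union> A3) \<omega> + ennreal b"
    proof (cases "\<omega> \<in> A1 \<union> A2 \<union> A3")
      case True
      have "emeasure U (Pair \<omega> -` B) \<le> 1" by (rule MU.M2.measure_le_1)
      also have "\<dots> \<le> indicator (A1 \<union> A2 \<union> A3) \<omega> + ennreal b" using True by simp
      finally show ?thesis .
    next
      case False
      then show ?thesis using cond[OF \<omega> False] by (simp add: MU.M2.emeasure_eq_measure ennreal_leI)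
    qed
  qed
  also have "\<dots> = emeasure M (A1 \<union> A2 \<union> A3) + ennreal b"
    by (subst nn_integral_add) (auto simp: emeasure_space_1)
  also have "\<dots> = ennreal (prob (A1 \<union> A2 \<union> A3) + b)"
    using \<open>0 \<le> b\<close> by (simp add: emeasure_eq_measure)
  finally have "measure (M \<Otimes>\<^sub>M U) B \<le> prob (A1 \<union> A2 \<union> A3) + b"
    using \<open>0 \<le> b\<close> by (simp add: MU.P.emeasure_eq_measure del: ennreal_plus)
  moreover have "prob {\<omega>\<in>space M. Q (br_ends m n w l \<omega>)} = measure (M \<Otimes>\<^sub>M U) B"
    unfolding B_def by (rule prob_ends_eq_model) (rule Qcong)
  moreover have "prob (A1 \<union> A2 \<union> A3) \<le> prob A1 + prob A2 + prob A3"
    using measure_Un_le[of "A1 \<union> A2" M A3] measure_Un_le[of A1 M A2] by simp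
  moreover have "prob A3 = 0"
    unfolding A3_def using AE_w_pos by (intro prob_eq_0_AE) auto
  moreover have "prob A1 \<le> 288 / (\<epsilon> ^ 4 * real i0)"
    unfolding A1_def by (rule prob_not_good) fact+
  moreover have "prob A2 \<le> 2 * (real m * (real m + 1) * (real m + 2) * (real m + 3)) * (harm n)\<^sup>2 / (\<zeta> * L)\<^sup>2"
    unfolding A2_def T_def using \<zeta> L by (intro weighted_sum_deviation m) auto
  ultimately show ?thesis by (simp add: b_def q_def Q_def br_parallel_pairs_def)
qed

text \<open>The block structure is available in the product model, for positive weights and
  \<open>u\<close> in the half-open unit cube. The inequality has probability 1 there and is carried
  back as an event of the graph.\<close>

lemma AE_parallel_pairs_le_reduction:
  assumes m: "m \<ge> 1"
  shows "AE \<omega> in M. real (br_parallel_pairs m n w l \<omega>) \<le> real m * br_edge_reduction m n w l \<omega>"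
proof -
  define Q where "Q f \<longleftrightarrow> real (num_parallel_pairs {1..N} f) \<le> real m * edge_reduction {1..N} f"
    for f :: "nat \<Rightarrow> nat set"
  have Qcong: "Q f = Q g" if "\<And>k. k \<in> {1..N} \<Longrightarrow> f k = g k" for f g
    using num_parallel_pairs_cong[of "{1..N}" f g, OF that] edge_reduction_cong[of "{1..N}" f g, OF that]
    by (simp add: Q_def)
  have "AE z in M \<Otimes>\<^sub>M U. Q (br_ends m n w_model l_model z)"
  proof (rule MU.AE_pair_measure)
    show "{z\<in>space (M \<Otimes>\<^sub>M U). Q (br_ends m n w_model l_model z)} \<in> sets (M \<Otimes>\<^sub>M U)"
      by (rule sets_Collect_ends_model) (rule Qcong)
    show "AE \<omega> in M. AE u in U. Q (br_ends m n w_model l_model (\<omega>, u))"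
      using AE_w_pos
    proof eventually_elim
      case (elim \<omega>)
      show ?case using AE_U
      proof eventually_elim
        case (elim u)
        show ?case
          unfolding Q_def
        proof (rule num_parallel_pairs_le_edge_reduction)
          fix k assume "k \<in> {1..N}"
          then show "card {j\<in>{1..N}. j < k \<and> parallel_edges (br_ends m n w_model l_model (\<omega>, u)) j k} \<le> m"
            using \<open>\<forall>i\<in>{1..N + 1}. 0 < w i \<omega>\<close> elim l_model_eq[of _ "(\<omega>, u)"]
            by (intro card_parallel_le[where u=u] m) (auto simp: w_model_def)
        qed simp
      qed
    qed
  qed
  then have "measure (M \<Otimes>\<^sub>M U) {z\<in>space (M \<Otimes>\<^sub>M U). Q (br_ends m n w_model l_model z)} = 1"
    by (intro MU.P.prob_Collect_eq_1[THEN iffD2] sets_Collect_ends_model Qcong)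
  then have "prob {\<omega>\<in>space M. Q (br_ends m n w l \<omega>)} = 1"
    using prob_ends_eq_model[of Q, OF Qcong] by simp
  then have "AE \<omega> in M. Q (br_ends m n w l \<omega>)"
    using prob_Collect_eq_1[OF sets_Collect_ends[of Q, OF Qcong]] by blast
  then show ?thesis unfolding Q_def br_parallel_pairs_def br_edge_reduction_def .
qed

end

section \<open>Passage to the limit\<close>

lemma eventually_sequentially_scaled_le:
  fixes f g :: "nat \<Rightarrow> real"
  assumes "(\<lambda>n. f n / g n) \<longlonglongrightarrow> a" "a < b" "\<forall>\<^sub>F n in sequentially. 0 < g n"
  shows "\<forall>\<^sub>F n in sequentially. f n \<le> b * g n"
  using order_tendstoD(2)[OF assms(1,2)] assms(3)
  by eventually_elim (simp add: pos_divide_less_eq less_imp_le)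

text \<open>The order of choices is decisive: \<epsilon> is chosen so that the limiting upper and
  lower coefficients are within \<eta> of \<open>c\<close>, then \<open>i0\<close> depending on
  \<epsilon> and \<delta>, and only then \<open>n\<close> large. Each of the three failure
  probabilities is kept below \<open>\<delta> / 3\<close>.\<close>

lemma tendsto_in_probability_parallel_pairs:
  fixes m :: nat and M :: "nat \<Rightarrow> 'a measure" and w l :: "nat \<Rightarrow> nat \<Rightarrow> 'a \<Rightarrow> real"
  assumes m: "m \<ge> 1"
    and br: "\<And>n. n \<ge> 1 \<Longrightarrow> bollobas_riordan (M n) m n (w n) (l n)"
  shows "tendsto_in_probability M
           (\<lambda>n \<omega>. real (br_parallel_pairs m n (w n) (l n) \<omega>) / (ln (real n))\<^sup>2)
           (((real m)\<^sup>2 - 1) / 16)"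
  unfolding tendsto_in_probability_def
proof (intro allI impI)
  fix \<eta>' :: real assume "0 < \<eta>'"
  define \<eta> where "\<eta> = \<eta>' / 3"
  have \<eta>: "0 < \<eta>" "\<eta>' = 3 * \<eta>" using \<open>0 < \<eta>'\<close> by (auto simp: \<eta>_def)
  define c where "c = ((real m)\<^sup>2 - 1) / 16"
  define \<kappa> where "\<kappa> = (real m - 1) / (8 * real m)"
  define \<theta> where "\<theta> = real m * (real m + 1)"
  define q where "q = real m * (real m - 1) / 2"
  define L where "L n = (ln (real n))\<^sup>2" for n :: nat
  have c: "0 \<le> c" using m by (simp add: c_def)
  have c_eq: "c = \<kappa> * (\<theta> / 2)"
    using m by (simp add: c_def \<kappa>_def \<theta>_def field_simps power2_eq_square)
  have L_pos: "\<forall>\<^sub>F n in sequentially. 0 < L n"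
    using eventually_gt_at_top[of 1] by eventually_elim (simp add: L_def)
  let ?P = "\<lambda>n. measure (M n) {\<omega>\<in>space (M n). \<bar>real (br_parallel_pairs m n (w n) (l n) \<omega>) / (ln (real n))\<^sup>2 - c\<bar> > \<eta>'}"
  have "?P \<longlonglongrightarrow> 0"
  proof (rule tendstoI)
    fix \<delta> :: real assume "0 < \<delta>"
    \<comment> \<open>As a function of \<open>x = \<epsilon>\<close>, this is the limit of the upper
      bound \<open>hi n / L n\<close> for \<open>n\<close> tending to infinity; at 0 it equals
      \<open>c\<close>.\<close>
    have "((\<lambda>x. \<kappa> / (1 - x)\<^sup>2 * (\<theta> / 2 + x)) \<longlongrightarrow> \<kappa> / (1 - 0)\<^sup>2 * (\<theta> / 2 + 0)) (at_right 0)"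
      by (intro tendsto_intros) auto
    then have up: "\<forall>\<^sub>F x in at_right 0. \<kappa> / (1 - x)\<^sup>2 * (\<theta> / 2 + x) < c + \<eta>"
      using \<eta> by (intro order_tendstoD(2)) (auto simp: c_eq)
    have "((\<lambda>x. \<kappa> / (1 + x)\<^sup>2 * (\<theta> / 2 - x)) \<longlongrightarrow> \<kappa> / (1 + 0)\<^sup>2 * (\<theta> / 2 - 0)) (at_right 0)"
      by (intro tendsto_intros) auto
    then have down: "\<forall>\<^sub>F x in at_right 0. c - \<eta> < \<kappa> / (1 + x)\<^sup>2 * (\<theta> / 2 - x)"
      using \<eta> by (intro order_tendstoD(1)) (auto simp: c_eq)
    have unit: "\<forall>\<^sub>F x in at_right 0. (0::real) < x \<and> x < 1"
      using eventually_at_right_less[of "0::real"] eventually_at_right_field[of "\<lambda>x. x < 1" "0::real"]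
      by (auto intro!: eventually_conj exI[of _ 1])
    have "\<forall>\<^sub>F x in at_right 0. (0 < x \<and> x < 1) \<and> \<kappa> / (1 - x)\<^sup>2 * (\<theta> / 2 + x) < c + \<eta>
      \<and> c - \<eta> < \<kappa> / (1 + x)\<^sup>2 * (\<theta> / 2 - x)"
      using up down unit by eventually_elim auto
    from eventually_happens'[OF _ this] obtain \<epsilon> where \<epsilon>: "0 < \<epsilon>" "\<epsilon> < 1"
      and \<epsilon>_up: "\<kappa> / (1 - \<epsilon>)\<^sup>2 * (\<theta> / 2 + \<epsilon>) < c + \<eta>"
      and \<epsilon>_down: "c - \<eta> < \<kappa> / (1 + \<epsilon>)\<^sup>2 * (\<theta> / 2 - \<epsilon>)"
      by auto
    \<comment> \<open>The first lower bound on \<open>i0\<close> serves the shift from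
      \<open>i\<close> to \<open>i + 1\<close>, the second makes the probability of irregular block
      ends less than \<open>\<delta> / 3\<close>.\<close>
    obtain i0 :: nat where i0: "max (2 / \<epsilon>) (288 / (\<epsilon> ^ 4 * (\<delta> / 3))) < real i0"
      using reals_Archimedean2 by blast
    then have i0_ge: "2 / \<epsilon> \<le> real i0" by simp
    have i0_\<delta>: "288 / (\<epsilon> ^ 4 * real i0) < \<delta> / 3"
    proof -
      have "0 < 2 / \<epsilon>" using \<epsilon> by simp
      then have "0 < real i0" using i0_ge by linarith
      moreover have "288 / (\<epsilon> ^ 4 * (\<delta> / 3)) < real i0" using i0 by simp
      ultimately show ?thesis using \<open>0 < \<delta>\<close> \<epsilon> by (simp add: field_simps)
    qed
    have lim_h: "(\<lambda>n. harm n / L n) \<longlonglongrightarrow> 0" and lim_h2: "(\<lambda>n. harm2 n / L n) \<longlonglongrightarrow> 1 / 2"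
      and lim_c: "(\<lambda>n. a / L n) \<longlonglongrightarrow> 0" for a
      unfolding L_def by (fact harm_div_ln_squared_tendsto harm2_div_ln_squared_tendsto
          const_div_ln_squared_tendsto)+
    define A where "A = q * ((1 + \<epsilon>) / (1 - \<epsilon>) * real i0)"
    define B where "B = ((1 + \<epsilon>) * real m * real i0)\<^sup>2"
    define hi where "hi n = A * harm n + \<kappa> / (1 - \<epsilon>)\<^sup>2 * (\<theta> * harm2 n + \<epsilon> * L n)" for n
    define lo where "lo n = \<kappa> / (1 + \<epsilon>)\<^sup>2 * (\<theta> * harm2 n - \<epsilon> * L n - B * harm n)" for n
    have ev_hi: "\<forall>\<^sub>F n in sequentially. hi n \<le> (c + \<eta>) * L n"
    proof (rule eventually_sequentially_scaled_le[OF _ _ L_pos])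
      have "(\<lambda>n. A * (harm n / L n) + \<kappa> / (1 - \<epsilon>)\<^sup>2 * (\<theta> * (harm2 n / L n) + \<epsilon>))
          \<longlonglongrightarrow> A * 0 + \<kappa> / (1 - \<epsilon>)\<^sup>2 * (\<theta> * (1 / 2) + \<epsilon>)"
        by (intro tendsto_add tendsto_mult tendsto_const lim_h lim_h2)
      moreover have "\<forall>\<^sub>F n in sequentially. A * (harm n / L n) + \<kappa> / (1 - \<epsilon>)\<^sup>2 * (\<theta> * (harm2 n / L n) + \<epsilon>) = hi n / L n"
        using L_pos by eventually_elim (simp add: hi_def add_divide_distrib distrib_left)
      ultimately show "(\<lambda>n. hi n / L n) \<longlonglongrightarrow> \<kappa> / (1 - \<epsilon>)\<^sup>2 * (\<theta> / 2 + \<epsilon>)"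
        by (simp add: filterlim_cong)
    qed (fact \<epsilon>_up)
    have ev_lo: "\<forall>\<^sub>F n in sequentially. (c - \<eta>) * L n \<le> lo n"
    proof -
      have "(\<lambda>n. \<kappa> / (1 + \<epsilon>)\<^sup>2 * (\<theta> * (harm2 n / L n) - \<epsilon> - B * (harm n / L n)))
          \<longlonglongrightarrow> \<kappa> / (1 + \<epsilon>)\<^sup>2 * (\<theta> * (1 / 2) - \<epsilon> - B * 0)"
        by (intro tendsto_diff tendsto_mult tendsto_const lim_h lim_h2)
      then have "\<forall>\<^sub>F n in sequentially. c - \<eta> < \<kappa> / (1 + \<epsilon>)\<^sup>2 * (\<theta> * (harm2 n / L n) - \<epsilon> - B * (harm n / L n))"
        using \<epsilon>_down by (intro order_tendstoD(1)) auto
      then show ?thesis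
        using L_pos
      proof eventually_elim
        case (elim n)
        have "\<kappa> / (1 + \<epsilon>)\<^sup>2 * (\<theta> * (harm2 n / L n) - \<epsilon> - B * (harm n / L n)) = lo n / L n"
          using elim(2) by (simp add: lo_def diff_divide_distrib right_diff_distrib)
        then show ?case using elim by (simp add: pos_less_divide_eq less_imp_le)
      qed
    qed
    have ev_few: "\<forall>\<^sub>F n in sequentially. q * real i0 \<le> \<eta> * L n"
      using lim_c \<eta>(1) L_pos by (rule eventually_sequentially_scaled_le)
    define C where "C = 2 * (real m * (real m + 1) * (real m + 2) * (real m + 3))"
    have ev_T: "\<forall>\<^sub>F n in sequentially. C * (harm n)\<^sup>2 / (\<epsilon> * L n)\<^sup>2 < \<delta> / 3"
    proof (rule order_tendstoD(2))
      have "(\<lambda>n. C / \<epsilon>\<^sup>2 * (harm n / L n)\<^sup>2) \<longlonglongrightarrow> C / \<epsilon>\<^sup>2 * 0\<^sup>2"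
        by (intro tendsto_mult tendsto_const tendsto_power lim_h)
      then show "(\<lambda>n. C * (harm n)\<^sup>2 / (\<epsilon> * L n)\<^sup>2) \<longlonglongrightarrow> 0"
        by (simp add: power_divide power_mult_distrib)
    qed (use \<open>0 < \<delta>\<close> in simp)
    have ev_cond: "\<forall>\<^sub>F n in sequentially. q * (c + \<eta>) / (\<eta>\<^sup>2 * L n) < \<delta> / 3"
    proof (rule order_tendstoD(2))
      show "(\<lambda>n. q * (c + \<eta>) / (\<eta>\<^sup>2 * L n)) \<longlonglongrightarrow> 0"
        using lim_c[of "q * (c + \<eta>) / \<eta>\<^sup>2"] by simp
    qed (use \<open>0 < \<delta>\<close> in simp)
    show "\<forall>\<^sub>F n in sequentially. dist (?P n) 0 < \<delta>"
      using ev_hi ev_lo ev_few ev_T ev_cond L_pos eventually_ge_at_top[of "max i0 1"]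
    proof eventually_elim
      case (elim n)
      interpret bollobas_riordan "M n" m n "w n" "l n" using elim by (intro br) simp
      have \<kappa>: "\<kappa> / x = (real m - 1) / (8 * real m * x)" for x by (simp add: \<kappa>_def)
      have "?P n \<le> 288 / (\<epsilon> ^ 4 * real i0) + C * (harm n)\<^sup>2 / (\<epsilon> * L n)\<^sup>2 + q * (c + \<eta>) / (\<eta>\<^sup>2 * L n)"
        unfolding C_def q_def \<eta>(2) L_def[symmetric]
      \<comment> \<open>The tolerance \<zeta> of the weighted sum is taken equal to
        \<epsilon>.\<close>
      proof (rule br_parallel_pairs_deviation[OF m \<epsilon> i0_ge _ \<eta>(1) \<epsilon>(1) elim(6) c])
        show "i0 \<le> n" using elim by simp
      qed (use elim in \<open>simp_all add: hi_def lo_def A_def B_def \<kappa> \<theta>_def q_def\<close>)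
      then have "?P n < \<delta>" using elim(4,5) i0_\<delta> by linarith
      then show ?case by (simp add: dist_real_def)
    qed
  qed
  then show "(\<lambda>n. measure (M n) {\<omega>\<in>space (M n). \<bar>real (br_parallel_pairs m n (w n) (l n) \<omega>) / (ln (real n))\<^sup>2
      - ((real m)\<^sup>2 - 1) / 16\<bar> > \<eta>'}) \<longlonglongrightarrow> 0"
    by (simp add: c_def)
qed

text \<open>Convergence in probability is used at one tolerance only. The implication is asked for
  almost surely, which is what the comparison of parallel pairs with the edge reduction
  provides.\<close>

lemma with_high_probabilityI:
  fixes X :: "nat \<Rightarrow> 'a \<Rightarrow> real"
  assumes X: "tendsto_in_probability M X c" and "0 < \<epsilon>"
    and prob: "\<forall>\<^sub>F n in sequentially. prob_space (M n)"
    and X_meas: "\<forall>\<^sub>F n in sequentially. {\<omega>\<in>space (M n). \<bar>X n \<omega> - c\<bar> > \<epsilon>} \<in> sets (M n)"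
    and Q_meas: "\<forall>\<^sub>F n in sequentially. {\<omega>\<in>space (M n). Q n \<omega>} \<in> sets (M n)"
    and imp: "\<forall>\<^sub>F n in sequentially. AE \<omega> in M n. \<bar>X n \<omega> - c\<bar> \<le> \<epsilon> \<longrightarrow> Q n \<omega>"
  shows "with_high_probability M Q"
  unfolding with_high_probability_def
proof (rule tendsto_sandwich)
  let ?B = "\<lambda>n. {\<omega>\<in>space (M n). \<bar>X n \<omega> - c\<bar> > \<epsilon>}"
  have "(\<lambda>n. measure (M n) (?B n)) \<longlonglongrightarrow> 0"
    using X \<open>0 < \<epsilon>\<close> by (simp add: tendsto_in_probability_def)
  from tendsto_diff[OF tendsto_const this, of 1] show "(\<lambda>n. 1 - measure (M n) (?B n)) \<longlonglongrightarrow> 1" by simp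
  show "\<forall>\<^sub>F n in sequentially. 1 - measure (M n) (?B n) \<le> measure (M n) {\<omega>\<in>space (M n). Q n \<omega>}"
    using prob X_meas Q_meas imp
  proof eventually_elim
    case (elim n)
    interpret prob_space "M n" by fact
    have "1 - measure (M n) (?B n) = measure (M n) (space (M n) - ?B n)"
      using elim by (simp add: prob_compl)
    also have "\<dots> \<le> measure (M n) {\<omega>\<in>space (M n). Q n \<omega>}"
    proof (rule finite_measure_mono_AE)
      show "AE \<omega> in M n. \<omega> \<in> space (M n) - ?B n \<longrightarrow> \<omega> \<in> {\<omega>\<in>space (M n). Q n \<omega>}"
        using elim(4) by eventually_elim auto
    qed (use elim in auto)
    finally show ?case .
  qed
  show "\<forall>\<^sub>F n in sequentially. measure (M n) {\<omega>\<in>space (M n). Q n \<omega>} \<le> 1"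
    using prob by eventually_elim (rule prob_space.prob_le_1)
qed simp

text \<open>The order of magnitude of the reduction is stated as two one-sided bounds. The lower one
  is restricted to \<open>m >= 2\<close> because for \<open>m = 1\<close> a block has a single edge,
  so that almost surely there are no parallel edges.\<close>

theorem theorem2p6:
  fixes m :: nat and M :: "nat \<Rightarrow> 'a measure" and w l :: "nat \<Rightarrow> nat \<Rightarrow> 'a \<Rightarrow> real"
  assumes "m \<ge> 1"
    and "\<And>n. n \<ge> 1 \<Longrightarrow> bollobas_riordan (M n) m n (w n) (l n)"
  shows "tendsto_in_probability M
           (\<lambda>n \<omega>. real (br_parallel_pairs m n (w n) (l n) \<omega>) / (ln (real n))\<^sup>2)
           (((real m)\<^sup>2 - 1) / 16)
         \<and> (\<exists>C>0. with_high_probability M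
             (\<lambda>n \<omega>. br_edge_reduction m n (w n) (l n) \<omega> \<le> C * (ln (real n))\<^sup>2))
         \<and> (m \<ge> 2 \<longrightarrow> (\<exists>c>0. with_high_probability M
             (\<lambda>n \<omega>. c * (ln (real n))\<^sup>2 \<le> br_edge_reduction m n (w n) (l n) \<omega>)))"
proof -
  define c where "c = ((real m)\<^sup>2 - 1) / 16"
  let ?P = "\<lambda>n \<omega>. real (br_parallel_pairs m n (w n) (l n) \<omega>)"
  let ?X = "\<lambda>n \<omega>. ?P n \<omega> / (ln (real n))\<^sup>2"
  let ?R = "\<lambda>n \<omega>. br_edge_reduction m n (w n) (l n) \<omega>"
  have X: "tendsto_in_probability M ?X c"
    unfolding c_def by (rule tendsto_in_probability_parallel_pairs) (use assms in auto)
  have large: "\<forall>\<^sub>F n in sequentially. 2 \<le> (n::nat)" by (rule eventually_ge_at_top)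
  have prob: "\<forall>\<^sub>F n in sequentially. prob_space (M n)"
    using large by eventually_elim (rule bollobas_riordan.axioms(1)[OF assms(2)], simp)
  have X_meas: "\<forall>\<^sub>F n in sequentially. {\<omega>\<in>space (M n). \<bar>?X n \<omega> - c\<bar> > \<epsilon>} \<in> sets (M n)" for \<epsilon>
    using large
  proof eventually_elim
    case (elim n)
    interpret bollobas_riordan "M n" m n "w n" "l n" using elim by (intro assms(2)) simp
    show ?case
      unfolding br_parallel_pairs_def
      by (rule sets_Collect_ends) (metis num_parallel_pairs_cong)
  qed
  have R_meas: "\<forall>\<^sub>F n in sequentially. {\<omega>\<in>space (M n). Q n (?R n \<omega>)} \<in> sets (M n)" for Q
    using large
  proof eventually_elim
    case (elim n)
    interpret bollobas_riordan "M n" m n "w n" "l n" using elim by (intro assms(2)) simp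
    show ?case
      unfolding br_edge_reduction_def
      by (rule sets_Collect_ends) (metis edge_reduction_cong)
  qed
  \<comment> \<open>Tolerance 1 gives the constant \<open>c + 1\<close>, which is positive even for
    \<open>m = 1\<close>, where \<open>c = 0\<close>.\<close>
  have "with_high_probability M (\<lambda>n \<omega>. ?R n \<omega> \<le> (c + 1) * (ln (real n))\<^sup>2)"
  proof (rule with_high_probabilityI[OF X zero_less_one prob X_meas R_meas])
    show "\<forall>\<^sub>F n in sequentially. AE \<omega> in M n. \<bar>?X n \<omega> - c\<bar> \<le> 1 \<longrightarrow> ?R n \<omega> \<le> (c + 1) * (ln (real n))\<^sup>2"
      using large
    proof (eventually_elim, intro AE_I2 impI)
      fix n \<omega> assume n: "2 \<le> n" and dev: "\<bar>?X n \<omega> - c\<bar> \<le> 1"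
      have "0 < (ln (real n))\<^sup>2" using n by simp
      have "?R n \<omega> \<le> ?P n \<omega>"
        unfolding br_edge_reduction_def br_parallel_pairs_def
        by (rule edge_reduction_le_num_parallel_pairs) simp
      also have "?P n \<omega> = ?X n \<omega> * (ln (real n))\<^sup>2" using \<open>0 < (ln (real n))\<^sup>2\<close> by simp
      also have "\<dots> \<le> (c + 1) * (ln (real n))\<^sup>2" using dev by (intro mult_right_mono) auto
      finally show "?R n \<omega> \<le> (c + 1) * (ln (real n))\<^sup>2" .
    qed
  qed
  moreover have "0 \<le> c" using assms(1) by (simp add: c_def)
  then have "0 < c + 1" by linarith
  moreover have "\<exists>c'>0. with_high_probability M (\<lambda>n \<omega>. c' * (ln (real n))\<^sup>2 \<le> ?R n \<omega>)" if "m \<ge> 2"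
  proof (intro exI conjI)
    \<comment> \<open>Now \<open>c\<close> is positive, so \<open>c / 2\<close> is an admissible
      tolerance. The witness \<open>c / (2 * real m)\<close> has one factor \<open>1 / 2\<close>
      from this tolerance and the factor \<open>1 / m\<close> from the pairs charged to each lost
      edge.\<close>
    have "1 < (real m)\<^sup>2" using that by (simp add: one_less_power)
    then have c: "0 < c / 2" by (simp add: c_def)
    then show "0 < c / (2 * real m)" using assms(1) by simp
    show "with_high_probability M (\<lambda>n \<omega>. c / (2 * real m) * (ln (real n))\<^sup>2 \<le> ?R n \<omega>)"
    proof (rule with_high_probabilityI[OF X c prob X_meas R_meas])
      show "\<forall>\<^sub>F n in sequentially. AE \<omega> in M n. \<bar>?X n \<omega> - c\<bar> \<le> c / 2 \<longrightarrow> c / (2 * real m) * (ln (real n))\<^sup>2 \<le> ?R n \<omega>"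
        using large
      proof eventually_elim
        case (elim n)
        interpret bollobas_riordan "M n" m n "w n" "l n" using elim by (intro assms(2)) simp
        have "0 < (ln (real n))\<^sup>2" using elim by simp
        show ?case using AE_parallel_pairs_le_reduction[OF assms(1)]
        proof (eventually_elim, intro impI)
          fix \<omega> assume le: "?P n \<omega> \<le> real m * ?R n \<omega>" and dev: "\<bar>?X n \<omega> - c\<bar> \<le> c / 2"
          have "c / 2 \<le> ?X n \<omega>" using dev by linarith
          then have "c / 2 * (ln (real n))\<^sup>2 \<le> ?X n \<omega> * (ln (real n))\<^sup>2"
            by (rule mult_right_mono) simp
          also have "\<dots> = ?P n \<omega>" using \<open>0 < (ln (real n))\<^sup>2\<close> by simp
          also note le
          finally show "c / (2 * real m) * (ln (real n))\<^sup>2 \<le> ?R n \<omega>"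
            using assms(1) by (simp add: field_simps)
        qed
      qed
    qed
  qed
  ultimately show ?thesis using X unfolding c_def by blast
qed

end
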